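(* Let $\mathcal F$ be a Kähler foliation of codimension $q=2m$ with $m\ge 2$ on a compact Riemannian manifold $(M,g_M)$. Then every transversal projective field of $\mathcal F$ is a transversal affine field of $\mathcal F$.
   Context: Setting. $(M,g_M)$ is a Riemannian manifold of dimension $n=p+q$ with a foliation $\mathcal F$ of codimension $q$ and a bundle-like metric $g_M$. $L\subset TM$ is the tangent bundle of $\mathcal F$, $Q=TM/L$ the normal bundle, $\pi:TM\to Q$ the projection, $\sigma:Q\to L^\perp$ the bundle isomorphism with $\pi\circ\sigma=\mathrm{id}$; $g_Q(s,t)=g_M(\sigma(s),\sigma(t))$ is the induced holonomy invariant metric on $Q$, and $Q$ is identified with $L^\perp$. For $s\in\Gamma Q$ put $Y_s=\sigma(s)$. The transversal Levi-Civita connection $\nabla$ in $Q$ is $\nabla_Xs=\pi([X,Y_s])$ for $X\in\Gamma L$ and $\nabla_Xs=\pi(\nabla^M_XY_s)$ for $X\in\Gamma L^\perp$, where $\nabla^M$ is the Levi-Civita connection of $g_M$; its curvature is $R^\nabla(X,Z)=[\nabla_X,\nabla_Z]-\nabla_{[X,Z]}$, which vanishes when one argument is in $L$. Kähler foliation: a foliation of even codimension $q=2m$ with bundle-like $g_M$, together with a holonomy invariant almost complex structure $J:Q\to Q$ such that $g_Q(JX,JZ)=g_Q(X,Z)$ for $X,Z\in\Gamma Q$ and $\nabla J=0$. Infinitesimal automorphisms. $V(\mathcal F)$ is the space of vector fields $Y$ on $M$ with $[Y,Z]\in\Gamma L$ for all $Z\in\Gamma L$; write $\bar Y=\pi(Y)$.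 A differential form $\omega$ is basic if $i(X)\omega=0$ and $\mathcal L_X\omega=0$ (Lie derivative) for all $X\in\Gamma L$. For $Y\in V(\mathcal F)$, the Lie derivative $\theta(Y)\nabla$ of the connection is given by $(\theta(Y)\nabla)(Z,X)=R^\nabla(\bar Y,\bar Z)X+\nabla_{\bar Z}\nabla_X\bar Y-\nabla_{\nabla_ZX}\bar Y$ for $Z\in V(\mathcal F)$, $X\in\Gamma Q$. For $Y\in V(\mathcal F)$: $\bar Y$ is a transversal affine field if $\theta(Y)\nabla=0$; $\bar Y$ is a transversal projective field if there is a basic 1-form $\alpha_Y$ on $M$ with $(\theta(Y)\nabla)(X,Z)=\alpha_Y(X)Z+\alpha_Y(Z)X$ for all $X,Z\in\Gamma Q$. *)

theory Defs
  imports "HOL-Analysis.Analysis"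
begin

section \<open>Smooth maps between Euclidean spaces\<close>

text \<open>Only used for open \<open>S\<close>.  In finite dimension, being differentiable with all directional
  derivatives of class \<open>k\<close> is the usual notion of class \<open>k + 1\<close>.\<close>

primrec Ck_on ::
  "nat \<Rightarrow> 'x::euclidean_space set \<Rightarrow> ('x \<Rightarrow> 'y::real_normed_vector) \<Rightarrow> bool" where
  "Ck_on 0 S f = continuous_on S f"
| "Ck_on (Suc k) S f =
     ((\<forall>x\<in>S. f differentiable (at x)) \<and> (\<forall>v. Ck_on k S (\<lambda>x. frechet_derivative f (at x) v)))"

definition smooth_on :: "'x::euclidean_space set \<Rightarrow> ('x \<Rightarrow> 'y::real_normed_vector) \<Rightarrow> bool" where
  "smooth_on S f \<longleftrightarrow> (\<forall>k. Ck_on k S f)"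


section \<open>Smooth manifolds\<close>

text \<open>The manifold \<open>M\<close> is the whole type \<open>'a\<close>, whose class provides the Hausdorff and second
  countable topology, together with a smooth atlas; its dimension is \<open>CARD('n)\<close>.\<close>

type_synonym ('a, 'n) chart = "'a set \<times> ('a \<Rightarrow> real^'n)"

definition chart_inv :: "('a, 'n::finite) chart \<Rightarrow> real^'n \<Rightarrow> 'a" where
  "chart_inv c = inv_into (fst c) (snd c)"

definition smooth_atlas ::
  "('a::{t2_space,second_countable_topology}, 'n::finite) chart set \<Rightarrow> bool" where
  "smooth_atlas A \<longleftrightarrow>
     (\<forall>c\<in>A. open (fst c) \<and> open (snd c ` fst c) \<and>
             homeomorphism (fst c) (snd c ` fst c) (snd c) (chart_inv c)) \<and>
     (\<Union>c\<in>A. fst c) = UNIV \<and>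
     (\<forall>c\<in>A. \<forall>e\<in>A. smooth_on (snd c ` (fst c \<inter> fst e)) (snd e \<circ> chart_inv c))"

definition smooth_fun_on ::
  "('a::topological_space, 'n::finite) chart set \<Rightarrow> 'a set \<Rightarrow> ('a \<Rightarrow> 'y::real_normed_vector) \<Rightarrow> bool"
  where
  "smooth_fun_on A U f \<longleftrightarrow> (\<forall>c\<in>A. smooth_on (snd c ` (fst c \<inter> U)) (f \<circ> chart_inv c))"

text \<open>Each tangent space \<open>T\<^sub>xM\<close> is identified with \<open>real^'n\<close> by means of one
  chart around \<open>x\<close>, chosen once and for all: \<open>v :: real^'n\<close> stands for the tangent vector with components
  \<open>v\<close> in the chart \<open>chart_at A x\<close>.  Since the chosen chart may vary discontinuously with \<open>x\<close>, smoothness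
  of a vector field is never read off from the function itself but from its components in the charts of
  the atlas.\<close>

definition chart_at :: "('a, 'n::finite) chart set \<Rightarrow> 'a \<Rightarrow> ('a, 'n) chart" where
  "chart_at A x = (SOME c. c \<in> A \<and> x \<in> fst c)"

definition differential ::
  "('a, 'n::finite) chart set \<Rightarrow> ('a \<Rightarrow> 'y::real_normed_vector) \<Rightarrow> 'a \<Rightarrow> real^'n \<Rightarrow> 'y" where
  "differential A f x v =
     frechet_derivative (f \<circ> chart_inv (chart_at A x)) (at (snd (chart_at A x) x)) v"

type_synonym ('a, 'n) vfield = "'a \<Rightarrow> real^'n"

definition components ::
  "('a, 'n::finite) chart set \<Rightarrow> ('a, 'n) chart \<Rightarrow> ('a, 'n) vfield \<Rightarrow> real^'n \<Rightarrow> real^'n" where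
  "components A c X y = differential A (snd c) (chart_inv c y) (X (chart_inv c y))"

definition vfields :: "('a, 'n::finite) chart set \<Rightarrow> ('a, 'n) vfield set" where
  "vfields A = {X. \<forall>c\<in>A. smooth_on (snd c ` fst c) (components A c X)}"

definition deriv_along ::
  "('a, 'n::finite) chart set \<Rightarrow> ('a, 'n) vfield \<Rightarrow> ('a \<Rightarrow> real) \<Rightarrow> 'a \<Rightarrow> real" where
  "deriv_along A X f x = differential A f x (X x)"

text \<open>The coordinate formula \<open>[X,Y]\<^sup>j = \<Sum>\<^sub>i X\<^sup>i \<partial>\<^sub>i Y\<^sup>j - Y\<^sup>i \<partial>\<^sub>i X\<^sup>j\<close> in the chart
  \<open>chart_at A x\<close>, in which \<open>X\<close> and \<open>Y\<close> have the components \<open>X x\<close> and \<open>Y x\<close> at \<open>x\<close>.\<close>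

definition lie_bracket ::
  "('a, 'n::finite) chart set \<Rightarrow> ('a, 'n) vfield \<Rightarrow> ('a, 'n) vfield \<Rightarrow> ('a, 'n) vfield" where
  "lie_bracket A X Y x =
     (let c = chart_at A x; y = snd c x in
        frechet_derivative (components A c Y) (at y) (X x) -
        frechet_derivative (components A c X) (at y) (Y x))"


section \<open>Riemannian metrics and the Levi-Civita connection\<close>

type_synonym ('a, 'n) metric = "'a \<Rightarrow> real^'n \<Rightarrow> real^'n \<Rightarrow> real"

definition riemannian_metric :: "('a::topological_space, 'n::finite) chart set \<Rightarrow> ('a, 'n) metric \<Rightarrow> bool"
  where
  "riemannian_metric A g \<longleftrightarrow>
     (\<forall>x. bilinear (g x)) \<and>
     (\<forall>x v w. g x v w = g x w v) \<and>
     (\<forall>x v. v \<noteq> 0 \<longrightarrow> g x v v > 0) \<and>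
     (\<forall>X\<in>vfields A. \<forall>Y\<in>vfields A. smooth_fun_on A UNIV (\<lambda>x. g x (X x) (Y x)))"

type_synonym ('a, 'n) connection = "('a, 'n) vfield \<Rightarrow> ('a, 'n) vfield \<Rightarrow> ('a, 'n) vfield"

definition affine_connection ::
  "('a::topological_space, 'n::finite) chart set \<Rightarrow> ('a, 'n) connection \<Rightarrow> bool" where
  "affine_connection A D \<longleftrightarrow>
     (\<forall>X\<in>vfields A. \<forall>Y\<in>vfields A. D X Y \<in> vfields A) \<and>
     (\<forall>X\<in>vfields A. \<forall>X'\<in>vfields A. \<forall>Y\<in>vfields A.
        D (\<lambda>x. X x + X' x) Y = (\<lambda>x. D X Y x + D X' Y x)) \<and>
     (\<forall>f X Y. smooth_fun_on A UNIV f \<and> X \<in> vfields A \<and> Y \<in> vfields A \<longrightarrow>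
        D (\<lambda>x. f x *\<^sub>R X x) Y = (\<lambda>x. f x *\<^sub>R D X Y x)) \<and>
     (\<forall>X\<in>vfields A. \<forall>Y\<in>vfields A. \<forall>Y'\<in>vfields A.
        D X (\<lambda>x. Y x + Y' x) = (\<lambda>x. D X Y x + D X Y' x)) \<and>
     (\<forall>f X Y. smooth_fun_on A UNIV f \<and> X \<in> vfields A \<and> Y \<in> vfields A \<longrightarrow>
        D X (\<lambda>x. f x *\<^sub>R Y x) = (\<lambda>x. deriv_along A X f x *\<^sub>R Y x + f x *\<^sub>R D X Y x))"

definition levi_civita ::
  "('a::topological_space, 'n::finite) chart set \<Rightarrow> ('a, 'n) metric \<Rightarrow> ('a, 'n) connection \<Rightarrow> bool" where
  "levi_civita A g D \<longleftrightarrow>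
     affine_connection A D \<and>
     (\<forall>X\<in>vfields A. \<forall>Y\<in>vfields A. \<forall>x. D X Y x - D Y X x = lie_bracket A X Y x) \<and>
     (\<forall>X\<in>vfields A. \<forall>Y\<in>vfields A. \<forall>Z\<in>vfields A. \<forall>x.
        deriv_along A X (\<lambda>x. g x (Y x) (Z x)) x = g x (D X Y x) (Z x) + g x (Y x) (D X Z x))"


section \<open>Foliations\<close>

text \<open>A foliation of codimension \<open>CARD('q)\<close> is given by a Haefliger cocycle: local submersions onto open
  subsets of \<open>real^'q\<close>, covering \<open>M\<close>, any two of which differ locally by a smooth change \<open>\<gamma>\<close> of the
  transverse coordinates.  Exchanging the two submersions shows that \<open>\<gamma>\<close> is a local diffeomorphism.
  The leaves are locally the fibres of the submersions.\<close>

type_synonym ('a, 'q) cocycle = "('a set \<times> ('a \<Rightarrow> real^'q)) set"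

definition foliation ::
  "('a::topological_space, 'n::finite) chart set \<Rightarrow> ('a, 'q::finite) cocycle \<Rightarrow> bool" where
  "foliation A F \<longleftrightarrow>
     (\<forall>(U, f)\<in>F. open U \<and> smooth_fun_on A U f \<and> (\<forall>x\<in>U. surj (differential A f x))) \<and>
     (\<Union>(U, f)\<in>F. U) = UNIV \<and>
     (\<forall>(U, f)\<in>F. \<forall>(W, h)\<in>F. \<forall>x\<in>U \<inter> W. \<exists>N \<gamma>.
        open N \<and> x \<in> N \<and> N \<subseteq> U \<inter> W \<and> open (f ` N) \<and> smooth_on (f ` N) \<gamma> \<and> (\<forall>y\<in>N. h y = \<gamma> (f y)))"

text \<open>The fibre \<open>L\<^sub>x\<close> of the tangent bundle of the foliation.\<close>

definition leaf_tangent :: "('a, 'n::finite) chart set \<Rightarrow> ('a, 'q::finite) cocycle \<Rightarrow> 'a \<Rightarrow> (real^'n) set"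
  where
  "leaf_tangent A F x = {v. \<forall>(U, f)\<in>F. x \<in> U \<longrightarrow> differential A f x v = 0}"

text \<open>The normal bundle \<open>Q = TM/L\<close> is identified with \<open>L\<^sup>\<bottom>\<close> by means of \<open>\<sigma>\<close>.  Hence \<open>Y\<^sub>s = s\<close> for a
  section \<open>s\<close> of \<open>Q\<close>, the projection \<open>\<pi>\<close> is the orthogonal projection to \<open>L\<^sup>\<bottom>\<close>, and \<open>g\<^sub>Q\<close> is
  the restriction of \<open>g\<^sub>M\<close> to \<open>L\<^sup>\<bottom>\<close>.\<close>

definition normal_space ::
  "('a, 'n::finite) chart set \<Rightarrow> ('a, 'n) metric \<Rightarrow> ('a, 'q::finite) cocycle \<Rightarrow> 'a \<Rightarrow> (real^'n) set" where
  "normal_space A g F x = {v. \<forall>w\<in>leaf_tangent A F x. g x v w = 0}"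

definition sections_L :: "('a, 'n::finite) chart set \<Rightarrow> ('a, 'q::finite) cocycle \<Rightarrow> ('a, 'n) vfield set"
  where
  "sections_L A F = {X \<in> vfields A. \<forall>x. X x \<in> leaf_tangent A F x}"

definition sections_Q ::
  "('a, 'n::finite) chart set \<Rightarrow> ('a, 'n) metric \<Rightarrow> ('a, 'q::finite) cocycle \<Rightarrow> ('a, 'n) vfield set" where
  "sections_Q A g F = {X \<in> vfields A. \<forall>x. X x \<in> normal_space A g F x}"

definition normal_part ::
  "('a, 'n::finite) chart set \<Rightarrow> ('a, 'n) metric \<Rightarrow> ('a, 'q::finite) cocycle \<Rightarrow>
   ('a, 'n) vfield \<Rightarrow> ('a, 'n) vfield" where
  "normal_part A g F X x =
     (THE v. v \<in> normal_space A g F x \<and> X x - v \<in> leaf_tangent A F x)"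

definition leaf_part ::
  "('a, 'n::finite) chart set \<Rightarrow> ('a, 'n) metric \<Rightarrow> ('a, 'q::finite) cocycle \<Rightarrow>
   ('a, 'n) vfield \<Rightarrow> ('a, 'n) vfield" where
  "leaf_part A g F X x = X x - normal_part A g F X x"

text \<open>The metric is bundle-like if \<open>\<theta>(X)g\<^sub>Q = 0\<close> for all sections \<open>X\<close> of \<open>L\<close>, where
  \<open>\<theta>(X)s = \<pi>[X,Y\<^sub>s]\<close>.\<close>

definition bundle_like ::
  "('a::topological_space, 'n::finite) chart set \<Rightarrow> ('a, 'n) metric \<Rightarrow> ('a, 'q::finite) cocycle \<Rightarrow> bool"
  where
  "bundle_like A g F \<longleftrightarrow>
     (\<forall>X\<in>sections_L A F. \<forall>s\<in>sections_Q A g F. \<forall>t\<in>sections_Q A g F. \<forall>x.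
        deriv_along A X (\<lambda>x. g x (s x) (t x)) x =
          g x (normal_part A g F (lie_bracket A X s) x) (t x) +
          g x (s x) (normal_part A g F (lie_bracket A X t) x))"

text \<open>Here and below \<open>D\<close> is the Levi-Civita connection of \<open>g\<close>, and an arbitrary vector field is
  split into its components in \<open>L\<close> and \<open>L\<^sup>\<bottom>\<close>.\<close>

definition transversal_connection ::
  "('a, 'n::finite) chart set \<Rightarrow> ('a, 'n) metric \<Rightarrow> ('a, 'q::finite) cocycle \<Rightarrow> ('a, 'n) connection \<Rightarrow>
   ('a, 'n) connection" where
  "transversal_connection A g F D X s =
     (\<lambda>x. normal_part A g F (lie_bracket A (leaf_part A g F X) s) x +
          normal_part A g F (D (normal_part A g F X) s) x)"

definition transversal_curvature ::
  "('a, 'n::finite) chart set \<Rightarrow> ('a, 'n) metric \<Rightarrow> ('a, 'q::finite) cocycle \<Rightarrow> ('a, 'n) connection \<Rightarrow>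
   ('a, 'n) vfield \<Rightarrow> ('a, 'n) vfield \<Rightarrow> ('a, 'n) vfield \<Rightarrow> ('a, 'n) vfield" where
  "transversal_curvature A g F D X Z s =
     (let N = transversal_connection A g F D in
        (\<lambda>x. N X (N Z s) x - N Z (N X s) x - N (lie_bracket A X Z) s x))"


section \<open>Kaehler foliations\<close>

text \<open>Only the values of \<open>J x\<close> on \<open>normal_space A g F x\<close> matter.\<close>

definition almost_complex_structure ::
  "('a::topological_space, 'n::finite) chart set \<Rightarrow> ('a, 'n) metric \<Rightarrow> ('a, 'q::finite) cocycle \<Rightarrow>
   ('a \<Rightarrow> real^'n \<Rightarrow> real^'n) \<Rightarrow> bool" where
  "almost_complex_structure A g F J \<longleftrightarrow>
     (\<forall>x. \<forall>v\<in>normal_space A g F x. J x v \<in> normal_space A g F x \<and> J x (J x v) = - v) \<and>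
     (\<forall>x. \<forall>v\<in>normal_space A g F x. \<forall>w\<in>normal_space A g F x. J x (v + w) = J x v + J x w) \<and>
     (\<forall>x r. \<forall>v\<in>normal_space A g F x. J x (r *\<^sub>R v) = r *\<^sub>R J x v) \<and>
     (\<forall>s\<in>sections_Q A g F. (\<lambda>x. J x (s x)) \<in> vfields A)"

definition kaehler_foliation ::
  "('a::topological_space, 'n::finite) chart set \<Rightarrow> ('a, 'n) metric \<Rightarrow> ('a, 'q::finite) cocycle \<Rightarrow>
   ('a, 'n) connection \<Rightarrow> ('a \<Rightarrow> real^'n \<Rightarrow> real^'n) \<Rightarrow> bool" where
  "kaehler_foliation A g F D J \<longleftrightarrow>
     foliation A F \<and> even CARD('q) \<and> bundle_like A g F \<and> almost_complex_structure A g F J \<and>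
     (\<forall>X\<in>sections_L A F. \<forall>s\<in>sections_Q A g F. \<forall>x.
        normal_part A g F (lie_bracket A X (\<lambda>x. J x (s x))) x =
        J x (normal_part A g F (lie_bracket A X s) x)) \<and>
     (\<forall>s\<in>sections_Q A g F. \<forall>t\<in>sections_Q A g F. \<forall>x. g x (J x (s x)) (J x (t x)) = g x (s x) (t x)) \<and>
     (\<forall>X\<in>vfields A. \<forall>s\<in>sections_Q A g F. \<forall>x.
        transversal_connection A g F D X (\<lambda>x. J x (s x)) x =
        J x (transversal_connection A g F D X s x))"


section \<open>Transversal affine and projective fields\<close>

definition infinitesimal_automorphisms ::
  "('a, 'n::finite) chart set \<Rightarrow> ('a, 'q::finite) cocycle \<Rightarrow> ('a, 'n) vfield set" where
  "infinitesimal_automorphisms A F =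
     {Y \<in> vfields A. \<forall>Z\<in>sections_L A F. lie_bracket A Y Z \<in> sections_L A F}"

text \<open>\<open>(\<L>\<^sub>X\<alpha>)(Z) = X(\<alpha>(Z)) - \<alpha>([X,Z])\<close>.\<close>

definition basic_1form ::
  "('a::topological_space, 'n::finite) chart set \<Rightarrow> ('a, 'q::finite) cocycle \<Rightarrow>
   ('a \<Rightarrow> real^'n \<Rightarrow> real) \<Rightarrow> bool" where
  "basic_1form A F \<alpha> \<longleftrightarrow>
     (\<forall>x. linear (\<alpha> x)) \<and>
     (\<forall>X\<in>vfields A. smooth_fun_on A UNIV (\<lambda>x. \<alpha> x (X x))) \<and>
     (\<forall>X\<in>sections_L A F. \<forall>x. \<alpha> x (X x) = 0) \<and>
     (\<forall>X\<in>sections_L A F. \<forall>Z\<in>vfields A. \<forall>x.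
        deriv_along A X (\<lambda>x. \<alpha> x (Z x)) x - \<alpha> x (lie_bracket A X Z x) = 0)"

text \<open>\<open>(\<theta>(Y)\<nabla>)(Z,X)\<close>, which depends on \<open>Z\<close> only through its normal part and is tensorial in \<open>Z\<close> and
  \<open>X\<close>.  The formula is therefore meaningful for \<open>Z\<close> in \<open>\<Gamma>Q\<close>, not only for \<open>Z\<close> in \<open>V(F)\<close>, and it is used
  in this generality in the definitions of affine and projective fields.\<close>

definition lie_connection ::
  "('a, 'n::finite) chart set \<Rightarrow> ('a, 'n) metric \<Rightarrow> ('a, 'q::finite) cocycle \<Rightarrow> ('a, 'n) connection \<Rightarrow>
   ('a, 'n) vfield \<Rightarrow> ('a, 'n) vfield \<Rightarrow> ('a, 'n) vfield \<Rightarrow> ('a, 'n) vfield" where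
  "lie_connection A g F D Y Z X =
     (let N = transversal_connection A g F D;
          Yb = normal_part A g F Y;
          Zb = normal_part A g F Z
      in (\<lambda>x. transversal_curvature A g F D Yb Zb X x + N Zb (N X Yb) x - N (N Zb X) Yb x))"

definition transversal_affine_field ::
  "('a, 'n::finite) chart set \<Rightarrow> ('a, 'n) metric \<Rightarrow> ('a, 'q::finite) cocycle \<Rightarrow> ('a, 'n) connection \<Rightarrow>
   ('a, 'n) vfield \<Rightarrow> bool" where
  "transversal_affine_field A g F D s \<longleftrightarrow>
     (\<exists>Y\<in>infinitesimal_automorphisms A F. s = normal_part A g F Y \<and>
        (\<forall>Z\<in>sections_Q A g F. \<forall>X\<in>sections_Q A g F. \<forall>x. lie_connection A g F D Y Z X x = 0))"

definition transversal_projective_field ::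
  "('a::topological_space, 'n::finite) chart set \<Rightarrow> ('a, 'n) metric \<Rightarrow> ('a, 'q::finite) cocycle \<Rightarrow>
   ('a, 'n) connection \<Rightarrow> ('a, 'n) vfield \<Rightarrow> bool" where
  "transversal_projective_field A g F D s \<longleftrightarrow>
     (\<exists>Y\<in>infinitesimal_automorphisms A F. s = normal_part A g F Y \<and>
        (\<exists>\<alpha>. basic_1form A F \<alpha> \<and>
          (\<forall>X\<in>sections_Q A g F. \<forall>Z\<in>sections_Q A g F. \<forall>x.
             lie_connection A g F D Y X Z x = \<alpha> x (X x) *\<^sub>R Z x + \<alpha> x (Z x) *\<^sub>R X x)))"

end

theory Submission
  imports Defs
begin

text \<open>
Write \<open>\<nabla>\<close> for the transversal connection, \<open>R\<close> for its curvature, \<open>Yb\<close> for the normal part of the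
infinitesimal automorphism \<open>Y\<close>, and \<open>B X = \<nabla>\<^sub>X Yb\<close>. The projective equation for \<open>Y\<close> with the
1-form \<open>\<alpha>\<close> is \<open>(\<nabla>\<^sub>Z B) X = \<alpha>(Z) X + \<alpha>(X) Z - R(Yb,Z) X\<close>. The point is to show \<open>\<alpha> = 0\<close>.

\<^item> A potential. Let \<open>Z\<close> be any vector field on \<open>M\<close>, and replace the factor \<open>Z\<close> by its normal part on
  the right: the equation persists, because \<open>R\<close> vanishes when one argument is tangent to the leaves
  (\<open>R_leaf_zero\<close>, \<open>lie_equation\<close>). As \<open>R(Yb,Z)\<close> is skew, the trace of the equation says
  that the derivative of \<open>tr B\<close> is \<open>(q + 1) \<alpha>\<close>. Thus \<open>\<alpha> = df\<close> for a function \<open>f\<close> on \<open>M\<close>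
  which is constant along the leaves (\<open>potential\<close>).

\<^item> The Hessian of \<open>f\<close>. The endomorphism \<open>K = J B - B J\<close> measures how far \<open>Y\<close> is from preserving
  \<open>J\<close>. It satisfies \<open>(\<nabla>\<^sub>Z K) W = \<alpha>(W) J Z - \<alpha>(J W) Z\<close>, from which the curvature has
  disappeared because \<open>R\<close> commutes with \<open>J\<close>. Differentiating once more and skew-symmetrizing gives,
  with \<open>H = \<nabla>\<alpha>\<close>,
  \<open>[R(X,Z), K] W = H(X,W) J Z - H(X,J W) Z - H(Z,W) J X + H(Z,J W) X\<close> (\<open>integrability\<close>).
  The left side does not change when \<open>(X,Z)\<close> is replaced by \<open>(J X, J Z)\<close>. Since \<open>q \<ge> 4\<close>, one can
  choose \<open>Z\<close> outside the plane of \<open>X\<close> and \<open>J X\<close> and compare the coefficients of \<open>J Z\<close>: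
  \<open>H(J X, J W) = - H(X, W)\<close> (\<open>Hess_anti_invariant\<close>).

\<^item> The maximum principle. Hence \<open>f\<close> solves \<open>H(E,E) + H(J E,J E) = 0\<close> for each section \<open>E\<close> of the
  normal bundle, and \<open>Z (Z f) = 0\<close> for each \<open>Z\<close> tangent to the leaves. The sum of these equations
  over the fields of a local frame is an elliptic equation on \<open>M\<close> without term of order zero. By
  the strong maximum principle of E. Hopf (\<open>strong_maximum_principle\<close>), \<open>f\<close> is constant near
  each local maximum point. On a connected component of the compact manifold \<open>M\<close> the function \<open>f\<close>
  attains its maximum on a set that is therefore open and closed, so \<open>f\<close> is locally constant and
  \<open>\<alpha> = 0\<close>.

All objects are given by vector fields defined on the whole of \<open>M\<close>, so local constructions are extended
with bump functions, and operators that are linear over the smooth functions are evaluated at a point by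
\<open>tensorial_zero\<close>. The smoothness of the normal part of a vector field comes from an explicit matrix
formula for the orthogonal projection (\<open>projection_matrix\<close>).
\<close>

section \<open>Smooth maps between Euclidean spaces\<close>

named_theorems smooth_intros

lemma Ck_on_cong:
  assumes "open S" "\<And>x. x \<in> S \<Longrightarrow> f x = g x" "Ck_on k S f"
  shows "Ck_on k S g"
  using assms(2,3)
proof (induction k arbitrary: f g)
  case 0
  then show ?case using continuous_on_cong by force
next
  case (Suc k)
  have df: "(f has_derivative frechet_derivative f (at x)) (at x)" if "x \<in> S" for x
    using Suc.prems(2) that frechet_derivative_works by auto
  have dg: "(g has_derivative frechet_derivative f (at x)) (at x)" if "x \<in> S" for x
    by (rule has_derivative_transform_within_open[OF df[OF that] assms(1) that]) (use Suc.prems in auto)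
  have eq: "frechet_derivative f (at x) = frechet_derivative g (at x)" if "x \<in> S" for x
    using dg[OF that] frechet_derivative_at by blast
  have "Ck_on k S (\<lambda>x. frechet_derivative g (at x) v)" for v
    by (rule Suc.IH[of "\<lambda>x. frechet_derivative f (at x) v"]) (use eq Suc.prems(2) in auto)
  then show ?case using dg by (auto simp: differentiable_def)
qed

text \<open>Any explicit derivative may be used in place of \<open>frechet_derivative\<close>. Every closure property of
\<open>Ck_on\<close> below is an induction on the order of differentiability with this rule.\<close>

lemma Ck_on_SucI:
  assumes "open S" "\<And>x. x \<in> S \<Longrightarrow> (f has_derivative f' x) (at x)"
    and "\<And>v. Ck_on k S (\<lambda>x. f' x v)"
  shows "Ck_on (Suc k) S f"
proof -
  have eq: "f' x = frechet_derivative f (at x)" if "x \<in> S" for x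
    using assms(2)[OF that] frechet_derivative_at by blast
  have "Ck_on k S (\<lambda>x. frechet_derivative f (at x) v)" for v
    by (rule Ck_on_cong[OF assms(1) _ assms(3)[of v]]) (simp add: eq)
  then show ?thesis using assms(2) by (auto simp: differentiable_def)
qed

lemma Ck_on_SucD:
  assumes "Ck_on (Suc k) S f" "x \<in> S"
  shows "(f has_derivative frechet_derivative f (at x)) (at x)"
  using assms frechet_derivative_works by auto

lemma Ck_on_SucD2: "Ck_on (Suc k) S f \<Longrightarrow> Ck_on k S (\<lambda>x. frechet_derivative f (at x) v)"
  by simp

lemma Ck_on_Suc_imp: "Ck_on (Suc k) S f \<Longrightarrow> Ck_on k S f"
proof (induction k arbitrary: f)
  case 0
  then show ?case
    by (auto intro!: continuous_at_imp_continuous_on differentiable_imp_continuous_within)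
next
  case (Suc k)
  then show ?case by (metis Ck_on.simps(2))
qed

lemma Ck_on_open_subset: "Ck_on k S f \<Longrightarrow> T \<subseteq> S \<Longrightarrow> Ck_on k T f"
proof (induction k arbitrary: f)
  case 0
  then show ?case using continuous_on_subset by auto
next
  case (Suc k)
  then show ?case by (auto simp: subset_iff)
qed

lemma Ck_on_const: "Ck_on k S (\<lambda>x. c)"
proof (induction k arbitrary: c)
  case (Suc k)
  have "frechet_derivative (\<lambda>x. c) (at x) v = 0" for x v
    using frechet_derivative_at[OF has_derivative_const[of c "at x"]] by metis
  then show ?case using Suc.IH[of 0] by simp
qed simp

lemma Ck_on_bounded_linear:
  assumes "open S" "bounded_linear L" "Ck_on k S f"
  shows "Ck_on k S (\<lambda>x. L (f x))"
  using assms(3)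
proof (induction k arbitrary: f)
  case 0
  then show ?case using assms(2) by (simp add: bounded_linear.continuous_on)
next
  case (Suc k)
  show ?case
  proof (rule Ck_on_SucI[OF assms(1)])
    show "((\<lambda>x. L (f x)) has_derivative (\<lambda>v. L (frechet_derivative f (at x) v))) (at x)" if "x \<in> S" for x
      using bounded_linear.has_derivative[OF assms(2) Ck_on_SucD[OF Suc.prems that]] .
    show "Ck_on k S (\<lambda>x. L (frechet_derivative f (at x) v))" for v
      by (rule Suc.IH[OF Ck_on_SucD2[OF Suc.prems]])
  qed
qed

lemma Ck_on_id: "open S \<Longrightarrow> Ck_on k S (\<lambda>x. x)"
proof (cases k)
  case (Suc k')
  assume "open S"
  then show ?thesis unfolding Suc
    by (rule Ck_on_SucI[where f' = "\<lambda>x v. v"]) (auto intro: Ck_on_const)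
qed simp

lemma Ck_on_add:
  assumes "open S"
  shows "Ck_on k S f \<Longrightarrow> Ck_on k S g \<Longrightarrow> Ck_on k S (\<lambda>x. f x + g x)"
proof (induction k arbitrary: f g)
  case 0
  then show ?case by (simp add: continuous_on_add)
next
  case (Suc k)
  show ?case
    by (rule Ck_on_SucI[OF assms has_derivative_add[OF Ck_on_SucD[OF Suc.prems(1)] Ck_on_SucD[OF Suc.prems(2)]]
          Suc.IH[OF Ck_on_SucD2[OF Suc.prems(1)] Ck_on_SucD2[OF Suc.prems(2)]]])
qed

lemma Ck_on_bilinear:
  assumes "open S" "bounded_bilinear P"
  shows "Ck_on k S f \<Longrightarrow> Ck_on k S g \<Longrightarrow> Ck_on k S (\<lambda>x. P (f x) (g x))"
proof (induction k arbitrary: f g)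
  case 0
  then show ?case using assms by (simp add: bounded_bilinear.continuous_on)
next
  case (Suc k)
  show ?case
    by (rule Ck_on_SucI[OF assms(1) bounded_bilinear.FDERIV[OF assms(2) Ck_on_SucD[OF Suc.prems(1)] Ck_on_SucD[OF Suc.prems(2)]]])
      (auto intro!: Ck_on_add[OF assms(1)] Suc.IH Ck_on_SucD2[OF Suc.prems(1)] Ck_on_SucD2[OF Suc.prems(2)]
         Ck_on_Suc_imp[OF Suc.prems(1)]  Ck_on_Suc_imp[OF Suc.prems(2)])
qed

lemma Ck_on_sum:
  assumes "open S"
  shows "(\<And>i. i \<in> I \<Longrightarrow> Ck_on k S (f i)) \<Longrightarrow> Ck_on k S (\<lambda>x. \<Sum>i\<in>I. f i x)"
proof (induction I rule: infinite_finite_induct)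
  case (insert a I)
  then show ?case using Ck_on_add[OF assms, of k "f a"] by simp
qed (auto intro: Ck_on_const)

lemma linear_euclidean_expansion:
  fixes L :: "'x::euclidean_space \<Rightarrow> 'y::real_vector"
  assumes "linear L"
  shows "L w = (\<Sum>b\<in>Basis. (w \<bullet> b) *\<^sub>R L b)"
proof -
  have "L w = L (\<Sum>b\<in>Basis. (w \<bullet> b) *\<^sub>R b)" by (simp add: euclidean_representation)
  then show ?thesis by (simp add: linear_sum[OF assms] linear_scale[OF assms])
qed

text \<open>The chain rule produces the derivative of \<open>f\<close> in a direction that depends on the point. Its expansion in
the standard basis brings it into the form to which the induction hypothesis applies.\<close>

lemma Ck_on_compose:
  fixes h :: "'x::euclidean_space \<Rightarrow> 'y::euclidean_space" and f :: "'y \<Rightarrow> 'z::real_normed_vector"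
  assumes "open S" "open T" "h ` S \<subseteq> T"
  shows "Ck_on k T f \<Longrightarrow> Ck_on k S h \<Longrightarrow> Ck_on k S (\<lambda>x. f (h x))"
proof (induction k arbitrary: f)
  case 0
  then show ?case using assms continuous_on_compose2[of T f S h] by simp
next
  case (Suc k)
  show ?case
  proof (rule Ck_on_SucI[OF assms(1)])
    fix x assume x: "x \<in> S"
    then have hx: "h x \<in> T" using assms by auto
    have lin: "linear (frechet_derivative f (at (h x)))"
      using Ck_on_SucD[OF Suc.prems(1) hx] has_derivative_linear by blast
    have "((\<lambda>x. f (h x)) has_derivative (\<lambda>v. frechet_derivative f (at (h x)) (frechet_derivative h (at x) v))) (at x)"
      using diff_chain_at[OF Ck_on_SucD[OF Suc.prems(2) x] Ck_on_SucD[OF Suc.prems(1) hx]]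
      by (simp add: o_def)
    moreover have "(\<lambda>v. frechet_derivative f (at (h x)) (frechet_derivative h (at x) v)) =
        (\<lambda>v. \<Sum>b\<in>Basis. (frechet_derivative h (at x) v \<bullet> b) *\<^sub>R frechet_derivative f (at (h x)) b)"
      by (rule ext) (rule linear_euclidean_expansion[OF lin])
    ultimately show "((\<lambda>x. f (h x)) has_derivative
        (\<lambda>v. \<Sum>b\<in>Basis. (frechet_derivative h (at x) v \<bullet> b) *\<^sub>R frechet_derivative f (at (h x)) b)) (at x)"
      by (simp only:)
  next
    fix v
    show "Ck_on k S (\<lambda>x. \<Sum>b\<in>Basis. (frechet_derivative h (at x) v \<bullet> b) *\<^sub>R frechet_derivative f (at (h x)) b)"
      by (intro Ck_on_sum[OF assms(1)] Ck_on_bilinear[OF assms(1) bounded_bilinear_scaleR]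
            Ck_on_bounded_linear[OF assms(1) bounded_linear_inner_left] Ck_on_SucD2[OF Suc.prems(2)]
            Suc.IH Ck_on_SucD2[OF Suc.prems(1)] Ck_on_Suc_imp[OF Suc.prems(2)])
  qed
qed

lemma smooth_on_cong:
  "smooth_on S f \<Longrightarrow> open S \<Longrightarrow> (\<And>x. x \<in> S \<Longrightarrow> f x = g x) \<Longrightarrow> smooth_on S g"
  by (auto simp: smooth_on_def intro: Ck_on_cong)

lemma smooth_on_subset: "smooth_on S f \<Longrightarrow> T \<subseteq> S \<Longrightarrow> smooth_on T f"
  by (auto simp: smooth_on_def intro: Ck_on_open_subset)

lemma smooth_on_const [smooth_intros]: "smooth_on S (\<lambda>x. c)"
  by (auto simp: smooth_on_def intro: Ck_on_const)

lemma smooth_on_id [smooth_intros]: "open S \<Longrightarrow> smooth_on S (\<lambda>x. x)"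
  by (auto simp: smooth_on_def intro: Ck_on_id)

lemma smooth_on_bounded_linear:
  "bounded_linear L \<Longrightarrow> open S \<Longrightarrow> smooth_on S f \<Longrightarrow> smooth_on S (\<lambda>x. L (f x))"
  by (auto simp: smooth_on_def intro: Ck_on_bounded_linear)

lemma smooth_on_bilinear:
  "bounded_bilinear P \<Longrightarrow> open S \<Longrightarrow> smooth_on S f \<Longrightarrow> smooth_on S g \<Longrightarrow> smooth_on S (\<lambda>x. P (f x) (g x))"
  by (auto simp: smooth_on_def intro: Ck_on_bilinear)

lemma smooth_on_add [smooth_intros]:
  "open S \<Longrightarrow> smooth_on S f \<Longrightarrow> smooth_on S g \<Longrightarrow> smooth_on S (\<lambda>x. f x + g x)"
  by (auto simp: smooth_on_def intro: Ck_on_add)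

lemma smooth_on_sum [smooth_intros]:
  "open S \<Longrightarrow> (\<And>i. i \<in> I \<Longrightarrow> smooth_on S (f i)) \<Longrightarrow> smooth_on S (\<lambda>x. \<Sum>i\<in>I. f i x)"
  by (auto simp: smooth_on_def intro: Ck_on_sum)

lemmas smooth_on_scaleR [smooth_intros] = smooth_on_bilinear[OF bounded_bilinear_scaleR]
lemmas smooth_on_inner [smooth_intros] = smooth_on_bilinear[OF bounded_bilinear_inner]
lemmas smooth_on_mult [smooth_intros] = smooth_on_bilinear[OF bounded_bilinear_mult]
lemmas smooth_on_nth [smooth_intros] = smooth_on_bounded_linear[OF bounded_linear_vec_nth]
lemmas smooth_on_uminus [smooth_intros] =
  smooth_on_bounded_linear[OF bounded_linear_minus[OF bounded_linear_ident]]

lemma smooth_on_diff [smooth_intros]: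
  "open S \<Longrightarrow> smooth_on S f \<Longrightarrow> smooth_on S g \<Longrightarrow> smooth_on S (\<lambda>x. f x - g x)"
  using smooth_on_add[of S f "\<lambda>x. - g x"] smooth_on_uminus[of S g] by simp

lemma smooth_on_prod [smooth_intros]:
  fixes f :: "'i \<Rightarrow> 'x::euclidean_space \<Rightarrow> real"
  assumes "open S"
  shows "(\<And>i. i \<in> I \<Longrightarrow> smooth_on S (f i)) \<Longrightarrow> smooth_on S (\<lambda>x. \<Prod>i\<in>I. f i x)"
proof (induction I rule: infinite_finite_induct)
  case (insert a I)
  then show ?case using smooth_on_mult[OF assms, of "f a"] by simp
qed (auto intro: smooth_on_const)

lemma smooth_on_compose:
  fixes h :: "'x::euclidean_space \<Rightarrow> 'y::euclidean_space"
  shows "smooth_on T f \<Longrightarrow> smooth_on S h \<Longrightarrow> open S \<Longrightarrow> open T \<Longrightarrow> h ` S \<subseteq> T \<Longrightarrow> smooth_on S (\<lambda>x. f (h x))"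
  by (auto simp: smooth_on_def intro: Ck_on_compose)

lemma smooth_on_has_derivative:
  "smooth_on S f \<Longrightarrow> x \<in> S \<Longrightarrow> (f has_derivative frechet_derivative f (at x)) (at x)"
  unfolding smooth_on_def by (rule Ck_on_SucD[of 0]) auto

lemma smooth_on_differentiable: "smooth_on S f \<Longrightarrow> x \<in> S \<Longrightarrow> f differentiable (at x)"
  using smooth_on_has_derivative differentiable_def by blast

lemma smooth_on_continuous: "smooth_on S f \<Longrightarrow> continuous_on S f"
  unfolding smooth_on_def by (metis Ck_on.simps(1))

lemma smooth_on_frechet: "smooth_on S f \<Longrightarrow> smooth_on S (\<lambda>x. frechet_derivative f (at x) v)"
  unfolding smooth_on_def by (metis Ck_on_SucD2)

lemma smooth_on_linear_frechet: "smooth_on S f \<Longrightarrow> x \<in> S \<Longrightarrow> linear (frechet_derivative f (at x))"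
  using smooth_on_has_derivative has_derivative_linear by blast

lemma smooth_on_frechet_apply [smooth_intros]:
  assumes "open S" "smooth_on S f" "smooth_on S w"
  shows "smooth_on S (\<lambda>x. frechet_derivative f (at x) (w x))"
proof (rule smooth_on_cong[OF _ assms(1)])
  show "smooth_on S (\<lambda>x. \<Sum>b\<in>Basis. (w x \<bullet> b) *\<^sub>R frechet_derivative f (at x) b)"
    by (intro smooth_intros assms smooth_on_frechet)
  show "(\<Sum>b\<in>Basis. (w x \<bullet> b) *\<^sub>R frechet_derivative f (at x) b) = frechet_derivative f (at x) (w x)" if "x \<in> S" for x
    by (rule linear_euclidean_expansion[OF smooth_on_linear_frechet[OF assms(2) that], symmetric])
qed

lemma smooth_on_vec_lambda [smooth_intros]:
  fixes f :: "'x::euclidean_space \<Rightarrow> 'n::finite \<Rightarrow> 'y::euclidean_space"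
  assumes "open S" "\<And>i. smooth_on S (\<lambda>x. f x i)"
  shows "smooth_on S (\<lambda>x. \<chi> i. f x i)"
proof -
  have "bounded_linear (axis i :: 'y \<Rightarrow> 'y^'n)" for i
    unfolding linear_conv_bounded_linear[symmetric] by (rule linearI) (auto simp: axis_def vec_eq_iff)
  then have "smooth_on S (\<lambda>x. \<Sum>i\<in>UNIV. axis i (f x i))"
    by (rule smooth_on_sum[OF assms(1) smooth_on_bounded_linear[OF _ assms(1) assms(2)]])
  moreover have "(\<Sum>i\<in>UNIV. axis i (f x i)) = (\<chi> i. f x i)" for x
    by (simp add: vec_eq_iff axis_def if_distrib cong: if_cong)
  ultimately show ?thesis by simp
qed

lemma smooth_on_local:
  assumes "\<And>x. x \<in> S \<Longrightarrow> \<exists>T. open T \<and> x \<in> T \<and> smooth_on T f"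
  shows "smooth_on S f"
proof -
  have "Ck_on k S f" if "\<And>x. x \<in> S \<Longrightarrow> \<exists>T. open T \<and> x \<in> T \<and> Ck_on k T f" for k
    using that
  proof (induction k arbitrary: f)
    case 0
    have "continuous (at x) f" if "x \<in> S" for x
      using 0[OF that] by (auto simp: continuous_on_eq_continuous_at)
    then show ?case by (simp add: continuous_at_imp_continuous_on)
  next
    case (Suc k)
    have "f differentiable at x" if "x \<in> S" for x
      using Suc.prems[OF that] by auto
    moreover have "Ck_on k S (\<lambda>x. frechet_derivative f (at x) v)" for v
      by (rule Suc.IH) (metis Suc.prems Ck_on.simps(2))
    ultimately show ?case by simp
  qed
  from this[of k for k] show ?thesis using assms unfolding smooth_on_def by metis
qed

lemma smooth_on_inverse [smooth_intros]:
  fixes f :: "'x::euclidean_space \<Rightarrow> real"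
  assumes "open S" "smooth_on S f" "\<And>x. x \<in> S \<Longrightarrow> f x \<noteq> 0"
  shows "smooth_on S (\<lambda>x. inverse (f x))"
proof -
  have op: "open (- {0::real})" by auto
  have "Ck_on k (- {0}) (inverse :: real \<Rightarrow> real)" for k
  proof (induction k)
    case 0
    then show ?case by (auto intro!: continuous_intros)
  next
    case (Suc k)
    show ?case
    proof (rule Ck_on_SucI[OF op])
      show "(inverse has_derivative (\<lambda>v. - (inverse x * v * inverse x))) (at x)" if "x \<in> - {0}" for x :: real
        using that by (auto intro!: derivative_eq_intros)
      show "Ck_on k (- {0}) (\<lambda>x::real. - (inverse x * v * inverse x))" for v
        using Ck_on_bilinear[OF op bounded_bilinear_mult
              Ck_on_bilinear[OF op bounded_bilinear_mult Suc Ck_on_const[of k _ "- v"]] Suc]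
        by simp
    qed
  qed
  then have "smooth_on (- {0}) (inverse :: real \<Rightarrow> real)" by (simp add: smooth_on_def)
  from smooth_on_compose[OF this assms(2) assms(1) op] show ?thesis using assms(3) by fastforce
qed

lemma smooth_on_divide [smooth_intros]:
  fixes f :: "'x::euclidean_space \<Rightarrow> real"
  assumes "open S" "smooth_on S f" "smooth_on S h" "\<And>x. x \<in> S \<Longrightarrow> h x \<noteq> 0"
  shows "smooth_on S (\<lambda>x. f x / h x)"
  unfolding divide_inverse by (intro smooth_intros assms)

lemma smooth_on_det [smooth_intros]:
  fixes M :: "'x::euclidean_space \<Rightarrow> real^'n^'n"
  assumes "open S" "\<And>i j. smooth_on S (\<lambda>x. M x $ i $ j)"
  shows "smooth_on S (\<lambda>x. det (M x))"
  unfolding det_def by (intro smooth_intros assms)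

lemma matrix_inv_inverse:
  fixes M :: "real^'n^'n"
  assumes "invertible M"
  shows "M ** matrix_inv M = mat 1" "matrix_inv M ** M = mat 1"
  using someI_ex[OF assms[unfolded invertible_def]] by (auto simp: matrix_inv_def)

text \<open>The entries of the inverse are quotients of determinants, by Cramer's rule applied to the standard basis
vectors.\<close>

lemma smooth_on_matrix_inv:
  fixes M :: "'x::euclidean_space \<Rightarrow> real^'n^'n"
  assumes "open S" "\<And>i j. smooth_on S (\<lambda>x. M x $ i $ j)" "\<And>x. x \<in> S \<Longrightarrow> invertible (M x)"
  shows "smooth_on S (\<lambda>x. matrix_inv (M x) $ i $ j)"
proof (rule smooth_on_cong[OF _ assms(1)])
  show "smooth_on S (\<lambda>x. det (\<chi> a b. if b = i then (axis j 1 :: real^'n) $ a else M x $ a $ b) / det (M x))"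
  proof (intro smooth_on_divide smooth_on_det assms)
    show "smooth_on S (\<lambda>x. (\<chi> a b. if b = i then (axis j 1 :: real^'n) $ a else M x $ a $ b) $ ia $ ja)" for ia ja
      by (cases "ja = i") (auto intro: smooth_on_const assms)
  qed (use assms invertible_det_nz in blast)
next
  fix x assume x: "x \<in> S"
  have "M x *v (matrix_inv (M x) *v axis j 1) = axis j 1"
    using assms(3)[OF x] by (simp add: matrix_vector_mul_assoc matrix_inv_inverse)
  then have "matrix_inv (M x) *v axis j 1 =
      (\<chi> k. det (\<chi> a b. if b = k then (axis j 1 :: real^'n) $ a else M x $ a $ b) / det (M x))"
    using cramer assms(3)[OF x] invertible_det_nz by blast
  then have "(matrix_inv (M x) *v axis j 1) $ i =
      det (\<chi> a b. if b = i then (axis j 1 :: real^'n) $ a else M x $ a $ b) / det (M x)"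
    by simp
  then show "det (\<chi> a b. if b = i then (axis j 1 :: real^'n) $ a else M x $ a $ b) / det (M x) = matrix_inv (M x) $ i $ j"
    by (simp add: matrix_vector_mul_component inner_axis' row_def matrix_vector_mult_basis column_def)
qed

section \<open>Smooth bump functions\<close>

text \<open>The family \<open>t\<^sup>-\<^sup>n exp(-1/t)\<close>, extended by zero to \<open>t \<le> 0\<close>. The span of the family is closed under
differentiation, which makes smoothness a one-line induction; the member \<open>n = 0\<close> alone would not do.\<close>

definition flat_exp :: "nat \<Rightarrow> real \<Rightarrow> real" where
  "flat_exp n t = (if t > 0 then inverse t ^ n * exp (- inverse t) else 0)"

lemma flat_exp_tendsto_0: "(flat_exp n \<longlongrightarrow> 0) (at_right 0)"
proof -
  have "((\<lambda>t::real. (inverse t) ^ n / exp (inverse t)) \<longlongrightarrow> 0) (at_right 0)"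
    by (rule filterlim_compose[OF tendsto_power_div_exp_0 filterlim_inverse_at_top_right])
  then show ?thesis
    by (rule Lim_transform_eventually)
      (auto simp: flat_exp_def exp_minus divide_inverse eventually_at_filter)
qed

lemma flat_exp_has_derivative:
  "(flat_exp n has_real_derivative - real n * flat_exp (Suc n) t + flat_exp (Suc (Suc n)) t) (at t)"
proof -
  consider "t > 0" | "t < 0" | "t = 0" by linarith
  then show ?thesis
  proof cases
    case 1
    have "((\<lambda>t. inverse t ^ n * exp (- inverse t)) has_real_derivative
        - real n * flat_exp (Suc n) t + flat_exp (Suc (Suc n)) t) (at t)"
    proof (cases n)
      case 0
      then show ?thesis using 1 by (auto intro!: derivative_eq_intros simp: flat_exp_def algebra_simps)
    next
      case (Suc m)
      have "((\<lambda>t. inverse t ^ n) has_real_derivative real n * (- (inverse t * 1 * inverse t) * inverse t ^ m)) (at t)"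
        using DERIV_power[OF DERIV_inverse'[OF DERIV_ident], of t n] 1 by (simp add: Suc)
      moreover have "((\<lambda>t. exp (- inverse t)) has_real_derivative exp (- inverse t) * (inverse t * inverse t)) (at t)"
        using 1 by (auto intro!: derivative_eq_intros)
      ultimately have "((\<lambda>t. inverse t ^ n * exp (- inverse t)) has_real_derivative
          real n * (- (inverse t * 1 * inverse t) * inverse t ^ m) * exp (- inverse t)
          + exp (- inverse t) * (inverse t * inverse t) * inverse t ^ n) (at t)"
        by (rule DERIV_mult)
      then show ?thesis
        by (rule DERIV_cong) (use 1 in \<open>simp add: Suc flat_exp_def algebra_simps\<close>)
    qed
    then show ?thesis
      by (rule has_field_derivative_transform_within_open[where S = "{0<..}"])
        (use 1 in \<open>auto simp: flat_exp_def\<close>)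
  next
    case 2
    have "((\<lambda>t. 0) has_real_derivative - real n * flat_exp (Suc n) t + flat_exp (Suc (Suc n)) t) (at t)"
      using 2 by (auto simp: flat_exp_def)
    then show ?thesis
      by (rule has_field_derivative_transform_within_open[where S = "{..<0}"])
        (use 2 in \<open>auto simp: flat_exp_def\<close>)
  next
    case 3
    have r: "((\<lambda>h. (flat_exp n (0 + h) - flat_exp n 0) / h) \<longlongrightarrow> 0) (at_right 0)"
      by (rule Lim_transform_eventually[OF flat_exp_tendsto_0[of "Suc n"]])
        (auto simp: flat_exp_def divide_inverse eventually_at_right intro: exI[of _ 1])
    have l: "((\<lambda>h. (flat_exp n (0 + h) - flat_exp n 0) / h) \<longlongrightarrow> 0) (at_left 0)"
      by (rule Lim_transform_eventually[OF tendsto_const])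
        (auto simp: flat_exp_def eventually_at_filter)
    have "((\<lambda>h. (flat_exp n (0 + h) - flat_exp n 0) / h) \<longlongrightarrow> 0) (at 0)"
      using r l by (simp add: filterlim_split_at)
    then show ?thesis using 3 by (simp add: DERIV_def flat_exp_def)
  qed
qed

lemma smooth_on_flat_exp: "smooth_on UNIV (flat_exp n)"
proof -
  have "Ck_on k UNIV (flat_exp n)" for k
  proof (induction k arbitrary: n)
    case 0
    then show ?case
      using DERIV_isCont[OF flat_exp_has_derivative] by (auto intro: continuous_at_imp_continuous_on)
  next
    case (Suc k)
    show ?case
    proof (rule Ck_on_SucI[OF open_UNIV flat_exp_has_derivative[unfolded has_field_derivative_def]])
      show "Ck_on k UNIV (\<lambda>t. (- real n * flat_exp (Suc n) t + flat_exp (Suc (Suc n)) t) * v)" for v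
        by (rule Ck_on_bilinear[OF open_UNIV bounded_bilinear_mult
              Ck_on_add[OF open_UNIV Ck_on_bilinear[OF open_UNIV bounded_bilinear_mult Ck_on_const Suc] Suc] Ck_on_const])
    qed
  qed
  then show ?thesis by (simp add: smooth_on_def)
qed

lemma exists_bump:
  fixes y0 :: "'x::euclidean_space"
  assumes "a > 0"
  obtains \<rho> :: "'x \<Rightarrow> real" where "smooth_on UNIV \<rho>" "\<And>y. y \<in> cball y0 a \<Longrightarrow> \<rho> y = 1"
    "\<And>y. y \<notin> ball y0 (2 * a) \<Longrightarrow> \<rho> y = 0"
proof
  \<comment> \<open>The function s is a smooth step: it vanishes for t <= 0 and equals 1 for t >= 1. The quadratic q is at
    least 1 on the small ball and negative outside the large one.\<close>
  define h where "h = flat_exp 0"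
  define s where "s t = h t / (h t + h (1 - t))" for t
  define q where "q y = 2 - ((y - y0) \<bullet> (y - y0)) / (a * a)" for y :: 'x
  have pos: "h t + h (1 - t) \<noteq> 0" for t
    by (auto simp: h_def flat_exp_def add_nonneg_eq_0_iff)
  have hs: "smooth_on UNIV h" unfolding h_def by (rule smooth_on_flat_exp)
  have h2: "smooth_on UNIV (\<lambda>t. h (1 - t))"
    by (rule smooth_on_compose[OF hs smooth_on_diff[OF open_UNIV smooth_on_const smooth_on_id[OF open_UNIV]]]) auto
  have s: "smooth_on UNIV s"
    unfolding s_def[abs_def]
    by (rule smooth_on_divide[OF open_UNIV hs smooth_on_add[OF open_UNIV hs h2] pos])
  have q: "smooth_on UNIV q"
    unfolding q_def[abs_def]
    by (rule smooth_on_diff smooth_on_divide smooth_on_const smooth_on_inner smooth_on_id open_UNIV)+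
      (use assms in auto)
  show "smooth_on UNIV (\<lambda>y. s (q y))"
    by (rule smooth_on_compose[OF s q]) auto
  show "s (q y) = 1" if "y \<in> cball y0 a" for y
  proof -
    have "norm (y - y0) ^ 2 \<le> a ^ 2" using that by (intro power_mono) (auto simp: dist_norm norm_minus_commute)
    then have "q y \<ge> 1"
      using assms by (simp add: q_def power2_norm_eq_inner[symmetric] power2_eq_square[symmetric])
    then show ?thesis by (auto simp: s_def h_def flat_exp_def)
  qed
  show "s (q y) = 0" if "y \<notin> ball y0 (2 * a)" for y
  proof -
    have "norm (y - y0) ^ 2 \<ge> (2 * a) ^ 2" using that assms by (intro power_mono) (auto simp: dist_norm norm_minus_commute)
    then have "(norm (y - y0))\<^sup>2 / a\<^sup>2 \<ge> 4"
      using assms by (simp add: power_mult_distrib pos_le_divide_eq)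
    then have "q y \<le> 0"
      by (simp add: q_def power2_norm_eq_inner[symmetric] power2_eq_square[symmetric])
    then show ?thesis by (auto simp: s_def h_def flat_exp_def)
  qed
qed

section \<open>Second derivatives and the strong maximum principle\<close>

text \<open>The mean value theorem in direction \<open>h\<close>, and then in direction \<open>k\<close>. The second difference is symmetric
in \<open>h\<close> and \<open>k\<close>, so its two evaluations identify the mixed derivatives in the limit \<open>t \<rightarrow> 0\<close>.\<close>

lemma second_difference_mean_value:
  fixes u :: "'x::euclidean_space \<Rightarrow> real"
  assumes u: "\<And>x. x \<in> ball y e \<Longrightarrow> (u has_derivative u' x) (at x)"
    and u': "\<And>x. x \<in> ball y e \<Longrightarrow> ((\<lambda>x. u' x h) has_derivative u'' x) (at x)"
    and t: "0 < t" "t * (norm h + norm k) < e"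
  obtains z where "norm (z - y) \<le> t * (norm h + norm k)"
    "u (y + t *\<^sub>R h + t *\<^sub>R k) - u (y + t *\<^sub>R h) - u (y + t *\<^sub>R k) + u y = t * t * u'' z k"
proof -
  have small: "norm (s *\<^sub>R h + r *\<^sub>R k) \<le> t * (norm h + norm k)" if "0 \<le> s" "s \<le> t" "0 \<le> r" "r \<le> t" for s r
  proof -
    have "norm (s *\<^sub>R h + r *\<^sub>R k) \<le> s * norm h + r * norm k"
      using norm_triangle_ineq[of "s *\<^sub>R h" "r *\<^sub>R k"] that by simp
    also have "\<dots> \<le> t * norm h + t * norm k" using that by (intro add_mono mult_right_mono) auto
    finally show ?thesis by (simp add: algebra_simps)
  qed
  have inb: "y + s *\<^sub>R h + r *\<^sub>R k \<in> ball y e" if "0 \<le> s" "s \<le> t" "0 \<le> r" "r \<le> t" for s r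
  proof -
    have "dist y (y + s *\<^sub>R h + r *\<^sub>R k) = norm (s *\<^sub>R h + r *\<^sub>R k)"
      by (simp only: add.assoc dist_norm norm_minus_commute[of y] add_diff_cancel_left')
    then show ?thesis using small[OF that] t(2) by simp
  qed
  have d1: "((\<lambda>s. u (y + s *\<^sub>R h + r *\<^sub>R k)) has_real_derivative u' (y + s *\<^sub>R h + r *\<^sub>R k) h) (at s)"
    if "0 \<le> s" "s \<le> t" "0 \<le> r" "r \<le> t" for s r
  proof -
    have "((\<lambda>s. y + s *\<^sub>R h + r *\<^sub>R k) has_derivative (\<lambda>v. v *\<^sub>R h)) (at s)"
      by (auto intro!: derivative_eq_intros)
    from diff_chain_at[OF this u[OF inb[OF that]]]
    have "((\<lambda>s. u (y + s *\<^sub>R h + r *\<^sub>R k)) has_derivative (\<lambda>v. u' (y + s *\<^sub>R h + r *\<^sub>R k) (v *\<^sub>R h))) (at s)"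
      by (simp add: o_def)
    moreover have "u' (y + s *\<^sub>R h + r *\<^sub>R k) (v *\<^sub>R h) = u' (y + s *\<^sub>R h + r *\<^sub>R k) h * v" for v
      using linear_scale[OF has_derivative_linear[OF u[OF inb[OF that]]]] by simp
    ultimately show ?thesis by (simp add: has_field_derivative_def)
  qed
  have "\<exists>s>0. s < t \<and> (u (y + t *\<^sub>R h + t *\<^sub>R k) - u (y + t *\<^sub>R h + 0 *\<^sub>R k)) - (u (y + 0 *\<^sub>R h + t *\<^sub>R k) - u (y + 0 *\<^sub>R h + 0 *\<^sub>R k))
      = (t - 0) * (u' (y + s *\<^sub>R h + t *\<^sub>R k) h - u' (y + s *\<^sub>R h + 0 *\<^sub>R k) h)"
    using t(1) by (intro MVT2 DERIV_diff d1) auto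
  then obtain s where s: "0 < s" "s < t" "u (y + t *\<^sub>R h + t *\<^sub>R k) - u (y + t *\<^sub>R h) - u (y + t *\<^sub>R k) + u y
      = t * (u' (y + s *\<^sub>R h + t *\<^sub>R k) h - u' (y + s *\<^sub>R h) h)" by auto
  have d2: "((\<lambda>r. u' (y + s *\<^sub>R h + r *\<^sub>R k) h) has_real_derivative u'' (y + s *\<^sub>R h + r *\<^sub>R k) k) (at r)"
    if "0 \<le> r" "r \<le> t" for r
  proof -
    have i: "y + s *\<^sub>R h + r *\<^sub>R k \<in> ball y e" using inb[of s r] s that by simp
    have "((\<lambda>r. y + s *\<^sub>R h + r *\<^sub>R k) has_derivative (\<lambda>v. v *\<^sub>R k)) (at r)"
      by (auto intro!: derivative_eq_intros)
    from diff_chain_at[OF this u'[OF i]]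
    have "((\<lambda>r. u' (y + s *\<^sub>R h + r *\<^sub>R k) h) has_derivative (\<lambda>v. u'' (y + s *\<^sub>R h + r *\<^sub>R k) (v *\<^sub>R k))) (at r)"
      by (simp add: o_def)
    moreover have "u'' (y + s *\<^sub>R h + r *\<^sub>R k) (v *\<^sub>R k) = u'' (y + s *\<^sub>R h + r *\<^sub>R k) k * v" for v
      using linear_scale[OF has_derivative_linear[OF u'[OF i]]] by simp
    ultimately show ?thesis by (simp add: has_field_derivative_def)
  qed
  have "\<exists>r>0. r < t \<and> u' (y + s *\<^sub>R h + t *\<^sub>R k) h - u' (y + s *\<^sub>R h + 0 *\<^sub>R k) h
      = (t - 0) * u'' (y + s *\<^sub>R h + r *\<^sub>R k) k"
    using t(1) by (intro MVT2 d2) auto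
  then obtain r where r: "0 < r" "r < t" "u' (y + s *\<^sub>R h + t *\<^sub>R k) h - u' (y + s *\<^sub>R h) h
      = t * u'' (y + s *\<^sub>R h + r *\<^sub>R k) k" by auto
  show thesis
    by (rule that[of "y + s *\<^sub>R h + r *\<^sub>R k"]) (use s r small[of s r] in \<open>auto simp: add.assoc\<close>)
qed

lemma second_derivative_symmetric:
  fixes u :: "'x::euclidean_space \<Rightarrow> real"
  assumes "open S" "smooth_on S u" "y \<in> S"
  shows "frechet_derivative (\<lambda>x. frechet_derivative u (at x) h) (at y) k =
         frechet_derivative (\<lambda>x. frechet_derivative u (at x) k) (at y) h"
proof (rule ccontr)
  define H where "H h k x = frechet_derivative (\<lambda>x. frechet_derivative u (at x) h) (at x) k" for h k x
  assume "\<not> ?thesis"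
  then have ne: "dist (H h k y) (H k h y) > 0" by (simp add: H_def)
  have cont: "isCont (H h k) y" for h k
    using smooth_on_continuous[OF smooth_on_frechet[OF smooth_on_frechet[OF assms(2)]]] assms(1,3)
    by (auto simp: H_def[abs_def] continuous_on_eq_continuous_at)
  define \<epsilon> where "\<epsilon> = dist (H h k y) (H k h y) / 2"
  have \<epsilon>: "\<epsilon> > 0" using ne by (simp add: \<epsilon>_def)
  obtain d1 where d1: "d1 > 0" "\<And>z. dist z y < d1 \<Longrightarrow> dist (H h k z) (H h k y) < \<epsilon>"
    using cont[of h k] \<epsilon> unfolding continuous_at_eps_delta by blast
  obtain d2 where d2: "d2 > 0" "\<And>z. dist z y < d2 \<Longrightarrow> dist (H k h z) (H k h y) < \<epsilon>"
    using cont[of k h] \<epsilon> unfolding continuous_at_eps_delta by blast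
  obtain e where e: "e > 0" "ball y e \<subseteq> S" using assms(1,3) open_contains_ball by blast
  define m where "m = min e (min d1 d2)"
  define t where "t = m / (2 * (norm h + norm k + 1))"
  have m: "m > 0" "m \<le> e" "m \<le> d1" "m \<le> d2" using e d1 d2 by (auto simp: m_def)
  have hk: "norm h + norm k + 1 > 0" by (simp add: add_nonneg_pos)
  have t: "t > 0" unfolding t_def using m(1) hk by (intro divide_pos_pos) auto
  have "t * (norm h + norm k) < t * (2 * (norm h + norm k + 1))"
    using t by (intro mult_strict_left_mono) (auto simp: add_nonneg_pos)
  also have "\<dots> = m" using hk by (simp add: t_def)
  finally have tm: "t * (norm h + norm k) < m" .
  have ud: "x \<in> ball y e \<Longrightarrow> (u has_derivative frechet_derivative u (at x)) (at x)" for x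
    using smooth_on_has_derivative[OF assms(2)] e(2) by auto
  have ud2: "x \<in> ball y e \<Longrightarrow> ((\<lambda>x. frechet_derivative u (at x) h) has_derivative (\<lambda>k. H h k x)) (at x)" for x h
    using smooth_on_has_derivative[OF smooth_on_frechet[OF assms(2)]] e(2) unfolding H_def by blast
  have te: "t * (norm h + norm k) < e" "t * (norm k + norm h) < e" using tm m by (auto simp: add.commute[of "norm k"])
  obtain z1 where z1: "norm (z1 - y) \<le> t * (norm h + norm k)"
    "u (y + t *\<^sub>R h + t *\<^sub>R k) - u (y + t *\<^sub>R h) - u (y + t *\<^sub>R k) + u y = t * t * H h k z1"
    using second_difference_mean_value[OF ud ud2 t te(1)] by blast
  obtain z2 where z2: "norm (z2 - y) \<le> t * (norm k + norm h)"
    "u (y + t *\<^sub>R k + t *\<^sub>R h) - u (y + t *\<^sub>R k) - u (y + t *\<^sub>R h) + u y = t * t * H k h z2"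
    using second_difference_mean_value[OF ud ud2 t te(2)] by blast
  have "t * t * H h k z1 = t * t * H k h z2"
    using z1(2) z2(2) unfolding add.assoc add.commute[of "t *\<^sub>R k" "t *\<^sub>R h"] by linarith
  then have "H h k z1 = H k h z2" using t by simp
  moreover have "dist (H h k z1) (H h k y) < \<epsilon>" using z1(1) tm m by (intro d1(2)) (simp add: dist_norm)
  moreover have "dist (H k h z2) (H k h y) < \<epsilon>" using z2(1) tm m by (intro d2(2)) (simp add: dist_norm add.commute)
  ultimately have "dist (H h k y) (H k h y) < 2 * \<epsilon>"
    using dist_triangle3[of "H h k y" "H k h y" "H h k z1"] by simp
  then show False by (simp add: \<epsilon>_def)
qed

lemma second_derivative_nonpos_at_max:
  fixes v :: "'x::euclidean_space \<Rightarrow> real"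
  assumes "open S" "y \<in> S" "\<And>x. x \<in> S \<Longrightarrow> v x \<le> v y"
    and v: "\<And>x. x \<in> S \<Longrightarrow> (v has_derivative v' x) (at x)"
    and v': "((\<lambda>x. v' x h) has_derivative v'') (at y)"
  shows "v' y = (\<lambda>_. 0)" "v'' h \<le> 0"
proof -
  show z: "v' y = (\<lambda>_. 0)"
    using differential_zero_maxmin[OF assms(2,1) v[OF assms(2)]] assms(3) by blast
  show "v'' h \<le> 0"
  proof (rule ccontr)
    assume "\<not> v'' h \<le> 0"
    then have pos: "v'' h > 0" by simp
    have der: "((\<lambda>t. y + t *\<^sub>R h) has_derivative (\<lambda>s. s *\<^sub>R h)) (at t)" for t
      by (auto intro!: derivative_eq_intros)
    have "((\<lambda>t. v' (y + t *\<^sub>R h) h) has_derivative (\<lambda>s. v'' (s *\<^sub>R h))) (at 0)"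
      using diff_chain_at[OF der[of 0], of "\<lambda>x. v' x h" v''] v' by (simp add: o_def)
    moreover have "v'' (s *\<^sub>R h) = v'' h * s" for s
      using linear_scale[OF has_derivative_linear[OF v']] by simp
    ultimately have "((\<lambda>t. v' (y + t *\<^sub>R h) h) has_real_derivative v'' h) (at 0)"
      by (simp add: has_field_derivative_def)
    from DERIV_pos_inc_right[OF this pos] z obtain d where d: "d > 0" "\<And>t. 0 < t \<Longrightarrow> t < d \<Longrightarrow> v' (y + t *\<^sub>R h) h > 0"
      by auto
    obtain e where e: "e > 0" "ball y e \<subseteq> S" using assms(1,2) open_contains_ball by blast
    define t where "t = min (d / 2) (e / (2 * (norm h + 1)))"
    have t: "t > 0" "t < d" using d(1) e(1) by (auto simp: t_def add_nonneg_pos)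
    have inb: "y + s *\<^sub>R h \<in> S" if "0 \<le> s" "s \<le> t" for s
    proof -
      have "s * norm h \<le> e / (2 * (norm h + 1)) * norm h"
        using that by (intro mult_right_mono) (auto simp: t_def)
      also have "\<dots> = e * (norm h / (2 * (norm h + 1)))" by simp
      also have "\<dots> < e * 1"
        using e(1) by (intro mult_strict_left_mono) (simp_all add: divide_less_eq add_nonneg_pos)
      finally have "s * norm h < e" by simp
      then show ?thesis using e(2) that by (auto simp: dist_norm)
    qed
    have D: "((\<lambda>s. v (y + s *\<^sub>R h)) has_real_derivative v' (y + s *\<^sub>R h) h) (at s)" if "0 \<le> s" "s \<le> t" for s
    proof -
      note vs = v[OF inb[OF that]]
      have "((\<lambda>s. v (y + s *\<^sub>R h)) has_derivative (\<lambda>r. v' (y + s *\<^sub>R h) (r *\<^sub>R h))) (at s)"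
        using diff_chain_at[OF der vs] by (simp add: o_def)
      moreover have "v' (y + s *\<^sub>R h) (r *\<^sub>R h) = v' (y + s *\<^sub>R h) h * r" for r
        using linear_scale[OF has_derivative_linear[OF vs]] by simp
      ultimately show ?thesis by (simp add: has_field_derivative_def)
    qed
    have "\<exists>s>0. s < t \<and> v (y + t *\<^sub>R h) - v (y + 0 *\<^sub>R h) = (t - 0) * v' (y + s *\<^sub>R h) h"
      using t(1) by (intro MVT2 D) auto
    then obtain s where s: "0 < s" "s < t" "v (y + t *\<^sub>R h) - v y = t * v' (y + s *\<^sub>R h) h" by auto
    have "v' (y + s *\<^sub>R h) h > 0" using s t by (intro d(2)) auto
    then have "v (y + t *\<^sub>R h) > v y" using s(3) t(1) by (smt (verit) mult_pos_pos)
    then show False using assms(3)[OF inb[of t]] t by simp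
  qed
qed

text \<open>E. Hopf's strong maximum principle for the operator \<open>u \<mapsto> \<Sum>\<^sub>i u''(V\<^sub>i, V\<^sub>i) + u'(b)\<close>, which is elliptic
because the \<open>V\<^sub>i\<close> span the space at each point. If \<open>u z < u p\<close>, then a ball around \<open>z\<close> touches
the set of maximum points at some \<open>y1\<close>. Adding a small multiple of a barrier \<open>w\<close>,
which is a strict subsolution near \<open>y1\<close> and smaller than \<open>w y1\<close> outside the ball, creates a local
maximum near \<open>y1\<close> at which the operator is positive. This contradicts the second derivative test.\<close>

lemma strong_maximum_principle:
  fixes u :: "'x::euclidean_space \<Rightarrow> real" and V :: "'i \<Rightarrow> 'x \<Rightarrow> 'x"
  assumes I: "finite I" and R: "R > 0"
    and u: "\<And>y. y \<in> ball p R \<Longrightarrow> (u has_derivative u' y) (at y)"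
    and u': "\<And>y h. y \<in> ball p R \<Longrightarrow> ((\<lambda>x. u' x h) has_derivative u'' y h) (at y)"
    and V: "\<And>i. i \<in> I \<Longrightarrow> continuous_on (ball p R) (V i)" and b: "continuous_on (ball p R) b"
    and elliptic: "\<And>y \<xi>. y \<in> ball p R \<Longrightarrow> \<xi> \<noteq> 0 \<Longrightarrow> \<exists>i\<in>I. V i y \<bullet> \<xi> \<noteq> 0"
    and eq: "\<And>y. y \<in> ball p R \<Longrightarrow> (\<Sum>i\<in>I. u'' y (V i y) (V i y)) + u' y (b y) = 0"
    and max: "\<And>y. y \<in> ball p R \<Longrightarrow> u y \<le> u p"
    and z: "z \<in> ball p (R / 2)"
  shows "u z = u p"
proof (rule ccontr)
  assume "u z \<noteq> u p"
  have cu: "continuous_on (ball p R) u"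
    by (intro continuous_at_imp_continuous_on ballI) (rule has_derivative_continuous[OF u])
  have zR: "z \<in> ball p R" using z R by auto
  define F where "F = {y \<in> cball z (dist z p). u y = u p}"
  have sub: "cball z (dist z p) \<subseteq> ball p R"
  proof
    fix y assume "y \<in> cball z (dist z p)"
    then show "y \<in> ball p R" using z dist_triangle[of p y z] by (auto simp: dist_commute)
  qed
  have "closed F" unfolding F_def
    by (rule continuous_closed_preimage_constant[OF continuous_on_subset[OF cu sub] closed_cball])
  moreover have pF: "p \<in> F" by (simp add: F_def)
  ultimately obtain y1 where y1: "y1 \<in> F" "\<And>y. y \<in> F \<Longrightarrow> dist z y1 \<le> dist z y"
    using distance_attains_inf[of F z] by blast
  have uy1: "u y1 = u p" using y1(1) by (simp add: F_def)
  have y1R: "y1 \<in> ball p R" using y1(1) sub by (auto simp: F_def)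
  \<comment> \<open>Passing to the ball of half the radius makes y1 the only maximum point in the closed ball.\<close>
  define c where "c = midpoint z y1"
  define \<rho> where "\<rho> = dist z y1 / 2"
  have \<rho>: "\<rho> > 0" using \<open>u z \<noteq> u p\<close> uy1 by (auto simp: \<rho>_def)
  have cd: "dist z c = \<rho>" "dist c y1 = \<rho>" by (simp_all add: c_def \<rho>_def dist_midpoint)
  have less: "u y < u p" if "y \<in> ball p R" "dist c y \<le> \<rho>" "y \<noteq> y1" for y
  proof (rule ccontr)
    assume "\<not> u y < u p"
    then have uy: "u y = u p" using max[OF that(1)] by simp
    have le: "dist z y \<le> 2 * \<rho>" using dist_triangle[of z y c] cd that(2) by simp
    also have "\<dots> \<le> dist z p" using y1(2)[OF pF] by (simp add: \<rho>_def)
    finally have "y \<in> F" using uy by (simp add: F_def)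
    then have "dist z y = 2 * \<rho>" using y1(2)[of y] le by (simp add: \<rho>_def)
    then have "dist z c + dist c y = dist z y" using dist_triangle[of z y c] cd that(2) by simp
    then have "y = y1"
    proof -
      have "norm ((c - z) + (y - c)) = norm (c - z) + norm (y - c)"
        using \<open>dist z c + dist c y = dist z y\<close> by (simp add: dist_norm norm_minus_commute)
      then have "norm (c - z) *\<^sub>R (y - c) = norm (y - c) *\<^sub>R (c - z)"
        unfolding norm_triangle_eq .
      moreover have "norm (c - z) = \<rho>" "norm (y - c) = \<rho>"
        using cd \<open>dist z c + dist c y = dist z y\<close> \<open>dist z y = 2 * \<rho>\<close> by (simp_all add: dist_norm norm_minus_commute)
      ultimately have "y - c = c - z" using \<rho> by simp
      moreover have "y1 - c = c - z"
        by (simp add: c_def midpoint_def algebra_simps flip: scaleR_add_left)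
      ultimately show "y = y1" by (metis diff_add_cancel)
    qed
    then show False using that(3) by simp
  qed
  obtain \<delta>0 where \<delta>0: "\<delta>0 > 0" "cball y1 \<delta>0 \<subseteq> ball p R"
    using y1R open_contains_cball by blast
  \<comment> \<open>The barrier is a strict subsolution only away from its centre c, so S has to keep clear of c.\<close>
  define \<delta> where "\<delta> = min \<delta>0 (\<rho> / 2)"
  define S where "S = cball y1 \<delta>"
  have \<delta>: "\<delta> > 0" "\<delta> \<le> \<rho> / 2" using \<delta>0 \<rho> by (auto simp: \<delta>_def)
  have SR: "S \<subseteq> ball p R" using \<delta>0 by (auto simp: S_def \<delta>_def)
  have Sc: "compact S" "y1 \<in> S" using \<delta> by (auto simp: S_def)
  have far: "\<rho> / 2 \<le> norm (y - c)" if "y \<in> S" for y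
    using dist_triangle[of c y1 y] cd(2) that \<delta>(2) by (simp add: S_def dist_norm norm_minus_commute)
  define q where "q y \<xi> = (\<Sum>i\<in>I. (V i y \<bullet> \<xi>)\<^sup>2)" for y \<xi>
  obtain \<mu> where \<mu>: "\<mu> > 0" "\<And>y \<xi>. y \<in> S \<Longrightarrow> \<mu> * (norm \<xi>)\<^sup>2 \<le> q y \<xi>"
  proof -
    have "continuous_on (S \<times> sphere 0 1) (\<lambda>w. q (fst w) (snd w))"
      unfolding q_def
      by (intro continuous_intros continuous_on_compose2[OF continuous_on_subset[OF V SR]]) auto
    moreover have "compact (S \<times> sphere (0::'x) 1)" using Sc by (intro compact_Times) auto
    moreover have "S \<times> sphere (0::'x) 1 \<noteq> {}"
    proof -
      obtain e :: 'x where "norm e = 1" using vector_choose_size[of 1] by auto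
      then have "(y1, e) \<in> S \<times> sphere 0 1" using Sc(2) by simp
      then show ?thesis by (metis empty_iff)
    qed
    ultimately have "\<exists>w\<in>S \<times> sphere 0 1. \<forall>v\<in>S \<times> sphere 0 1. q (fst w) (snd w) \<le> q (fst v) (snd v)"
      by (intro continuous_attains_inf)
    then obtain w where w: "w \<in> S \<times> sphere 0 1"
      "\<And>v. v \<in> S \<times> sphere 0 1 \<Longrightarrow> q (fst w) (snd w) \<le> q (fst v) (snd v)" by auto
    show ?thesis
    proof (rule that[of "q (fst w) (snd w)"])
      have "\<exists>i\<in>I. V i (fst w) \<bullet> snd w \<noteq> 0"
        by (rule elliptic) (use w(1) SR in auto)
      then show "q (fst w) (snd w) > 0"
        unfolding q_def using I by (auto intro: sum_pos2)
      fix y \<xi> assume y: "y \<in> S"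
      show "q (fst w) (snd w) * (norm \<xi>)\<^sup>2 \<le> q y \<xi>"
      proof (cases "\<xi> = 0")
        case False
        have "q y \<xi> = (norm \<xi>)\<^sup>2 * q y (\<xi> /\<^sub>R norm \<xi>)"
          using False by (simp add: q_def sum_distrib_left power_mult_distrib power_divide field_simps)
        moreover have "q (fst w) (snd w) \<le> q y (\<xi> /\<^sub>R norm \<xi>)"
          using w(2)[of "(y, \<xi> /\<^sub>R norm \<xi>)"] y False by simp
        ultimately show ?thesis by (metis mult.commute mult_left_mono zero_le_power2)
      qed (simp add: q_def)
    qed
  qed
  define h where "h y = (\<Sum>i\<in>I. (norm (V i y))\<^sup>2) + (y - c) \<bullet> b y" for y
  have "continuous_on S h" unfolding h_def
    by (intro continuous_intros continuous_on_subset[OF V SR] continuous_on_subset[OF b SR])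
  from continuous_attains_sup[OF Sc(1) _ this] Sc(2)
  obtain C where "\<And>y. y \<in> S \<Longrightarrow> h y \<le> C" by auto
  then have C: "(\<Sum>i\<in>I. (norm (V i y))\<^sup>2) + (y - c) \<bullet> b y \<le> C" if "y \<in> S" for y
    using that by (simp add: h_def)
  \<comment> \<open>The second order term of the barrier grows like the square of k and the remaining terms like k. This
    value of k makes the former dominate on S.\<close>
  define k where "k = 2 * (\<bar>C\<bar> + 1) / (\<mu> * \<rho>\<^sup>2)"
  have k: "k > 0" unfolding k_def using \<mu>(1) \<rho> by (intro divide_pos_pos mult_pos_pos zero_less_power) auto
  define w where "w y = exp (- k * ((y - c) \<bullet> (y - c)))" for y
  define w' where "w' y h = - 2 * k * ((y - c) \<bullet> h) * w y" for y h
  define w'' where "w'' y h l = w y * (4 * k\<^sup>2 * ((y - c) \<bullet> h) * ((y - c) \<bullet> l) - 2 * k * (l \<bullet> h))" for y h l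
  have dw: "(w has_derivative w' y) (at y)" for y
    unfolding w_def[abs_def] w'_def
    by (auto intro!: derivative_eq_intros simp: w_def inner_commute algebra_simps)
  have dw': "((\<lambda>y. w' y h) has_derivative w'' y h) (at y)" for y h
    unfolding w'_def w''_def
    by (auto intro!: derivative_eq_intros dw simp: w'_def inner_commute algebra_simps power2_eq_square)
  have Lw: "(\<Sum>i\<in>I. w'' y (V i y) (V i y)) + w' y (b y) > 0" if y: "y \<in> S" for y
  proof -
    have "w'' y (V i y) (V i y) = w y * (4 * k\<^sup>2 * (V i y \<bullet> (y - c))\<^sup>2 - 2 * k * (norm (V i y))\<^sup>2)" for i
      unfolding w''_def power2_norm_eq_inner power2_eq_square[of "V i y \<bullet> (y - c)"] by (simp add: inner_commute)
    then have "(\<Sum>i\<in>I. w'' y (V i y) (V i y)) =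
        w y * (4 * k\<^sup>2 * q y (y - c) - 2 * k * (\<Sum>i\<in>I. (norm (V i y))\<^sup>2))"
      by (simp add: q_def sum_subtractf flip: sum_distrib_left)
    then have "(\<Sum>i\<in>I. w'' y (V i y) (V i y)) + w' y (b y) =
        2 * k * w y * (2 * k * q y (y - c) - ((\<Sum>i\<in>I. (norm (V i y))\<^sup>2) + (y - c) \<bullet> b y))"
      by (simp add: w'_def power2_eq_square algebra_simps)
    moreover have "2 * k * q y (y - c) > C"
    proof -
      have "\<bar>C\<bar> < 2 * k * (\<mu> * (\<rho> / 2)\<^sup>2)"
        using \<mu>(1) \<rho> by (simp add: k_def power_divide field_simps)
      also have "\<dots> \<le> 2 * k * (\<mu> * (norm (y - c))\<^sup>2)"
        using k \<mu>(1) \<rho> far[OF y] by (intro mult_left_mono power_mono) auto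
      also have "\<dots> \<le> 2 * k * q y (y - c)" using k \<mu>(2)[OF y, of "y - c"] by (intro mult_left_mono) auto
      finally show ?thesis by simp
    qed
    moreover have "w y > 0" by (simp add: w_def)
    ultimately show ?thesis using C[OF y] k by simp
  qed
  \<comment> \<open>On K the function u stays below its maximum by a fixed amount, which absorbs the multiple of w. On the
    rest of the sphere around y1 the barrier itself is smaller than at y1.\<close>
  define K where "K = sphere y1 \<delta> \<inter> cball c \<rho>"
  have "\<exists>\<eta>>0. \<forall>y\<in>K. u y \<le> u p - \<eta>"
  proof (cases "K = {}")
    case False
    have "compact K" unfolding K_def by (intro compact_Int_closed) auto
    moreover have KR: "K \<subseteq> ball p R" using SR by (auto simp: K_def S_def)
    ultimately obtain x where x: "x \<in> K" "\<And>y. y \<in> K \<Longrightarrow> u y \<le> u x"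
      using continuous_attains_sup[OF _ False continuous_on_subset[OF cu KR]] by blast
    have "u x < u p" using x(1) KR \<delta>(1) by (intro less) (auto simp: K_def)
    then show ?thesis using x(2) by (intro exI[of _ "u p - u x"]) auto
  qed (auto intro: exI[of _ 1])
  then obtain \<eta> where \<eta>: "\<eta> > 0" "\<And>y. y \<in> K \<Longrightarrow> u y \<le> u p - \<eta>" by blast
  define \<epsilon> where "\<epsilon> = \<eta> / 2"
  define v where "v y = u y + \<epsilon> * w y" for y
  have \<epsilon>: "\<epsilon> > 0" "\<epsilon> < \<eta>" using \<eta> by (auto simp: \<epsilon>_def)
  have w1: "w y \<le> 1" "w y > 0" for y using k by (auto simp: w_def)
  have bdry: "v y < v y1" if "y \<in> sphere y1 \<delta>" for y
  proof (cases "y \<in> cball c \<rho>")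
    case True
    then have "u y \<le> u p - \<eta>" using that \<eta> by (auto simp: K_def)
    moreover have "\<epsilon> * w y < \<eta>" using w1[of y] \<epsilon> by (smt (verit) mult_left_le)
    moreover have "\<epsilon> * w y1 > 0" using w1 \<epsilon> by simp
    ultimately show ?thesis by (simp add: v_def uy1)
  next
    case False
    have "w y < w y1"
    proof -
      have "norm (y1 - c) < norm (y - c)" using False cd(2) by (auto simp: dist_norm norm_minus_commute)
      then have "(norm (y1 - c))\<^sup>2 < (norm (y - c))\<^sup>2" by (intro power_strict_mono) auto
      then show ?thesis using k by (simp add: w_def power2_norm_eq_inner)
    qed
    moreover have "u y \<le> u p" using that SR by (intro max) (auto simp: S_def)
    ultimately show ?thesis using \<epsilon> by (simp add: v_def uy1 add_le_less_mono)
  qed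
  have dv: "(v has_derivative (\<lambda>h. u' y h + \<epsilon> * w' y h)) (at y)" if "y \<in> ball p R" for y
    unfolding v_def[abs_def] by (auto intro!: derivative_eq_intros u[OF that] dw)
  have dv': "((\<lambda>y. u' y h + \<epsilon> * w' y h) has_derivative (\<lambda>l. u'' y h l + \<epsilon> * w'' y h l)) (at y)"
    if "y \<in> ball p R" for y h
    by (auto intro!: derivative_eq_intros u'[OF that] dw')
  have "continuous_on S v"
    using dv SR has_derivative_continuous by (blast intro: continuous_at_imp_continuous_on)
  then obtain y2 where y2: "y2 \<in> S" "\<And>y. y \<in> S \<Longrightarrow> v y \<le> v y2"
    using continuous_attains_sup[OF Sc(1), of v] Sc(2) by (metis empty_iff)
  have "y2 \<notin> sphere y1 \<delta>" using bdry y2(2)[OF Sc(2)] by fastforce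
  then have y2b: "y2 \<in> ball y1 \<delta>" using y2(1) by (auto simp: S_def)
  have bR: "ball y1 \<delta> \<subseteq> S" by (auto simp: S_def)
  have y2R: "y2 \<in> ball p R" using y2(1) SR by auto
  have "v y \<le> v y2" "(v has_derivative (\<lambda>h. u' y h + \<epsilon> * w' y h)) (at y)" if "y \<in> ball y1 \<delta>" for y
    using that y2(2) dv bR SR by blast+
  note test = second_derivative_nonpos_at_max[OF open_ball y2b this dv'[OF y2R]]
  have first: "u' y2 h + \<epsilon> * w' y2 h = 0" and second: "u'' y2 h h + \<epsilon> * w'' y2 h h \<le> 0" for h
    using fun_cong[OF test(1), of h] test(2)[of h] by simp_all
  have "0 \<ge> (\<Sum>i\<in>I. u'' y2 (V i y2) (V i y2) + \<epsilon> * w'' y2 (V i y2) (V i y2)) + (u' y2 (b y2) + \<epsilon> * w' y2 (b y2))"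
    using sum_nonpos[of I "\<lambda>i. u'' y2 (V i y2) (V i y2) + \<epsilon> * w'' y2 (V i y2) (V i y2)"] second first[of "b y2"] by simp
  also have "(\<Sum>i\<in>I. u'' y2 (V i y2) (V i y2) + \<epsilon> * w'' y2 (V i y2) (V i y2)) + (u' y2 (b y2) + \<epsilon> * w' y2 (b y2))
      = ((\<Sum>i\<in>I. u'' y2 (V i y2) (V i y2)) + u' y2 (b y2)) +
        \<epsilon> * ((\<Sum>i\<in>I. w'' y2 (V i y2) (V i y2)) + w' y2 (b y2))"
    by (simp add: sum.distrib sum_distrib_left algebra_simps)
  also have "\<dots> > 0" using eq[OF y2R] Lw[OF y2(1)] \<epsilon>(1) by simp
  finally show False by simp
qed

section \<open>Charts, vector fields and derivations of functions\<close>

locale manifold =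
  fixes A :: "('a::{t2_space,second_countable_topology}, 'n::finite) chart set"
  assumes atlas: "smooth_atlas A"
begin

text \<open>\<open>Tc c x\<close> translates the fixed identification of the tangent space at \<open>x\<close> with \<open>real^'n\<close> into components with
respect to the chart \<open>c\<close>.\<close>

abbreviation Tc where "Tc c x \<equiv> differential A (snd c) x"
abbreviation dv where "dv \<equiv> deriv_along A"
abbreviation br where "br \<equiv> lie_bracket A"
abbreviation smf where "smf \<equiv> smooth_fun_on A"

lemma chart_homeo: "c \<in> A \<Longrightarrow> homeomorphism (fst c) (snd c ` fst c) (snd c) (chart_inv c)"
  and chart_open: "c \<in> A \<Longrightarrow> open (fst c)"
  and chart_image_open: "c \<in> A \<Longrightarrow> open (snd c ` fst c)"
  and transition_smooth: "c \<in> A \<Longrightarrow> e \<in> A \<Longrightarrow> smooth_on (snd c ` (fst c \<inter> fst e)) (snd e \<circ> chart_inv c)"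
  using atlas by (auto simp: smooth_atlas_def)

lemma chart_inv_left [simp]: "c \<in> A \<Longrightarrow> x \<in> fst c \<Longrightarrow> chart_inv c (snd c x) = x"
  using chart_homeo homeomorphism_apply1 by blast

lemma chart_at_in [simp]: "chart_at A x \<in> A" and chart_at_dom [simp]: "x \<in> fst (chart_at A x)"
proof -
  have "x \<in> (\<Union>c\<in>A. fst c)" using atlas by (simp add: smooth_atlas_def)
  then have "\<exists>c. c \<in> A \<and> x \<in> fst c" by blast
  from someI_ex[OF this] show "chart_at A x \<in> A" "x \<in> fst (chart_at A x)"
    by (auto simp: chart_at_def)
qed

lemma chart_inv_left_set: "c \<in> A \<Longrightarrow> U \<subseteq> fst c \<Longrightarrow> snd c ` U = snd c ` fst c \<inter> chart_inv c -` U"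
  by (force simp: subset_iff image_iff)

lemma chart_image_open_subset:
  assumes "c \<in> A" "open U"
  shows "open (snd c ` (fst c \<inter> U))"
proof -
  have "continuous_on (snd c ` fst c) (chart_inv c)"
    using chart_homeo[OF assms(1)] by (simp add: homeomorphism_def)
  then have "open (snd c ` fst c \<inter> chart_inv c -` (fst c \<inter> U))"
    using chart_open[OF assms(1)] chart_image_open[OF assms(1)] assms(2)
    by (intro continuous_open_preimage) auto
  then show ?thesis using chart_inv_left_set[OF assms(1), of "fst c \<inter> U"] by simp
qed

lemma smooth_fun_on_chartD: "smf U f \<Longrightarrow> c \<in> A \<Longrightarrow> smooth_on (snd c ` (fst c \<inter> U)) (f \<circ> chart_inv c)"
  by (simp add: smooth_fun_on_def)

lemma transition_has_derivative:
  assumes "c \<in> A" "e \<in> A" "x \<in> fst c" "x \<in> fst e"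
  shows "(snd e \<circ> chart_inv c has_derivative frechet_derivative (snd e \<circ> chart_inv c) (at (snd c x))) (at (snd c x))"
  by (rule smooth_on_has_derivative[OF transition_smooth]) (use assms in auto)

text \<open>The chain rule for a change of charts. It is the source of the independence of \<open>differential\<close>
from the chart in which it is computed (\<open>differential_in_chart\<close>).\<close>

lemma frechet_change_chart:
  assumes ce: "c \<in> A" "e \<in> A" "x \<in> fst c" "x \<in> fst e"
    and f: "(f \<circ> chart_inv c) differentiable (at (snd c x))"
  shows "(f \<circ> chart_inv e has_derivative (\<lambda>v. frechet_derivative (f \<circ> chart_inv c) (at (snd c x))
     (frechet_derivative (snd c \<circ> chart_inv e) (at (snd e x)) v))) (at (snd e x))"
proof -
  have "((f \<circ> chart_inv c) has_derivative frechet_derivative (f \<circ> chart_inv c) (at (snd c x)))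
      (at ((snd c \<circ> chart_inv e) (snd e x)))"
    using f ce by (simp add: frechet_derivative_works)
  from diff_chain_at[OF transition_has_derivative[OF ce(2,1,4,3)] this]
  have "((f \<circ> chart_inv c) \<circ> (snd c \<circ> chart_inv e) has_derivative
      (\<lambda>v. frechet_derivative (f \<circ> chart_inv c) (at (snd c x))
      (frechet_derivative (snd c \<circ> chart_inv e) (at (snd e x)) v))) (at (snd e x))"
    by (simp add: o_def)
  then show ?thesis
    by (rule has_derivative_transform_within_open[OF _ chart_image_open_subset[OF ce(2) chart_open[OF ce(1)]]])
      (use ce in auto)
qed

lemma differential_in_chart:
  assumes "c \<in> A" "x \<in> fst c" "(f \<circ> chart_inv c) differentiable (at (snd c x))"
  shows "differential A f x v = frechet_derivative (f \<circ> chart_inv c) (at (snd c x)) (Tc c x v)"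
  using fun_cong[OF frechet_derivative_at[OF frechet_change_chart[OF assms(1) chart_at_in assms(2) chart_at_dom assms(3)]], of v]
  by (simp add: differential_def)

lemma Tc_linear: "c \<in> A \<Longrightarrow> x \<in> fst c \<Longrightarrow> linear (Tc c x)"
  using has_derivative_linear[OF transition_has_derivative[OF chart_at_in _ chart_at_dom]]
  by (simp add: differential_def[abs_def])

text \<open>The inverse of \<open>Tc c x\<close>; thus \<open>Sc c x (axis i 1)\<close> is the \<open>i\<close>-th coordinate vector of \<open>c\<close> at \<open>x\<close>.\<close>

definition Sc where "Sc c x = frechet_derivative (snd (chart_at A x) \<circ> chart_inv c) (at (snd c x))"

lemma frechet_chart_id:
  assumes "c \<in> A" "x \<in> fst c"
  shows "frechet_derivative (snd c \<circ> chart_inv c) (at (snd c x)) = (\<lambda>v. v)"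
proof -
  have "(snd c \<circ> chart_inv c has_derivative (\<lambda>v. v)) (at (snd c x))"
    by (rule has_derivative_transform_within_open[OF has_derivative_ident chart_image_open[OF assms(1)]])
      (use assms in auto)
  then show ?thesis by (metis frechet_derivative_at)
qed

lemma Tc_chart_at: "Tc (chart_at A x) x v = v"
  by (simp add: differential_def frechet_chart_id)

lemma transition_differential:
  assumes "c \<in> A" "e \<in> A" "x \<in> fst c" "x \<in> fst e"
  shows "Tc e x v = frechet_derivative (snd e \<circ> chart_inv c) (at (snd c x)) (Tc c x v)"
  by (rule differential_in_chart[OF assms(1,3) differentiableI[OF transition_has_derivative[OF assms]]])

lemma Sc_Tc [simp]: "c \<in> A \<Longrightarrow> x \<in> fst c \<Longrightarrow> Sc c x (Tc c x v) = v"
  using transition_differential[of c "chart_at A x" x v] by (simp add: Sc_def Tc_chart_at)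

lemma Sc_linear: "c \<in> A \<Longrightarrow> x \<in> fst c \<Longrightarrow> linear (Sc c x)"
  using has_derivative_linear[OF transition_has_derivative[OF _ chart_at_in _ chart_at_dom]]
  by (simp add: Sc_def)

lemma Tc_Sc [simp]:
  assumes "c \<in> A" "x \<in> fst c"
  shows "Tc c x (Sc c x v) = v"
proof -
  have "frechet_derivative (snd c \<circ> chart_inv c) (at (snd c x)) v =
      frechet_derivative (snd c \<circ> chart_inv (chart_at A x)) (at (snd (chart_at A x) x)) (Sc c x v)"
    using frechet_derivative_at[OF frechet_change_chart[OF chart_at_in assms(1) chart_at_dom assms(2), of "snd c"]]
      transition_has_derivative[OF chart_at_in assms(1) chart_at_dom assms(2)]
    by (simp add: Sc_def differentiable_def) metis
  then show ?thesis by (simp add: frechet_chart_id[OF assms] differential_def)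
qed

lemma components_chart: "c \<in> A \<Longrightarrow> x \<in> fst c \<Longrightarrow> components A c X (snd c x) = Tc c x (X x)"
  by (simp add: components_def)

lemma smooth_differentiable:
  "smf U f \<Longrightarrow> c \<in> A \<Longrightarrow> x \<in> fst c \<Longrightarrow> x \<in> U \<Longrightarrow> (f \<circ> chart_inv c) differentiable (at (snd c x))"
  by (rule smooth_on_differentiable[OF smooth_fun_on_chartD]) auto

lemma dv_chart:
  assumes "smf U f" "x \<in> U" "c \<in> A" "x \<in> fst c"
  shows "dv X f x = frechet_derivative (f \<circ> chart_inv c) (at (snd c x)) (components A c X (snd c x))"
  using differential_in_chart[OF assms(3,4) smooth_differentiable[OF assms(1,3,4,2)]] assms
  by (simp add: deriv_along_def components_chart)

definition vf_on where "vf_on U X \<longleftrightarrow> (\<forall>c\<in>A. smooth_on (snd c ` (fst c \<inter> U)) (components A c X))"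

lemma vfields_iff: "X \<in> vfields A \<longleftrightarrow> vf_on UNIV X"
  by (simp add: vf_on_def vfields_def)

lemma smooth_fun_on_mono: "smf U f \<Longrightarrow> V \<subseteq> U \<Longrightarrow> smf V f"
  unfolding smooth_fun_on_def using smooth_on_subset by (metis image_mono inf_mono order_refl)

lemma vf_on_mono: "vf_on U X \<Longrightarrow> V \<subseteq> U \<Longrightarrow> vf_on V X"
  unfolding vf_on_def using smooth_on_subset by (metis image_mono inf_mono order_refl)

lemma vfields_vf_on: "X \<in> vfields A \<Longrightarrow> vf_on U X"
  using vf_on_mono vfields_iff by blast

lemma smooth_fun_on_local:
  assumes "\<And>x. x \<in> U \<Longrightarrow> \<exists>N. open N \<and> x \<in> N \<and> smf N f"
  shows "smf U f"
  unfolding smooth_fun_on_def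
proof
  fix c assume c: "c \<in> A"
  show "smooth_on (snd c ` (fst c \<inter> U)) (f \<circ> chart_inv c)"
  proof (rule smooth_on_local)
    fix y assume "y \<in> snd c ` (fst c \<inter> U)"
    then obtain x where x: "x \<in> fst c" "x \<in> U" "y = snd c x" by auto
    obtain N where "open N" "x \<in> N" "smf N f" using assms[OF x(2)] by auto
    then show "\<exists>T. open T \<and> y \<in> T \<and> smooth_on T (f \<circ> chart_inv c)"
      using x c chart_image_open_subset[OF c, of N] smooth_fun_on_chartD[of N f c]
      by (intro exI[of _ "snd c ` (fst c \<inter> N)"]) auto
  qed
qed

lemma vf_on_local:
  assumes "\<And>x. x \<in> U \<Longrightarrow> \<exists>N. open N \<and> x \<in> N \<and> vf_on N X"
  shows "vf_on U X"
  unfolding vf_on_def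
proof
  fix c assume c: "c \<in> A"
  show "smooth_on (snd c ` (fst c \<inter> U)) (components A c X)"
  proof (rule smooth_on_local)
    fix y assume "y \<in> snd c ` (fst c \<inter> U)"
    then obtain x where x: "x \<in> fst c" "x \<in> U" "y = snd c x" by auto
    obtain N where "open N" "x \<in> N" "vf_on N X" using assms[OF x(2)] by auto
    then show "\<exists>T. open T \<and> y \<in> T \<and> smooth_on T (components A c X)"
      using x c chart_image_open_subset[OF c]
      by (intro exI[of _ "snd c ` (fst c \<inter> N)"]) (auto simp: vf_on_def)
  qed
qed

text \<open>On an open set covered by one chart, smoothness need only be tested in that chart, since the transition
maps are smooth. The same holds for vector fields (\<open>vf_on_chart\<close>).\<close>

lemma smooth_fun_on_chart:
  assumes c: "c \<in> A" "open U" "U \<subseteq> fst c" and f: "smooth_on (snd c ` U) (f \<circ> chart_inv c)"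
  shows "smf U f"
  unfolding smooth_fun_on_def
proof
  fix e assume e: "e \<in> A"
  have op: "open (snd e ` (fst e \<inter> U))" "open (snd c ` U)"
    using chart_image_open_subset[OF e c(2)] chart_image_open_subset[OF c(1,2)] c(3) by (simp_all add: Int_absorb1)
  have "smooth_on (snd e ` (fst e \<inter> U)) (snd c \<circ> chart_inv e)"
    using transition_smooth[OF e c(1)] by (rule smooth_on_subset) (use c in auto)
  moreover have "(snd c \<circ> chart_inv e) ` (snd e ` (fst e \<inter> U)) \<subseteq> snd c ` U" using e by auto
  ultimately have "smooth_on (snd e ` (fst e \<inter> U)) (\<lambda>y. (f \<circ> chart_inv c) ((snd c \<circ> chart_inv e) y))"
    using smooth_on_compose[OF f _ op] by blast
  then show "smooth_on (snd e ` (fst e \<inter> U)) (f \<circ> chart_inv e)"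
    by (rule smooth_on_cong[OF _ op(1)]) (use c e in auto)
qed

lemma vf_on_chart:
  assumes c: "c \<in> A" "open U" "U \<subseteq> fst c" and X: "smooth_on (snd c ` U) (components A c X)"
  shows "vf_on U X"
  unfolding vf_on_def
proof
  fix e assume e: "e \<in> A"
  have op: "open (snd e ` (fst e \<inter> U))" "open (snd c ` U)" "open (snd c ` (fst c \<inter> fst e \<inter> U))"
    using chart_image_open_subset[OF e c(2)] chart_image_open_subset[OF c(1,2)] c(3)
      chart_image_open_subset[OF c(1), of "fst e \<inter> U"] chart_open[OF e] c(2) by (auto simp: Int_absorb1 Int_assoc)
  have tr: "smooth_on (snd e ` (fst e \<inter> U)) (snd c \<circ> chart_inv e)"
    using transition_smooth[OF e c(1)] by (rule smooth_on_subset) (use c in auto)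
  have "smooth_on (snd c ` (fst c \<inter> fst e \<inter> U)) (\<lambda>y. frechet_derivative (snd e \<circ> chart_inv c) (at y) (components A c X y))"
    by (rule smooth_on_frechet_apply[OF op(3) smooth_on_subset[OF transition_smooth[OF c(1) e]] smooth_on_subset[OF X]]) auto
  moreover have "(snd c \<circ> chart_inv e) ` (snd e ` (fst e \<inter> U)) \<subseteq> snd c ` (fst c \<inter> fst e \<inter> U)"
    using c e by auto
  ultimately have "smooth_on (snd e ` (fst e \<inter> U)) (\<lambda>y. frechet_derivative (snd e \<circ> chart_inv c) (at ((snd c \<circ> chart_inv e) y))
      (components A c X ((snd c \<circ> chart_inv e) y)))"
    using smooth_on_compose[OF _ tr op(1,3)] by blast
  then show "smooth_on (snd e ` (fst e \<inter> U)) (components A e X)"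
  proof (rule smooth_on_cong[OF _ op(1)])
    fix y assume "y \<in> snd e ` (fst e \<inter> U)"
    then obtain x where x: "x \<in> fst e" "x \<in> U" "y = snd e x" by auto
    then show "frechet_derivative (snd e \<circ> chart_inv c) (at ((snd c \<circ> chart_inv e) y))
        (components A c X ((snd c \<circ> chart_inv e) y)) = components A e X y"
      using c e by (simp add: components_chart subset_iff transition_differential[OF c(1) e])
  qed
qed

lemma smooth_fun_on_cong: "smf U f \<Longrightarrow> open U \<Longrightarrow> (\<And>x. x \<in> U \<Longrightarrow> f x = h x) \<Longrightarrow> smf U h"
  unfolding smooth_fun_on_def
proof
  fix c assume *: "\<forall>c\<in>A. smooth_on (snd c ` (fst c \<inter> U)) (f \<circ> chart_inv c)" "open U"
    "\<And>x. x \<in> U \<Longrightarrow> f x = h x" and c: "c \<in> A"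
  show "smooth_on (snd c ` (fst c \<inter> U)) (h \<circ> chart_inv c)"
    by (rule smooth_on_cong[OF bspec[OF *(1) c] chart_image_open_subset[OF c *(2)]]) (use * c in auto)
qed

lemma vf_on_cong:
  assumes "vf_on U X" "open U" "\<And>x. x \<in> U \<Longrightarrow> X x = Y x"
  shows "vf_on U Y"
  unfolding vf_on_def
proof
  fix c assume c: "c \<in> A"
  show "smooth_on (snd c ` (fst c \<inter> U)) (components A c Y)"
    by (rule smooth_on_cong[OF assms(1)[unfolded vf_on_def, rule_format, OF c] chart_image_open_subset[OF c assms(2)]])
      (use assms c in \<open>auto simp: components_chart\<close>)
qed

lemma smooth_fun_on_const [simp]: "smf U (\<lambda>x. a)"
  by (simp add: smooth_fun_on_def o_def smooth_on_const)

lemma smooth_fun_on_bilinear: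
  assumes "bounded_bilinear P" "open U" "smf U f" "smf U h"
  shows "smf U (\<lambda>x. P (f x) (h x))"
  unfolding smooth_fun_on_def
proof
  fix c assume c: "c \<in> A"
  show "smooth_on (snd c ` (fst c \<inter> U)) ((\<lambda>x. P (f x) (h x)) \<circ> chart_inv c)"
    using smooth_on_bilinear[OF assms(1) chart_image_open_subset[OF c assms(2)]
        smooth_fun_on_chartD[OF assms(3) c] smooth_fun_on_chartD[OF assms(4) c]]
    by (simp add: o_def)
qed

lemmas smooth_fun_on_mult = smooth_fun_on_bilinear[OF bounded_bilinear_mult]

lemma smooth_fun_on_add:
  assumes "open U" "smf U f" "smf U h"
  shows "smf U (\<lambda>x. f x + h x)"
  unfolding smooth_fun_on_def
proof
  fix c assume c: "c \<in> A"
  show "smooth_on (snd c ` (fst c \<inter> U)) ((\<lambda>x. f x + h x) \<circ> chart_inv c)"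
    using smooth_on_add[OF chart_image_open_subset[OF c assms(1)]
        smooth_fun_on_chartD[OF assms(2) c] smooth_fun_on_chartD[OF assms(3) c]]
    by (simp add: o_def)
qed

lemma smooth_fun_on_sum:
  assumes "open U"
  shows "(\<And>i. i \<in> I \<Longrightarrow> smf U (f i)) \<Longrightarrow> smf U (\<lambda>x. \<Sum>i\<in>I. f i x)"
proof (induction I rule: infinite_finite_induct)
  case (insert a I)
  then show ?case using smooth_fun_on_add[OF assms, of "f a"] by simp
qed auto

lemma smooth_fun_on_uminus: "open U \<Longrightarrow> smf U f \<Longrightarrow> smf U (\<lambda>x. - f x :: real)"
  using smooth_fun_on_mult[of U "\<lambda>x. -1" f] by simp

lemma components_add: "c \<in> A \<Longrightarrow> x \<in> fst c \<Longrightarrow>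
  components A c (\<lambda>x. X x + Y x) (snd c x) = components A c X (snd c x) + components A c Y (snd c x)"
  by (simp add: components_chart linear_add[OF Tc_linear])

lemma components_scaleR: "c \<in> A \<Longrightarrow> x \<in> fst c \<Longrightarrow>
  components A c (\<lambda>x. f x *\<^sub>R X x) (snd c x) = f x *\<^sub>R components A c X (snd c x)"
  by (simp add: components_chart linear_scale[OF Tc_linear])

lemma vf_on_add:
  assumes "open U" "vf_on U X" "vf_on U Y"
  shows "vf_on U (\<lambda>x. X x + Y x)"
  unfolding vf_on_def
proof
  fix c assume c: "c \<in> A"
  note op = chart_image_open_subset[OF c assms(1)]
  show "smooth_on (snd c ` (fst c \<inter> U)) (components A c (\<lambda>x. X x + Y x))"
    by (rule smooth_on_cong[OF smooth_on_add[OF op, of "components A c X" "components A c Y"] op])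
      (use assms c in \<open>auto simp: vf_on_def components_add\<close>)
qed

lemma vf_on_scaleR:
  assumes "open U" "smf U f" "vf_on U X"
  shows "vf_on U (\<lambda>x. f x *\<^sub>R X x)"
  unfolding vf_on_def
proof
  fix c assume c: "c \<in> A"
  note op = chart_image_open_subset[OF c assms(1)]
  show "smooth_on (snd c ` (fst c \<inter> U)) (components A c (\<lambda>x. f x *\<^sub>R X x))"
    by (rule smooth_on_cong[OF smooth_on_scaleR[OF op, of "f \<circ> chart_inv c" "components A c X"] op])
      (use assms c in \<open>auto simp: vf_on_def smooth_fun_on_def components_scaleR\<close>)
qed

lemma vf_on_zero: "vf_on U (\<lambda>x. 0)"
proof -
  have "vf_on UNIV (\<lambda>x. 0)"
    unfolding vf_on_def
  proof
    fix c assume c: "c \<in> A"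
    show "smooth_on (snd c ` (fst c \<inter> UNIV)) (components A c (\<lambda>x. 0))"
      by (rule smooth_on_cong[OF smooth_on_const[of _ 0] chart_image_open_subset[OF c open_UNIV]])
        (use c in \<open>auto simp: components_chart linear_0[OF Tc_linear]\<close>)
  qed
  then show ?thesis using vf_on_mono by blast
qed

lemma vfields_zero [simp]: "(\<lambda>x. 0) \<in> vfields A"
  and vfields_add [simp]: "X \<in> vfields A \<Longrightarrow> Y \<in> vfields A \<Longrightarrow> (\<lambda>x. X x + Y x) \<in> vfields A"
  and vfields_scaleR [simp]: "smf UNIV f \<Longrightarrow> X \<in> vfields A \<Longrightarrow> (\<lambda>x. f x *\<^sub>R X x) \<in> vfields A"
  by (simp_all add: vfields_iff vf_on_zero vf_on_add vf_on_scaleR)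

lemma vfields_cmul [simp]: "X \<in> vfields A \<Longrightarrow> (\<lambda>x. a *\<^sub>R X x) \<in> vfields A"
  using vfields_scaleR[of "\<lambda>x. a"] by simp

lemma vfields_uminus [simp]: "X \<in> vfields A \<Longrightarrow> (\<lambda>x. - X x) \<in> vfields A"
  using vfields_cmul[of X "-1"] by simp

lemma vfields_diff [simp]: "X \<in> vfields A \<Longrightarrow> Y \<in> vfields A \<Longrightarrow> (\<lambda>x. X x - Y x) \<in> vfields A"
  using vfields_add[of X "\<lambda>x. - Y x"] vfields_uminus[of Y] by simp

lemma vfields_sum [simp]: "(\<And>i. i \<in> I \<Longrightarrow> X i \<in> vfields A) \<Longrightarrow> (\<lambda>x. \<Sum>i\<in>I. X i x) \<in> vfields A"
proof (induction I rule: infinite_finite_induct)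
  case (insert a I)
  then show ?case using vfields_add[of "X a"] by simp
qed auto

lemma smooth_deriv_along:
  assumes "open U" "smf U f" "vf_on U X"
  shows "smf U (dv X f)"
  unfolding smooth_fun_on_def
proof
  fix c assume c: "c \<in> A"
  note op = chart_image_open_subset[OF c assms(1)]
  show "smooth_on (snd c ` (fst c \<inter> U)) (dv X f \<circ> chart_inv c)"
    by (rule smooth_on_cong[OF smooth_on_frechet_apply[OF op, of "f \<circ> chart_inv c" "components A c X"] op])
      (use assms c in \<open>auto simp: vf_on_def smooth_fun_on_def dv_chart[OF assms(2) _ c]\<close>)
qed

text \<open>The open set \<open>W\<close> is the complement of a closed set outside of which the bump function vanishes. It is part of the statement
because smoothness of an extension by zero is verified separately on \<open>U\<close> and on \<open>W\<close>.\<close>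

lemma exists_bump_chart:
  assumes "open U" "x \<in> U"
  obtains \<rho> N W where "smf UNIV \<rho>" "open N" "x \<in> N" "N \<subseteq> U" "\<And>z. z \<in> N \<Longrightarrow> \<rho> z = (1::real)"
    "open W" "W \<union> U = UNIV" "\<And>z. z \<in> W \<Longrightarrow> \<rho> z = 0"
proof -
  define c where "c = chart_at A x"
  have c: "c \<in> A" "x \<in> fst c" by (simp_all add: c_def)
  note op = chart_image_open_subset[OF c(1) assms(1)]
  have hom: "continuous_on (snd c ` fst c) (chart_inv c)" "continuous_on (fst c) (snd c)"
    using chart_homeo[OF c(1)] by (simp_all add: homeomorphism_def)
  obtain r where r: "r > 0" "ball (snd c x) r \<subseteq> snd c ` (fst c \<inter> U)"
    using open_contains_ball[THEN iffD1, OF op] c assms(2) by blast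
  define a where "a = r / 4"
  have a: "a > 0" "cball (snd c x) (2 * a) \<subseteq> ball (snd c x) r" "ball (snd c x) a \<subseteq> ball (snd c x) r"
    using r by (auto simp: a_def)
  obtain b :: "real^'n \<Rightarrow> real" where b: "smooth_on UNIV b" "\<And>y. y \<in> cball (snd c x) a \<Longrightarrow> b y = 1"
    "\<And>y. y \<notin> ball (snd c x) (2 * a) \<Longrightarrow> b y = 0" using exists_bump[OF a(1)] by blast
  define K where "K = chart_inv c ` cball (snd c x) (2 * a)"
  have KU: "K \<subseteq> fst c \<inter> U" using a(2) r(2) c unfolding K_def by force
  have "compact K" unfolding K_def
    by (rule compact_continuous_image[OF continuous_on_subset[OF hom(1)]]) (use a r in auto)
  then have K: "closed K" by (rule compact_imp_closed)
  define \<rho> where "\<rho> z = (if z \<in> fst c then b (snd c z) else 0)" for z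
  have zero: "\<rho> z = 0" if "z \<notin> K" for z
  proof (cases "z \<in> fst c")
    case True
    then have "snd c z \<notin> cball (snd c x) (2 * a)"
      using that c(1) unfolding K_def by (metis chart_inv_left image_eqI)
    then have "snd c z \<notin> ball (snd c x) (2 * a)" by simp
    then show ?thesis using b(3) by (simp add: \<rho>_def)
  qed (simp add: \<rho>_def)
  have s1: "smf (fst c) \<rho>"
  proof (rule smooth_fun_on_chart[OF c(1) chart_open[OF c(1)] order_refl])
    have "smooth_on (snd c ` fst c) b" using b(1) by (rule smooth_on_subset) auto
    then show "smooth_on (snd c ` fst c) (\<rho> \<circ> chart_inv c)"
      by (rule smooth_on_cong[OF _ chart_image_open[OF c(1)]]) (use c(1) in \<open>auto simp: \<rho>_def\<close>)
  qed
  have s2: "smf (- K) \<rho>"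
    by (rule smooth_fun_on_cong[OF smooth_fun_on_const[of _ 0]]) (use K zero in auto)
  have sm: "smf UNIV \<rho>"
  proof (rule smooth_fun_on_local)
    fix z
    show "\<exists>N. open N \<and> z \<in> N \<and> smf N \<rho>"
    proof (cases "z \<in> K")
      case True
      then show ?thesis using s1 chart_open[OF c(1)] KU by blast
    next
      case False
      then show ?thesis using s2 K by (intro exI[of _ "- K"]) auto
    qed
  qed
  define N where "N = {z \<in> fst c. snd c z \<in> ball (snd c x) a}"
  have "open (fst c \<inter> snd c -` ball (snd c x) a)"
    by (rule continuous_open_preimage[OF hom(2) chart_open[OF c(1)]]) auto
  then have N: "open N" by (simp add: N_def Int_def vimage_def)
  have NU: "N \<subseteq> U"
  proof
    fix z assume z: "z \<in> N"
    then have "snd c z \<in> snd c ` (fst c \<inter> U)" using a(3) r(2) by (auto simp: N_def)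
    then show "z \<in> U" using z c(1) by (auto simp: N_def) (metis chart_inv_left)
  qed
  show thesis
    by (rule that[OF sm N _ NU _ _ _ zero, of "- K"]) (use K KU a b c in \<open>auto simp: N_def \<rho>_def\<close>)
qed

lemma extend_function:
  assumes "open U" "x \<in> U" "smf U (f :: 'a \<Rightarrow> real)"
  obtains h N where "smf UNIV h" "open N" "x \<in> N" "N \<subseteq> U" "\<And>z. z \<in> N \<Longrightarrow> h z = f z"
proof -
  obtain \<rho> N W where *: "smf UNIV \<rho>" "open N" "x \<in> N" "N \<subseteq> U" "\<And>z. z \<in> N \<Longrightarrow> \<rho> z = (1::real)"
    "open W" "W \<union> U = UNIV" "\<And>z. z \<in> W \<Longrightarrow> \<rho> z = 0" using exists_bump_chart[OF assms(1,2)] by blast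
  have s1: "smf U (\<lambda>z. \<rho> z * f z)"
    by (rule smooth_fun_on_mult[OF assms(1) smooth_fun_on_mono[OF *(1)] assms(3)]) auto
  have s2: "smf W (\<lambda>z. \<rho> z * f z)"
    by (rule smooth_fun_on_cong[OF smooth_fun_on_const[of _ 0] *(6)]) (use *(8) in auto)
  have "smf UNIV (\<lambda>z. \<rho> z * f z)"
    by (rule smooth_fun_on_local) (metis s1 s2 assms(1) *(6,7) UnE UNIV_I)
  then show thesis by (rule that[OF _ *(2-4)]) (use * in auto)
qed

lemma extend_vfield:
  assumes "open U" "x \<in> U" "vf_on U X"
  obtains Y N where "Y \<in> vfields A" "open N" "x \<in> N" "N \<subseteq> U" "\<And>z. z \<in> N \<Longrightarrow> Y z = X z"
proof -
  obtain \<rho> N W where *: "smf UNIV \<rho>" "open N" "x \<in> N" "N \<subseteq> U" "\<And>z. z \<in> N \<Longrightarrow> \<rho> z = (1::real)"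
    "open W" "W \<union> U = UNIV" "\<And>z. z \<in> W \<Longrightarrow> \<rho> z = 0" using exists_bump_chart[OF assms(1,2)] by blast
  have s1: "vf_on U (\<lambda>z. \<rho> z *\<^sub>R X z)"
    by (rule vf_on_scaleR[OF assms(1) smooth_fun_on_mono[OF *(1)] assms(3)]) auto
  have s2: "vf_on W (\<lambda>z. \<rho> z *\<^sub>R X z)"
    by (rule vf_on_cong[OF vf_on_zero *(6)]) (use *(8) in auto)
  have "vf_on UNIV (\<lambda>z. \<rho> z *\<^sub>R X z)"
    by (rule vf_on_local) (metis s1 s2 assms(1) *(6,7) UnE UNIV_I)
  then have "(\<lambda>z. \<rho> z *\<^sub>R X z) \<in> vfields A" by (simp add: vfields_iff)
  then show thesis by (rule that[OF _ *(2-4)]) (use * in auto)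
qed

lemma vf_on_coordinate:
  assumes "c \<in> A"
  shows "vf_on (fst c) (\<lambda>z. Sc c z v)"
proof (rule vf_on_chart[OF assms chart_open[OF assms] order_refl])
  show "smooth_on (snd c ` fst c) (components A c (\<lambda>z. Sc c z v))"
    by (rule smooth_on_cong[OF smooth_on_const[of _ v] chart_image_open[OF assms]])
      (use assms in \<open>auto simp: components_chart\<close>)
qed

lemma smooth_coordinate:
  assumes "c \<in> A"
  shows "smf (fst c) (\<lambda>z. snd c z $ i)"
proof (rule smooth_fun_on_chart[OF assms chart_open[OF assms] order_refl])
  show "smooth_on (snd c ` fst c) ((\<lambda>z. snd c z $ i) \<circ> chart_inv c)"
    by (rule smooth_on_cong[OF smooth_on_nth[OF chart_image_open[OF assms] smooth_on_id] chart_image_open[OF assms]])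
      (use assms chart_image_open in auto)
qed

lemma extend_vector:
  obtains X where "X \<in> vfields A" "X x = v"
proof -
  obtain Y N where "Y \<in> vfields A" "x \<in> N" "\<And>z. z \<in> N \<Longrightarrow> Y z = Sc (chart_at A x) z (Tc (chart_at A x) x v)"
    using extend_vfield[OF chart_open[OF chart_at_in] chart_at_dom vf_on_coordinate[OF chart_at_in]] by metis
  then show thesis using that[of Y] by simp
qed

lemma differential_has_derivative:
  assumes "smf U f" "x \<in> U"
  shows "(f \<circ> chart_inv (chart_at A x) has_derivative differential A f x) (at (snd (chart_at A x) x))"
  using smooth_differentiable[OF assms(1) chart_at_in chart_at_dom assms(2)]
  by (simp add: frechet_derivative_works differential_def[abs_def])

lemma differential_linear: "smf U f \<Longrightarrow> x \<in> U \<Longrightarrow> linear (differential A f x)"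
  using differential_has_derivative has_derivative_linear by blast

lemma differential_eqI:
  assumes "(f \<circ> chart_inv (chart_at A x) has_derivative L) (at (snd (chart_at A x) x))"
  shows "differential A f x = L"
  using frechet_derivative_at[OF assms] by (simp add: differential_def[abs_def])

lemma dv_add_field: "smf U f \<Longrightarrow> x \<in> U \<Longrightarrow> dv (\<lambda>x. X x + Y x) f x = dv X f x + dv Y f x"
  by (simp add: deriv_along_def linear_add[OF differential_linear])

lemma dv_zero_field: "smf U f \<Longrightarrow> x \<in> U \<Longrightarrow> X x = 0 \<Longrightarrow> dv X f x = 0"
  by (simp add: deriv_along_def linear_0[OF differential_linear])

lemma dv_const [simp]: "dv X (\<lambda>x. a) x = 0"
proof -
  have "differential A (\<lambda>x. a) x = (\<lambda>v. 0)" by (rule differential_eqI) (simp add: o_def)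
  then show ?thesis by (simp add: deriv_along_def)
qed

lemma dv_add:
  assumes "smf U f" "smf U h" "x \<in> U"
  shows "dv X (\<lambda>x. f x + h x) x = dv X f x + dv X h x"
proof -
  have "differential A (\<lambda>x. f x + h x) x = (\<lambda>v. differential A f x v + differential A h x v)"
    by (rule differential_eqI)
      (use has_derivative_add[OF differential_has_derivative[OF assms(1,3)] differential_has_derivative[OF assms(2,3)]]
        in \<open>simp add: o_def\<close>)
  then show ?thesis by (simp add: deriv_along_def)
qed

lemma dv_mult:
  assumes "smf U f" "smf U h" "x \<in> U"
  shows "dv X (\<lambda>x. f x * h x) x = dv X f x * h x + f x * dv X h x"
proof -
  have "differential A (\<lambda>x. f x * h x) x = (\<lambda>v. f x * differential A h x v + differential A f x v * h x)"
    by (rule differential_eqI)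
      (use has_derivative_mult[OF differential_has_derivative[OF assms(1,3)] differential_has_derivative[OF assms(2,3)]]
        in \<open>simp add: o_def\<close>)
  then show ?thesis by (simp add: deriv_along_def)
qed

lemma dv_local:
  assumes "smf U f" "x \<in> U" "open N" "x \<in> N" "\<And>z. z \<in> N \<Longrightarrow> f z = h z"
  shows "dv X h x = dv X f x"
proof -
  have "differential A h x = differential A f x"
    by (rule differential_eqI, rule has_derivative_transform_within_open[OF differential_has_derivative[OF assms(1,2)]
          chart_image_open_subset[OF chart_at_in assms(3)]]) (use assms in auto)
  then show ?thesis by (simp add: deriv_along_def)
qed

lemma dv_cmul: "smf U f \<Longrightarrow> x \<in> U \<Longrightarrow> dv X (\<lambda>x. a * f x) x = a * dv X f x"
  using dv_mult[of U "\<lambda>x. a" f x X] by simp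

lemma dv_uminus: "smf U f \<Longrightarrow> x \<in> U \<Longrightarrow> dv X (\<lambda>x. - f x) x = - dv X f x"
  using dv_cmul[of U f x X "-1"] by simp

lemma dv_diff: "open U \<Longrightarrow> smf U f \<Longrightarrow> smf U h \<Longrightarrow> x \<in> U \<Longrightarrow> dv X (\<lambda>x. f x - h x) x = dv X f x - dv X h x"
  using dv_add[of U f "\<lambda>x. - h x" x X] smooth_fun_on_uminus[of U h] dv_uminus[of U h x X] by simp

lemma dv_sum:
  assumes "open U" "x \<in> U" "\<And>i. i \<in> I \<Longrightarrow> smf U (f i)"
  shows "dv X (\<lambda>x. \<Sum>i\<in>I. f i x) x = (\<Sum>i\<in>I. dv X (f i) x)"
  using assms(3)
proof (induction I rule: infinite_finite_induct)
  case (insert a I)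
  then show ?case
    using dv_add[of U "f a" "\<lambda>x. \<Sum>i\<in>I. f i x" x X] smooth_fun_on_sum[OF assms(1), of I f] assms(2) by simp
qed auto

text \<open>In a chart, the second derivative \<open>X (Y f)\<close> splits into the second derivative of \<open>f\<close> and a first order
term. The first part is symmetric in \<open>X\<close> and \<open>Y\<close>, whence \<open>dv_bracket\<close>; taken with \<open>X = Y\<close>, the
formula also turns sums of squares of vector fields into elliptic operators.\<close>

lemma dv_twice_chart:
  assumes "open U" "smf U f" "x \<in> U" "vf_on U X" "vf_on U Y" "c \<in> A" "x \<in> fst c"
  defines "u \<equiv> f \<circ> chart_inv c"
  shows "dv X (dv Y f) x =
     frechet_derivative (\<lambda>y. frechet_derivative u (at y) (components A c Y (snd c x))) (at (snd c x)) (components A c X (snd c x))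
     + frechet_derivative u (at (snd c x)) (frechet_derivative (components A c Y) (at (snd c x)) (components A c X (snd c x)))"
proof -
  define S where "S = snd c ` (fst c \<inter> U)"
  define y where "y = snd c x"
  define Yc where "Yc = components A c Y"
  have S: "open S" "y \<in> S"
    using chart_image_open_subset[OF assms(6,1)] assms by (auto simp: S_def y_def)
  have u: "smooth_on S u" using assms(2,6) by (simp add: S_def u_def smooth_fun_on_def)
  have Yc: "smooth_on S Yc" using assms(5,6) by (simp add: S_def Yc_def vf_on_def)
  have eq: "(dv Y f \<circ> chart_inv c) z = (\<Sum>b\<in>Basis. (Yc z \<bullet> b) * frechet_derivative u (at z) b)" if z: "z \<in> S" for z
  proof -
    obtain w where w: "w \<in> fst c" "w \<in> U" "z = snd c w" using z by (auto simp: S_def)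
    have "(dv Y f \<circ> chart_inv c) z = frechet_derivative u (at z) (Yc z)"
      using dv_chart[OF assms(2) w(2) assms(6) w(1)] w assms(6) by (simp add: u_def Yc_def)
    then show ?thesis
      using linear_euclidean_expansion[OF smooth_on_linear_frechet[OF u z], of "Yc z"] by simp
  qed
  let ?H = "\<lambda>b. frechet_derivative (\<lambda>z. frechet_derivative u (at z) b) (at y)"
  have "((\<lambda>z. \<Sum>b\<in>Basis. (Yc z \<bullet> b) * frechet_derivative u (at z) b) has_derivative
     (\<lambda>v. \<Sum>b\<in>Basis. (Yc y \<bullet> b) * ?H b v + (frechet_derivative Yc (at y) v \<bullet> b) * frechet_derivative u (at y) b)) (at y)"
    by (intro has_derivative_sum has_derivative_mult has_derivative_inner_left
          smooth_on_has_derivative[OF Yc S(2)] smooth_on_has_derivative[OF smooth_on_frechet[OF u] S(2)])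
  then have "(dv Y f \<circ> chart_inv c has_derivative
     (\<lambda>v. \<Sum>b\<in>Basis. (Yc y \<bullet> b) * ?H b v + (frechet_derivative Yc (at y) v \<bullet> b) * frechet_derivative u (at y) b)) (at y)"
    by (rule has_derivative_transform_within_open[OF _ S]) (rule eq[symmetric])
  from fun_cong[OF frechet_derivative_at[OF this], of "components A c X y"]
  have "dv X (dv Y f) x = (\<Sum>b\<in>Basis. (Yc y \<bullet> b) * ?H b (components A c X y) +
      (frechet_derivative Yc (at y) (components A c X y) \<bullet> b) * frechet_derivative u (at y) b)"
    using dv_chart[OF smooth_deriv_along[OF assms(1,2,5)] assms(3,6,7), of X] by (simp add: y_def)
  also have "\<dots> = (\<Sum>b\<in>Basis. (Yc y \<bullet> b) * ?H b (components A c X y)) +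
      frechet_derivative u (at y) (frechet_derivative Yc (at y) (components A c X y))"
    using linear_euclidean_expansion[OF smooth_on_linear_frechet[OF u S(2)], of "frechet_derivative Yc (at y) (components A c X y)"]
    by (simp add: sum.distrib)
  also have "(\<Sum>b\<in>Basis. (Yc y \<bullet> b) * ?H b (components A c X y)) = ?H (Yc y) (components A c X y)"
  proof -
    have "linear (\<lambda>w. ?H w (components A c X y))"
    proof (rule linearI)
      fix a b :: "real^'n" and r :: real
      have "((\<lambda>z. frechet_derivative u (at z) a + frechet_derivative u (at z) b) has_derivative (\<lambda>v. ?H a v + ?H b v)) (at y)"
        by (intro has_derivative_add smooth_on_has_derivative[OF smooth_on_frechet[OF u] S(2)])
      then have "((\<lambda>z. frechet_derivative u (at z) (a + b)) has_derivative (\<lambda>v. ?H a v + ?H b v)) (at y)"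
        by (rule has_derivative_transform_within_open[OF _ S]) (simp add: linear_add[OF smooth_on_linear_frechet[OF u]])
      note d = this
      show "?H (a + b) (components A c X y) = ?H a (components A c X y) + ?H b (components A c X y)"
        by (rule fun_cong[OF frechet_derivative_at[OF d], symmetric])
      have "((\<lambda>z. r *\<^sub>R frechet_derivative u (at z) a) has_derivative (\<lambda>v. r *\<^sub>R ?H a v)) (at y)"
        by (intro has_derivative_scaleR_right smooth_on_has_derivative[OF smooth_on_frechet[OF u] S(2)])
      then have "((\<lambda>z. frechet_derivative u (at z) (r *\<^sub>R a)) has_derivative (\<lambda>v. r *\<^sub>R ?H a v)) (at y)"
        by (rule has_derivative_transform_within_open[OF _ S]) (simp add: linear_scale[OF smooth_on_linear_frechet[OF u]])
      note d = this
      show "?H (r *\<^sub>R a) (components A c X y) = r *\<^sub>R ?H a (components A c X y)"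
        by (rule fun_cong[OF frechet_derivative_at[OF d], symmetric])
    qed
    from linear_euclidean_expansion[OF this, of "Yc y"] show ?thesis by simp
  qed
  finally show ?thesis by (simp add: y_def Yc_def)
qed

lemma dv_bracket:
  assumes "open U" "smf U f" "x \<in> U" "X \<in> vfields A" "Y \<in> vfields A"
  shows "dv (br X Y) f x = dv X (dv Y f) x - dv Y (dv X f) x"
proof -
  define c where "c = chart_at A x"
  define u where "u = f \<circ> chart_inv c"
  define y where "y = snd c x"
  have c: "c \<in> A" "x \<in> fst c" by (simp_all add: c_def)
  have S: "open (snd c ` (fst c \<inter> U))" "y \<in> snd c ` (fst c \<inter> U)"
    using chart_image_open_subset[OF c(1) assms(1)] assms(3) c by (auto simp: y_def)
  have u: "smooth_on (snd c ` (fst c \<inter> U)) u" using assms(2) c by (simp add: u_def smooth_fun_on_def)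
  have comp: "components A c X y = X x" for X
    using components_chart[OF c] Tc_chart_at[of x "X x"] by (simp add: y_def c_def)
  have "dv (br X Y) f x = frechet_derivative u (at y) (br X Y x)"
    by (simp add: deriv_along_def differential_def u_def y_def c_def)
  also have "\<dots> = frechet_derivative u (at y) (frechet_derivative (components A c Y) (at y) (X x))
      - frechet_derivative u (at y) (frechet_derivative (components A c X) (at y) (Y x))"
    by (simp add: lie_bracket_def Let_def linear_diff[OF smooth_on_linear_frechet[OF u S(2)]] flip: c_def y_def)
  also have "\<dots> = dv X (dv Y f) x - dv Y (dv X f) x"
    using dv_twice_chart[OF assms(1-3) vfields_vf_on[OF assms(4)] vfields_vf_on[OF assms(5)] c]
      dv_twice_chart[OF assms(1-3) vfields_vf_on[OF assms(5)] vfields_vf_on[OF assms(4)] c]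
      second_derivative_symmetric[OF S(1) u S(2)] comp
    by (simp add: u_def y_def)
  finally show ?thesis .
qed

text \<open>A tangent vector is determined by its action on functions, because the coordinates of a chart can be
extended to global functions.\<close>

lemma vector_eqI_dv:
  assumes "\<And>f. smf UNIV f \<Longrightarrow> dv X f x = dv Y f x"
  shows "X x = Y x"
proof -
  define c where "c = chart_at A x"
  have c: "c \<in> A" "x \<in> fst c" by (simp_all add: c_def)
  have "X x $ i = Y x $ i" for i
  proof -
    obtain h N where h: "smf UNIV h" "open N" "x \<in> N" "\<And>z. z \<in> N \<Longrightarrow> h z = snd c z $ i"
      using extend_function[OF chart_open[OF c(1)] c(2) smooth_coordinate[OF c(1)]] by metis
    have "dv Z h x = Z x $ i" for Z
    proof -
      have "dv Z h x = dv Z (\<lambda>z. snd c z $ i) x"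
        by (rule dv_local[OF smooth_coordinate[OF c(1)] c(2) h(2,3)]) (simp add: h)
      also have "differential A (\<lambda>z. snd c z $ i) x = (\<lambda>v. v $ i)"
      proof (rule differential_eqI)
        have "((\<lambda>y. y $ i) has_derivative (\<lambda>v. v $ i)) (at (snd c x))"
          by (rule bounded_linear_imp_has_derivative[OF bounded_linear_vec_nth])
        then show "((\<lambda>z. snd c z $ i) \<circ> chart_inv (chart_at A x) has_derivative (\<lambda>v. v $ i)) (at (snd (chart_at A x) x))"
          unfolding c_def[symmetric]
          by (rule has_derivative_transform_within_open[OF _ chart_image_open[OF c(1)]]) (use c in auto)
      qed
      then have "dv Z (\<lambda>z. snd c z $ i) x = Z x $ i" by (simp add: deriv_along_def)
      finally show ?thesis .
    qed
    then show ?thesis using assms[OF h(1)] by simp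
  qed
  then show ?thesis by (simp add: vec_eq_iff)
qed

end

section \<open>Tensorial maps and their traces\<close>

context manifold begin

text \<open>Coordinate fields and coefficient functions, cut off so as to be defined on all of \<open>M\<close>. The global
identity \<open>\<rho> X = \<Sum>\<^sub>i a\<^sub>i E\<^sub>i\<close> allows operators on global fields to be applied to the
expansion of \<open>X\<close> without any discussion of their locality. The factor \<open>\<rho>\<close> is the
square of a bump function: one factor belongs to \<open>a\<^sub>i\<close> and the other to \<open>E\<^sub>i\<close>.\<close>

lemma local_frame:
  assumes c: "c \<in> A" "x \<in> fst c"
  obtains \<rho> N E a where "smf UNIV (\<rho> :: 'a \<Rightarrow> real)" "open N" "x \<in> N" "N \<subseteq> fst c" "\<And>z. z \<in> N \<Longrightarrow> \<rho> z = 1"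
    "\<And>i. E i \<in> vfields A" "\<And>i z. z \<in> N \<Longrightarrow> E i z = Sc c z (axis i 1)"
    "\<And>X i. X \<in> vfields A \<Longrightarrow> smf UNIV (a X i)"
    "\<And>X i z. X \<in> vfields A \<Longrightarrow> z \<in> N \<Longrightarrow> a X i z = Tc c z (X z) $ i"
    "\<And>X z. X \<in> vfields A \<Longrightarrow> \<rho> z *\<^sub>R X z = (\<Sum>i\<in>UNIV. a X i z *\<^sub>R E i z)"
proof -
  note op = chart_open[OF c(1)]
  obtain \<rho> N W where *: "smf UNIV \<rho>" "open N" "x \<in> N" "N \<subseteq> fst c" "\<And>z. z \<in> N \<Longrightarrow> \<rho> z = (1::real)"
    "open W" "W \<union> fst c = UNIV" "\<And>z. z \<in> W \<Longrightarrow> \<rho> z = 0"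
    using exists_bump_chart[OF op c(2)] by blast
  define E where "E i z = \<rho> z *\<^sub>R Sc c z (axis i 1)" for i z
  define a where "a X i z = \<rho> z * (Tc c z (X z) $ i)" for X :: "'a \<Rightarrow> real^'n" and i z
  have \<rho>c: "smf (fst c) \<rho>" using *(1) by (rule smooth_fun_on_mono) auto
  have E: "E i \<in> vfields A" for i
  proof -
    have s1: "vf_on (fst c) (E i)" unfolding E_def
      by (rule vf_on_scaleR[OF op \<rho>c vf_on_coordinate[OF c(1)]])
    have s2: "vf_on W (E i)" by (rule vf_on_cong[OF vf_on_zero *(6)]) (use *(8) in \<open>auto simp: E_def\<close>)
    have "vf_on UNIV (E i)" by (rule vf_on_local) (metis s1 s2 op *(6,7) UnE UNIV_I)
    then show ?thesis by (simp add: vfields_iff)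
  qed
  have a: "smf UNIV (a X i)" if X: "X \<in> vfields A" for X i
  proof -
    have "smf (fst c) (\<lambda>z. Tc c z (X z) $ i)"
    proof (rule smooth_fun_on_chart[OF c(1) op order_refl])
      have "smooth_on (snd c ` fst c) (components A c X)" using X c(1) by (simp add: vfields_def)
      from smooth_on_nth[OF chart_image_open[OF c(1)] this]
      show "smooth_on (snd c ` fst c) ((\<lambda>z. Tc c z (X z) $ i) \<circ> chart_inv c)"
        by (simp add: components_def o_def)
    qed
    then have s1: "smf (fst c) (a X i)" unfolding a_def by (rule smooth_fun_on_mult[OF op \<rho>c])
    have s2: "smf W (a X i)" by (rule smooth_fun_on_cong[OF smooth_fun_on_const[of _ 0] *(6)]) (use *(8) in \<open>auto simp: a_def\<close>)
    show ?thesis by (rule smooth_fun_on_local) (metis s1 s2 op *(6,7) UnE UNIV_I)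
  qed
  have exp: "(\<rho> z * \<rho> z) *\<^sub>R X z = (\<Sum>i\<in>UNIV. a X i z *\<^sub>R E i z)" for X z
  proof (cases "z \<in> fst c")
    case True
    have "Sc c z (Tc c z (X z)) = (\<Sum>b\<in>Basis. (Tc c z (X z) \<bullet> b) *\<^sub>R Sc c z b)"
      by (rule linear_euclidean_expansion[OF Sc_linear[OF c(1) True]])
    also have "\<dots> = (\<Sum>i\<in>UNIV. (Tc c z (X z) $ i) *\<^sub>R Sc c z (axis i 1))"
      by (simp add: Basis_vec_def axis_eq_axis inner_axis sum.UNION_disjoint)
    finally have "X z = (\<Sum>i\<in>UNIV. (Tc c z (X z) $ i) *\<^sub>R Sc c z (axis i 1))"
      using c(1) True by simp
    then have "(\<rho> z * \<rho> z) *\<^sub>R X z = (\<rho> z * \<rho> z) *\<^sub>R (\<Sum>i\<in>UNIV. (Tc c z (X z) $ i) *\<^sub>R Sc c z (axis i 1))"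
      by (rule arg_cong)
    then show ?thesis by (simp add: a_def E_def scaleR_sum_right mult_ac)
  next
    case False
    then have "\<rho> z = 0" using * by blast
    then show ?thesis by (simp add: E_def)
  qed
  show thesis
    by (rule that[of "\<lambda>z. \<rho> z * \<rho> z" N E a])
      (use * E a exp smooth_fun_on_mult[OF open_UNIV *(1,1)] in \<open>auto simp: E_def a_def\<close>)
qed

text \<open>A map that is linear over the smooth functions sees only the value of a field at the point: near \<open>x\<close>
the field is a combination of frame fields whose coefficients vanish at \<open>x\<close>.\<close>

lemma tensorial_zero:
  fixes \<Phi> :: "('a \<Rightarrow> real^'n) \<Rightarrow> 'y::real_vector"
  assumes add: "\<And>X Y. X \<in> vfields A \<Longrightarrow> Y \<in> vfields A \<Longrightarrow> \<Phi> (\<lambda>z. X z + Y z) = \<Phi> X + \<Phi> Y"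
    and scale: "\<And>f X. smf UNIV f \<Longrightarrow> X \<in> vfields A \<Longrightarrow> \<Phi> (\<lambda>z. f z *\<^sub>R X z) = f x *\<^sub>R \<Phi> X"
    and X: "X \<in> vfields A" "X x = 0"
  shows "\<Phi> X = 0"
proof -
  obtain \<rho> N E a where fr: "smf UNIV (\<rho> :: 'a \<Rightarrow> real)" "x \<in> N" "N \<subseteq> fst (chart_at A x)" "\<And>z. z \<in> N \<Longrightarrow> \<rho> z = 1"
    "\<And>i. E i \<in> vfields A"
    "\<And>X i. X \<in> vfields A \<Longrightarrow> smf UNIV (a X i)"
    "\<And>X i z. X \<in> vfields A \<Longrightarrow> z \<in> N \<Longrightarrow> a X i z = Tc (chart_at A x) z (X z) $ i"
    "\<And>X z. X \<in> vfields A \<Longrightarrow> \<rho> z *\<^sub>R X z = (\<Sum>i\<in>UNIV. a X i z *\<^sub>R E i z)"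
    by (rule local_frame[OF chart_at_in chart_at_dom, of x]) blast
  have zero: "\<Phi> (\<lambda>z. 0) = 0" using scale[of "\<lambda>z. 0" "\<lambda>z. 0"] by simp
  have "\<Phi> X = \<rho> x *\<^sub>R \<Phi> X" using fr(2,4) by simp
  also have "\<dots> = \<Phi> (\<lambda>z. \<Sum>i\<in>UNIV. a X i z *\<^sub>R E i z)" using scale[OF fr(1) X(1)] fr(8)[OF X(1)] by simp
  also have "\<dots> = (\<Sum>i\<in>UNIV. \<Phi> (\<lambda>z. a X i z *\<^sub>R E i z))"
  proof -
    have "\<Phi> (\<lambda>z. \<Sum>i\<in>I. a X i z *\<^sub>R E i z) = (\<Sum>i\<in>I. \<Phi> (\<lambda>z. a X i z *\<^sub>R E i z))" if "finite I" for I
      using that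
    proof (induction I rule: finite_induct)
      case (insert j I)
      then show ?case
        using add[of "\<lambda>z. a X j z *\<^sub>R E j z" "\<lambda>z. \<Sum>i\<in>I. a X i z *\<^sub>R E i z"] fr(5) fr(6)[OF X(1)] by simp
    qed (simp add: zero)
    then show ?thesis by simp
  qed
  also have "\<dots> = (\<Sum>i\<in>UNIV. a X i x *\<^sub>R \<Phi> (E i))" using scale fr(5) fr(6)[OF X(1)] by simp
  also have "\<dots> = 0" using fr(7)[OF X(1) fr(2)] X(2) by (simp add: Tc_chart_at)
  finally show ?thesis .
qed

definition tensorial :: "(('a \<Rightarrow> real^'n) \<Rightarrow> 'a \<Rightarrow> real^'n) \<Rightarrow> bool" where
  "tensorial \<Phi> \<longleftrightarrow> (\<forall>X\<in>vfields A. \<Phi> X \<in> vfields A) \<and>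
     (\<forall>X\<in>vfields A. \<forall>Y\<in>vfields A. \<Phi> (\<lambda>x. X x + Y x) = (\<lambda>x. \<Phi> X x + \<Phi> Y x)) \<and>
     (\<forall>f X. smf UNIV f \<longrightarrow> X \<in> vfields A \<longrightarrow> \<Phi> (\<lambda>x. f x *\<^sub>R X x) = (\<lambda>x. f x *\<^sub>R \<Phi> X x))"

lemma tensorialI:
  assumes "\<And>X. X \<in> vfields A \<Longrightarrow> \<Phi> X \<in> vfields A"
    "\<And>X Y. X \<in> vfields A \<Longrightarrow> Y \<in> vfields A \<Longrightarrow> \<Phi> (\<lambda>x. X x + Y x) = (\<lambda>x. \<Phi> X x + \<Phi> Y x)"
    "\<And>f X. smf UNIV f \<Longrightarrow> X \<in> vfields A \<Longrightarrow> \<Phi> (\<lambda>x. f x *\<^sub>R X x) = (\<lambda>x. f x *\<^sub>R \<Phi> X x)"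
  shows "tensorial \<Phi>"
  using assms by (auto simp: tensorial_def)

lemma tensorialD:
  assumes "tensorial \<Phi>"
  shows "X \<in> vfields A \<Longrightarrow> \<Phi> X \<in> vfields A"
    "X \<in> vfields A \<Longrightarrow> Y \<in> vfields A \<Longrightarrow> \<Phi> (\<lambda>x. X x + Y x) = (\<lambda>x. \<Phi> X x + \<Phi> Y x)"
    "smf UNIV f \<Longrightarrow> X \<in> vfields A \<Longrightarrow> \<Phi> (\<lambda>x. f x *\<^sub>R X x) = (\<lambda>x. f x *\<^sub>R \<Phi> X x)"
  using assms by (auto simp: tensorial_def)

lemma tensorial_eq:
  assumes "tensorial \<Phi>" "X \<in> vfields A" "Y \<in> vfields A" "X x = Y x"
  shows "\<Phi> X x = \<Phi> Y x"
proof -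
  note T = tensorialD[OF assms(1)]
  have "\<Phi> (\<lambda>z. X z + (-1) *\<^sub>R Y z) x = 0"
    by (rule tensorial_zero[where \<Phi> = "\<lambda>X. \<Phi> X x" and x = x]) (use assms T in \<open>auto simp: fun_eq_iff\<close>)
  moreover have "\<Phi> (\<lambda>z. X z + (-1) *\<^sub>R Y z) x = \<Phi> X x + (-1) *\<^sub>R \<Phi> Y x"
    using T(2)[OF assms(2) vfields_cmul[OF assms(3)], of "-1"] T(3)[of "\<lambda>_. -1" Y] assms(3) by (simp add: fun_eq_iff)
  ultimately show ?thesis by simp
qed

definition some_field where "some_field x v = (SOME X. X \<in> vfields A \<and> X x = v)"

lemma some_field [simp]: "some_field x v \<in> vfields A" "some_field x v x = v"
proof -
  have "\<exists>X. X \<in> vfields A \<and> X x = v" using extend_vector[of x v] by blast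
  from someI_ex[OF this] show "some_field x v \<in> vfields A" "some_field x v x = v" by (auto simp: some_field_def)
qed

text \<open>The linear map on the tangent space at \<open>x\<close> induced by a tensorial map.\<close>

definition at_pt where "at_pt \<Phi> x v = \<Phi> (some_field x v) x"

lemma at_pt: "tensorial \<Phi> \<Longrightarrow> X \<in> vfields A \<Longrightarrow> at_pt \<Phi> x (X x) = \<Phi> X x"
  unfolding at_pt_def by (rule tensorial_eq) auto

lemma at_pt_linear:
  assumes "tensorial \<Phi>"
  shows "linear (at_pt \<Phi> x)"
proof (rule linearI)
  show "at_pt \<Phi> x (v + w) = at_pt \<Phi> x v + at_pt \<Phi> x w" for v w
    using at_pt[OF assms, of "\<lambda>z. some_field x v z + some_field x w z" x] tensorialD(2)[OF assms, of "some_field x v" "some_field x w"]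
    by (simp add: at_pt_def)
  show "at_pt \<Phi> x (r *\<^sub>R v) = r *\<^sub>R at_pt \<Phi> x v" for r v
    using at_pt[OF assms, of "\<lambda>z. r *\<^sub>R some_field x v z" x] tensorialD(3)[OF assms, of "\<lambda>_. r" "some_field x v"]
    by (simp add: at_pt_def)
qed

definition tr where "tr \<Phi> x = trace (matrix (at_pt \<Phi> x))"

text \<open>The trace can be computed with the coordinate frame of any chart around the point, since the two matrices
are conjugate. This makes the trace a smooth function.\<close>

lemma tr_chart:
  assumes "tensorial \<Phi>" "c \<in> A" "x \<in> fst c" "\<And>i. E i \<in> vfields A" "\<And>i. E i x = Sc c x (axis i 1)"
  shows "tr \<Phi> x = (\<Sum>i\<in>UNIV. Tc c x (\<Phi> (E i) x) $ i)"
proof -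
  note lin = at_pt_linear[OF assms(1), of x] Tc_linear[OF assms(2,3)] Sc_linear[OF assms(2,3)]
  have "(\<Sum>i\<in>UNIV. Tc c x (\<Phi> (E i) x) $ i) = trace (matrix (Tc c x \<circ> (at_pt \<Phi> x \<circ> Sc c x)))"
    using at_pt[OF assms(1,4), of x] by (simp add: trace_def matrix_def assms(5))
  also have "matrix (Tc c x \<circ> (at_pt \<Phi> x \<circ> Sc c x)) = matrix (Tc c x) ** (matrix (at_pt \<Phi> x) ** matrix (Sc c x))"
    using lin by (simp add: matrix_compose linear_compose)
  also have "trace \<dots> = trace (matrix (at_pt \<Phi> x) ** (matrix (Sc c x) ** matrix (Tc c x)))"
    by (subst trace_mul_sym) (simp add: matrix_mul_assoc)
  also have "matrix (Sc c x) ** matrix (Tc c x) = matrix (Sc c x \<circ> Tc c x)"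
    using lin by (simp add: matrix_compose)
  also have "Sc c x \<circ> Tc c x = id" using assms(2,3) by auto
  finally show ?thesis unfolding tr_def matrix_id_mat_1 matrix_mul_rid by (rule sym)
qed

definition derivation :: "('a \<Rightarrow> real^'n) \<Rightarrow> (('a \<Rightarrow> real^'n) \<Rightarrow> 'a \<Rightarrow> real^'n) \<Rightarrow> bool" where
  "derivation Z \<delta> \<longleftrightarrow> (\<forall>X\<in>vfields A. \<delta> X \<in> vfields A) \<and>
     (\<forall>X\<in>vfields A. \<forall>Y\<in>vfields A. \<delta> (\<lambda>x. X x + Y x) = (\<lambda>x. \<delta> X x + \<delta> Y x)) \<and>
     (\<forall>f X. smf UNIV f \<longrightarrow> X \<in> vfields A \<longrightarrow> \<delta> (\<lambda>x. f x *\<^sub>R X x) = (\<lambda>x. dv Z f x *\<^sub>R X x + f x *\<^sub>R \<delta> X x))"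

lemma derivationD:
  assumes "derivation Z \<delta>"
  shows "X \<in> vfields A \<Longrightarrow> \<delta> X \<in> vfields A"
    "X \<in> vfields A \<Longrightarrow> Y \<in> vfields A \<Longrightarrow> \<delta> (\<lambda>x. X x + Y x) = (\<lambda>x. \<delta> X x + \<delta> Y x)"
    "smf UNIV f \<Longrightarrow> X \<in> vfields A \<Longrightarrow> \<delta> (\<lambda>x. f x *\<^sub>R X x) = (\<lambda>x. dv Z f x *\<^sub>R X x + f x *\<^sub>R \<delta> X x)"
  using assms by (auto simp: derivation_def)

lemma derivation_sum:
  assumes "derivation Z \<delta>" "finite I" "\<And>i. i \<in> I \<Longrightarrow> X i \<in> vfields A"
  shows "\<delta> (\<lambda>x. \<Sum>i\<in>I. X i x) = (\<lambda>x. \<Sum>i\<in>I. \<delta> (X i) x)"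
  using assms(2,3)
proof (induction I rule: finite_induct)
  case empty
  then show ?case using derivationD(3)[OF assms(1), of "\<lambda>_. 0" "\<lambda>_. 0"] by simp
next
  case (insert j I)
  then show ?case using derivationD(2)[OF assms(1), of "X j" "\<lambda>x. \<Sum>i\<in>I. X i x"] by simp
qed

lemma tensorial_commutator:
  assumes d: "derivation Z \<delta>" and t: "tensorial \<Phi>" and Z: "Z \<in> vfields A"
  shows "tensorial (\<lambda>X x. \<delta> (\<Phi> X) x - \<Phi> (\<delta> X) x)"
proof (rule tensorialI)
  note D = derivationD[OF d] and T = tensorialD[OF t]
  fix X Y assume X: "X \<in> vfields A" 
  show "(\<lambda>x. \<delta> (\<Phi> X) x - \<Phi> (\<delta> X) x) \<in> vfields A" using X D T by simp
  { assume Y: "Y \<in> vfields A"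
    show "(\<lambda>x. \<delta> (\<Phi> (\<lambda>x. X x + Y x)) x - \<Phi> (\<delta> (\<lambda>x. X x + Y x)) x) =
      (\<lambda>x. \<delta> (\<Phi> X) x - \<Phi> (\<delta> X) x + (\<delta> (\<Phi> Y) x - \<Phi> (\<delta> Y) x))"
      using X Y by (simp add: D T fun_eq_iff) }
  fix f :: "'a \<Rightarrow> real" assume f: "smf UNIV f"
  have Zf: "smf UNIV (dv Z f)" by (rule smooth_deriv_along[OF open_UNIV f vfields_vf_on[OF Z]])
  show "(\<lambda>x. \<delta> (\<Phi> (\<lambda>x. f x *\<^sub>R X x)) x - \<Phi> (\<delta> (\<lambda>x. f x *\<^sub>R X x)) x) = (\<lambda>x. f x *\<^sub>R (\<delta> (\<Phi> X) x - \<Phi> (\<delta> X) x))"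
    using X f Zf by (simp add: D T fun_eq_iff algebra_simps)
qed

text \<open>The rule \<open>Z (tr \<Phi>) = tr [\<delta>, \<Phi>]\<close> for each derivation \<open>\<delta>\<close> over \<open>Z\<close>. In a coordinate frame the
contributions of \<open>\<delta> E\<^sub>i\<close> to the two terms of the commutator have the same trace, and only
the derivatives of the diagonal coefficients remain. The freedom to choose \<open>\<delta>\<close> is used later
with a derivation that respects the splitting of the tangent bundle.\<close>

lemma trace_smooth_and_derivative:
  assumes d: "derivation Z \<delta>" and t: "tensorial \<Phi>" and Z: "Z \<in> vfields A"
  shows "smf UNIV (tr \<Phi>)" "dv Z (tr \<Phi>) x = tr (\<lambda>X x. \<delta> (\<Phi> X) x - \<Phi> (\<delta> X) x) x"
proof -
  note D = derivationD[OF d] and T = tensorialD[OF t]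
  have main: "(\<exists>N. open N \<and> x \<in> N \<and> smf N (tr \<Phi>)) \<and> dv Z (tr \<Phi>) x = tr (\<lambda>X x. \<delta> (\<Phi> X) x - \<Phi> (\<delta> X) x) x" for x
  proof -
    define c where "c = chart_at A x"
    have c: "c \<in> A" "x \<in> fst c" by (simp_all add: c_def)
    obtain \<rho> N E a where fr: "smf UNIV (\<rho> :: 'a \<Rightarrow> real)" "open N" "x \<in> N" "N \<subseteq> fst c" "\<And>z. z \<in> N \<Longrightarrow> \<rho> z = 1"
      and E: "\<And>i. E i \<in> vfields A" "\<And>i z. z \<in> N \<Longrightarrow> E i z = Sc c z (axis i 1)"
      and a: "\<And>X i. X \<in> vfields A \<Longrightarrow> smf UNIV (a X i)"
        "\<And>X i z. X \<in> vfields A \<Longrightarrow> z \<in> N \<Longrightarrow> a X i z = Tc c z (X z) $ i"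
        "\<And>X z. X \<in> vfields A \<Longrightarrow> \<rho> z *\<^sub>R X z = (\<Sum>i\<in>UNIV. a X i z *\<^sub>R E i z)"
      by (rule local_frame[OF c]) blast
    define V where "V i = \<Phi> (E i)" for i
    have V: "V i \<in> vfields A" for i by (simp add: V_def T E)
    have trN: "tr \<Phi> z = (\<Sum>i\<in>UNIV. a (V i) i z)" if "z \<in> N" for z
      using tr_chart[OF t c(1) _ E(1) E(2), of z] that fr(4) a(2)[OF V that] by (auto simp: V_def)
    have sm: "smf UNIV (\<lambda>z. \<Sum>i\<in>UNIV. a (V i) i z)" by (rule smooth_fun_on_sum[OF open_UNIV a(1)[OF V]])
    have smN: "smf N (tr \<Phi>)"
      by (rule smooth_fun_on_cong[OF smooth_fun_on_mono[OF sm] fr(2)]) (use trN in auto)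
    have expx: "X x = (\<Sum>k\<in>UNIV. a X k x *\<^sub>R E k x)" if "X \<in> vfields A" for X
      using a(3)[OF that, of x] fr(5)[OF fr(3)] by simp
    have axk: "Tc c x (E k x) $ i = (if i = k then 1 else 0)" for i k
      using E(2)[OF fr(3)] c by (simp add: axis_def)
    have Zrho: "dv Z \<rho> x = 0" using dv_local[OF smooth_fun_on_const[of UNIV 1] UNIV_I fr(2,3), of \<rho>] fr(5) by simp
    have Tlin: "linear (\<lambda>v. Tc c x v $ i)" for i
      using Tc_linear[OF c] by (auto simp: linear_iff)
    have dV: "Tc c x (\<delta> (V i) x) $ i = dv Z (a (V i) i) x + (\<Sum>k\<in>UNIV. a (V i) k x * (Tc c x (\<delta> (E k) x) $ i))" for i
    proof -
      have "\<delta> (V i) x = \<delta> (\<lambda>z. \<rho> z *\<^sub>R V i z) x" using D(3)[OF fr(1) V] Zrho fr(5)[OF fr(3)] by simp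
      also have "\<dots> = \<delta> (\<lambda>z. \<Sum>k\<in>UNIV. a (V i) k z *\<^sub>R E k z) x" by (simp add: a(3)[OF V])
      also have "\<dots> = (\<Sum>k\<in>UNIV. \<delta> (\<lambda>z. a (V i) k z *\<^sub>R E k z) x)"
        using derivation_sum[OF d, of UNIV "\<lambda>k z. a (V i) k z *\<^sub>R E k z"] a(1)[OF V] E(1) by simp
      also have "\<dots> = (\<Sum>k\<in>UNIV. dv Z (a (V i) k) x *\<^sub>R E k x + a (V i) k x *\<^sub>R \<delta> (E k) x)"
        by (simp add: D(3)[OF a(1)[OF V] E(1)])
      finally have "Tc c x (\<delta> (V i) x) $ i =
          (\<Sum>k\<in>UNIV. dv Z (a (V i) k) x * (Tc c x (E k x) $ i) + a (V i) k x * (Tc c x (\<delta> (E k) x) $ i))"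
        by (simp add: linear_sum[OF Tlin] linear_add[OF Tlin] linear_scale[OF Tlin])
      then show ?thesis by (simp add: axk sum.distrib if_distrib[of "\<lambda>t. _ * t"] cong: if_cong)
    qed
    have PhidE: "Tc c x (\<Phi> (\<delta> (E i)) x) $ i = (\<Sum>k\<in>UNIV. (Tc c x (\<delta> (E i) x) $ k) * a (V k) i x)" for i
    proof -
      have "at_pt \<Phi> x (\<delta> (E i) x) = (\<Sum>k\<in>UNIV. a (\<delta> (E i)) k x *\<^sub>R at_pt \<Phi> x (E k x))"
        using arg_cong[OF expx[OF D(1)[OF E(1)], of i], of "at_pt \<Phi> x"]
        by (simp add: linear_sum[OF at_pt_linear[OF t]] linear_scale[OF at_pt_linear[OF t]])
      then have "\<Phi> (\<delta> (E i)) x = (\<Sum>k\<in>UNIV. a (\<delta> (E i)) k x *\<^sub>R V k x)"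
        using at_pt[OF t] D(1) E(1) by (simp add: V_def)
      then have "Tc c x (\<Phi> (\<delta> (E i)) x) $ i = (\<Sum>k\<in>UNIV. a (\<delta> (E i)) k x * (Tc c x (V k x) $ i))"
        by (simp add: linear_sum[OF Tlin] linear_scale[OF Tlin])
      then show ?thesis using a(2)[OF D(1)[OF E(1)] fr(3)] a(2)[OF V fr(3)] by simp
    qed
    have "dv Z (tr \<Phi>) x = dv Z (\<lambda>z. \<Sum>i\<in>UNIV. a (V i) i z) x"
      by (rule dv_local[OF sm UNIV_I fr(2,3)]) (simp add: trN)
    also have "\<dots> = (\<Sum>i\<in>UNIV. dv Z (a (V i) i) x)" by (rule dv_sum[OF open_UNIV UNIV_I a(1)[OF V]])
    also have "\<dots> = (\<Sum>i\<in>UNIV. Tc c x (\<delta> (\<Phi> (E i)) x) $ i - Tc c x (\<Phi> (\<delta> (E i)) x) $ i)"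
    proof -
      have "(\<Sum>i\<in>UNIV. \<Sum>k\<in>UNIV. a (V i) k x * (Tc c x (\<delta> (E k) x) $ i)) =
          (\<Sum>i\<in>UNIV. \<Sum>k\<in>UNIV. (Tc c x (\<delta> (E i) x) $ k) * a (V k) i x)"
        by (subst sum.swap) (simp add: mult.commute)
      then show ?thesis using dV by (simp add: sum_subtractf PhidE sum.distrib flip: V_def)
    qed
    also have "\<dots> = tr (\<lambda>X x. \<delta> (\<Phi> X) x - \<Phi> (\<delta> X) x) x"
      using tr_chart[OF tensorial_commutator[OF d t Z] c E(1) E(2)[OF fr(3)]]
      by (simp add: linear_diff[OF Tc_linear[OF c]])
    finally show ?thesis using smN fr(2,3) by blast
  qed
  show "smf UNIV (tr \<Phi>)" by (rule smooth_fun_on_local) (use main in blast)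
  show "dv Z (tr \<Phi>) x = tr (\<lambda>X x. \<delta> (\<Phi> X) x - \<Phi> (\<delta> X) x) x" using main by blast
qed

end

section \<open>The projection to the normal bundle\<close>

lemma smooth_on_matrix_mult:
  fixes M :: "'x::euclidean_space \<Rightarrow> real^'k^'m" and N :: "'x \<Rightarrow> real^'l^'k"
  assumes "open S" "\<And>i j. smooth_on S (\<lambda>x. M x $ i $ j)" "\<And>i j. smooth_on S (\<lambda>x. N x $ i $ j)"
  shows "smooth_on S (\<lambda>x. (M x ** N x) $ i $ j)"
  unfolding matrix_matrix_mult_def
  by (simp, rule smooth_on_sum[OF assms(1) smooth_on_mult[OF assms(1) assms(2,3)]])

lemma smooth_on_matrix_vector_mult:
  fixes M :: "'x::euclidean_space \<Rightarrow> real^'k^'m" and w :: "'x \<Rightarrow> real^'k"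
  assumes "open S" "\<And>i j. smooth_on S (\<lambda>x. M x $ i $ j)" "smooth_on S w"
  shows "smooth_on S (\<lambda>x. M x *v w x)"
  unfolding matrix_vector_mult_def
  by (rule smooth_on_vec_lambda[OF assms(1)])
    (rule smooth_on_sum[OF assms(1) smooth_on_mult[OF assms(1) assms(2) smooth_on_nth[OF assms(1,3)]]])

text \<open>The matrix \<open>G\<^sup>-\<^sup>1 M\<^sup>T (M G\<^sup>-\<^sup>1 M\<^sup>T)\<^sup>-\<^sup>1 M\<close> of the orthogonal projection, with respect to the inner product
\<open>G\<close>, along the kernel of \<open>M\<close>.\<close>

definition projection_matrix :: "real^'n^'n \<Rightarrow> real^'n^'q \<Rightarrow> real^'n^'n" where
  "projection_matrix G M =
     (matrix_inv G ** (transpose M ** matrix_inv (M ** (matrix_inv G ** transpose M)))) ** M"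

lemma invertible_if_positive:
  fixes G :: "real^'n^'n"
  assumes "\<forall>v. v \<noteq> 0 \<longrightarrow> v \<bullet> (G *v v) > 0"
  shows "invertible G"
proof -
  have "\<forall>v. G *v v = 0 \<longrightarrow> v = 0" using assms by (metis inner_zero_right less_irrefl)
  then show ?thesis using invertible_left_inverse matrix_left_invertible_ker by blast
qed

text \<open>The matrix \<open>M G\<^sup>-\<^sup>1 M\<^sup>T\<close> is positive definite because \<open>M\<^sup>T\<close> is injective. The formula for the
projection has the form \<open>B M\<close> with \<open>M B = 1\<close>, so its trace is that of the identity of size \<open>q\<close>.\<close>

lemma projection_matrix:
  fixes G :: "real^'n^'n" and M :: "real^'n^'q"
  assumes pos: "\<forall>v. v \<noteq> 0 \<longrightarrow> v \<bullet> (G *v v) > 0" and surj: "surj ((*v) M)"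
  shows "invertible (M ** (matrix_inv G ** transpose M))"
    and "M *v (projection_matrix G M *v v) = M *v v"
    and "M *v u = 0 \<Longrightarrow> u \<bullet> (G *v (projection_matrix G M *v v)) = 0"
    and "trace (projection_matrix G M) = real CARD('q)"
proof -
  define H where "H = M ** (matrix_inv G ** transpose M)"
  note G = matrix_inv_inverse[OF invertible_if_positive[OF pos]]
  have GG: "G *v (matrix_inv G *v v) = v" for v by (simp add: matrix_vector_mul_assoc G)
  have adj: "(transpose M *v c) \<bullet> w = c \<bullet> (M *v w)" for c w
    by (simp add: dot_lmul_matrix transpose_matrix_vector)
  have "\<forall>c. c \<noteq> 0 \<longrightarrow> c \<bullet> (H *v c) > 0"
  proof (intro allI impI)
    fix c :: "real^'q" assume that: "c \<noteq> 0"
    define w where "w = matrix_inv G *v (transpose M *v c)"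
    have "w \<noteq> 0"
    proof
      assume "w = 0"
      then have "transpose M *v c = 0" using GG[of "transpose M *v c"] by (simp add: w_def)
      moreover obtain u where "M *v u = c" using surj by (metis surjD)
      ultimately have "c \<bullet> c = 0" using adj[of c u] by simp
      then show False using that by simp
    qed
    moreover have "c \<bullet> (H *v c) = w \<bullet> (G *v w)"
      using adj[of c w] GG[of "transpose M *v c"]
      by (simp add: H_def w_def inner_commute flip: matrix_vector_mul_assoc)
    ultimately show "c \<bullet> (H *v c) > 0" using pos by simp
  qed
  then show iH: "invertible (M ** (matrix_inv G ** transpose M))"
    using invertible_if_positive unfolding H_def by blast
  note Hi = matrix_inv_inverse[OF iH, folded H_def]
  have "M ** (matrix_inv G ** (transpose M ** matrix_inv H)) = mat 1"
    using Hi(1) by (simp add: H_def matrix_mul_assoc)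
  note MB = this
  have P: "projection_matrix G M = (matrix_inv G ** (transpose M ** matrix_inv H)) ** M"
    by (simp add: projection_matrix_def H_def)
  show "M *v (projection_matrix G M *v v) = M *v v"
    using MB by (simp add: P matrix_vector_mul_assoc matrix_mul_assoc)
  show "u \<bullet> (G *v (projection_matrix G M *v v)) = 0" if "M *v u = 0"
  proof -
    have "projection_matrix G M *v v = matrix_inv G *v (transpose M *v (matrix_inv H *v (M *v v)))"
      by (simp add: P matrix_vector_mul_assoc matrix_mul_assoc)
    then have "u \<bullet> (G *v (projection_matrix G M *v v)) = (matrix_inv H *v (M *v v)) \<bullet> (M *v u)"
      by (simp only: GG inner_commute[of u] adj)
    then show ?thesis using that by simp
  qed
  show "trace (projection_matrix G M) = real CARD('q)"
    unfolding P by (subst trace_mul_sym) (simp add: MB trace_I)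
qed

locale foliated_manifold = manifold A
  for A :: "('a::{t2_space,second_countable_topology}, 'n::finite) chart set" +
  fixes g :: "('a, 'n) metric" and F :: "('a, 'q::finite) cocycle" and D :: "('a, 'n) connection"
  assumes metric: "riemannian_metric A g" and lc: "levi_civita A g D" and fol: "foliation A F"
begin

abbreviation L where "L \<equiv> leaf_tangent A F"
abbreviation Q where "Q \<equiv> normal_space A g F"

lemma g_sym: "g x v w = g x w v"
  and g_pos: "v \<noteq> 0 \<Longrightarrow> g x v v > 0"
  and g_smooth [simp]: "X \<in> vfields A \<Longrightarrow> Y \<in> vfields A \<Longrightarrow> smf UNIV (\<lambda>x. g x (X x) (Y x))"
  and g_bilinear: "bilinear (g x)"
  using metric by (auto simp: riemannian_metric_def)

lemmas g_simps = bilinear_ladd[OF g_bilinear] bilinear_radd[OF g_bilinear] bilinear_lmul[OF g_bilinear]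
  bilinear_rmul[OF g_bilinear] bilinear_lneg[OF g_bilinear] bilinear_rneg[OF g_bilinear]
  bilinear_lzero[OF g_bilinear] bilinear_rzero[OF g_bilinear] bilinear_lsub[OF g_bilinear]
  bilinear_rsub[OF g_bilinear]

lemma submersion: 
  assumes "(U, f) \<in> F"
  shows "open U" "smf U f" "x \<in> U \<Longrightarrow> surj (differential A f x)"
  using fol assms unfolding foliation_def by blast+

lemma submersion_at: obtains U f where "(U, f) \<in> F" "x \<in> U"
proof -
  have "x \<in> (\<Union>(U, f)\<in>F. U)" using fol unfolding foliation_def by blast
  then show thesis using that by blast
qed

text \<open>Two submersions of the cocycle differ by a smooth map near the point, so the kernel of the first
differential lies in that of the second. By symmetry the kernels agree and the leaf tangent space is the
kernel of any one differential (\<open>leaf_tangent_eq\<close>).\<close>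

lemma submersion_change:
  assumes "(U, f) \<in> F" "(W, h) \<in> F" "x \<in> U" "x \<in> W" "differential A f x v = 0"
  shows "differential A h x v = 0"
proof -
  have "\<exists>N \<gamma>. open N \<and> x \<in> N \<and> N \<subseteq> U \<inter> W \<and> open (f ` N) \<and> smooth_on (f ` N) \<gamma> \<and> (\<forall>y\<in>N. h y = \<gamma> (f y))"
    using fol assms(1-4) unfolding foliation_def by blast
  then obtain N \<gamma> where N: "open N" "x \<in> N" "smooth_on (f ` N) \<gamma>" "\<And>y. y \<in> N \<Longrightarrow> h y = \<gamma> (f y)" by blast
  define c where "c = chart_at A x"
  have df: "(f \<circ> chart_inv c has_derivative differential A f x) (at (snd c x))"
    unfolding c_def by (rule differential_has_derivative[OF submersion(2)[OF assms(1)] assms(3)])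
  have "(\<gamma> has_derivative frechet_derivative \<gamma> (at (f x))) (at ((f \<circ> chart_inv c) (snd c x)))"
    using smooth_on_has_derivative[OF N(3), of "f x"] N(2) by (simp add: c_def)
  note d = diff_chain_at[OF df this]
  have "(h \<circ> chart_inv c has_derivative frechet_derivative \<gamma> (at (f x)) \<circ> differential A f x) (at (snd c x))"
    by (rule has_derivative_transform_within_open[OF d chart_image_open_subset[OF chart_at_in N(1)]])
      (use N in \<open>auto simp: c_def\<close>)
  then have "differential A h x = frechet_derivative \<gamma> (at (f x)) \<circ> differential A f x"
    unfolding c_def by (rule differential_eqI)
  moreover have "linear (frechet_derivative \<gamma> (at (f x)))"
    using smooth_on_linear_frechet[OF N(3)] N(2) by blast
  ultimately show ?thesis using assms(5) by (simp add: linear_0)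
qed

lemma leaf_tangent_eq: "(U, f) \<in> F \<Longrightarrow> x \<in> U \<Longrightarrow> L x = {v. differential A f x v = 0}"
  unfolding leaf_tangent_def using submersion_change[of U f _ _ x] by blast

lemma subspace_L: "subspace (L x)"
proof -
  obtain U f where Uf: "(U, f) \<in> F" "x \<in> U" by (rule submersion_at)
  show ?thesis unfolding leaf_tangent_eq[OF Uf]
    using differential_linear[OF submersion(2)[OF Uf(1)] Uf(2)] by (rule linear_subspace_kernel)
qed

lemma subspace_Q: "subspace (Q x)"
  unfolding normal_space_def subspace_def by (simp add: g_simps)

lemma L_Int_Q: "v \<in> L x \<Longrightarrow> v \<in> Q x \<Longrightarrow> v = 0"
  by (rule ccontr, drule g_pos[of v x]) (simp add: normal_space_def)

text \<open>The matrices, in the chart \<open>c\<close>, of the metric and of the differential of a submersion.\<close>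

definition Gm where "Gm c z = (\<chi> i j. g z (Sc c z (axis i 1)) (Sc c z (axis j 1)))"
definition Fm :: "('a, 'n) chart \<Rightarrow> ('a \<Rightarrow> real^'q) \<Rightarrow> 'a \<Rightarrow> real^'n^'q"
  where "Fm c f z = matrix (frechet_derivative (f \<circ> chart_inv c) (at (snd c z)))"

lemma vec_expansion: "(v :: real^'k) = (\<Sum>i\<in>UNIV. (v $ i) *\<^sub>R axis i 1)"
  using basis_expansion[of v] by (simp add: scalar_mult_eq_scaleR)

lemma Gm_form:
  assumes "c \<in> A" "z \<in> fst c"
  shows "v \<bullet> (Gm c z *v w) = g z (Sc c z v) (Sc c z w)"
proof -
  note lin = Sc_linear[OF assms]
  have l: "linear (\<lambda>v. g z v u)" "linear (g z u)" for u using g_bilinear[of z] by (auto simp: bilinear_def)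
  have S: "Sc c z v = (\<Sum>i\<in>UNIV. (v $ i) *\<^sub>R Sc c z (axis i 1))" for v
    using arg_cong[OF vec_expansion[of v], of "Sc c z"] by (simp add: linear_sum[OF lin] linear_scale[OF lin])
  have "g z (Sc c z v) (Sc c z w) = (\<Sum>i\<in>UNIV. v $ i * g z (Sc c z (axis i 1)) (Sc c z w))"
    using arg_cong[OF S[of v], of "\<lambda>u. g z u (Sc c z w)"] by (simp add: linear_sum[OF l(1)] linear_scale[OF l(1)])
  moreover have "g z u (Sc c z w) = (\<Sum>j\<in>UNIV. w $ j * g z u (Sc c z (axis j 1)))" for u
    using arg_cong[OF S[of w], of "g z u"] by (simp add: linear_sum[OF l(2)] linear_scale[OF l(2)])
  ultimately have "g z (Sc c z v) (Sc c z w) = (\<Sum>i\<in>UNIV. v $ i * (\<Sum>j\<in>UNIV. w $ j * g z (Sc c z (axis i 1)) (Sc c z (axis j 1))))"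
    by simp
  then show ?thesis
    by (simp add: Gm_def inner_vec_def matrix_vector_mult_def mult.commute)
qed

lemma Gm_pos:
  assumes "c \<in> A" "z \<in> fst c"
  shows "\<forall>v. v \<noteq> 0 \<longrightarrow> v \<bullet> (Gm c z *v v) > 0"
proof (intro allI impI)
  fix v :: "real^'n" assume "v \<noteq> 0"
  have "Sc c z v \<noteq> 0" using Tc_Sc[OF assms(1,2), of v] linear_0[OF Tc_linear[OF assms(1,2)]] \<open>v \<noteq> 0\<close> by metis
  then show "v \<bullet> (Gm c z *v v) > 0" using g_pos Gm_form[OF assms(1,2)] by simp
qed

lemma Fm_differential:
  assumes "(U, f) \<in> F" "z \<in> U" "c \<in> A" "z \<in> fst c"
  shows "Fm c f z *v (Tc c z v) = differential A f z v"
proof -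
  note d = smooth_differentiable[OF submersion(2)[OF assms(1)] assms(3,4,2)]
  have "linear (frechet_derivative (f \<circ> chart_inv c) (at (snd c z)))"
    using d unfolding frechet_derivative_works by (rule has_derivative_linear)
  then show ?thesis
    unfolding Fm_def by (subst fun_cong[OF matrix_vector_mul(2)]) (simp_all add: differential_in_chart[OF assms(3,4) d])
qed

lemma Fm_surj:
  assumes "(U, f) \<in> F" "z \<in> U" "c \<in> A" "z \<in> fst c"
  shows "surj ((*v) (Fm c f z))"
  unfolding surj_def
proof
  fix y
  obtain v where "y = differential A f z v" using submersion(3)[OF assms(1,2)] unfolding surj_def by blast
  then show "\<exists>w. y = Fm c f z *v w" using Fm_differential[OF assms, of v] by (intro exI[of _ "Tc c z v"]) simp
qed

text \<open>The normal part as a linear map on the tangent space at a single point.\<close>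

definition np where "np x v = (THE w. w \<in> Q x \<and> v - w \<in> L x)"

lemma normal_part_np: "normal_part A g F X x = np x (X x)"
  by (simp add: normal_part_def np_def)

lemma np_unique:
  assumes "w \<in> Q x" "v - w \<in> L x"
  shows "np x v = w"
  unfolding np_def
proof (rule the_equality)
  fix u assume u: "u \<in> Q x \<and> v - u \<in> L x"
  have "u - w = (v - w) - (v - u)" by simp
  then have "u - w \<in> L x" using subspace_diff[OF subspace_L] assms(2) u by metis
  moreover have "u - w \<in> Q x" using subspace_diff[OF subspace_Q] assms(1) u by blast
  ultimately show "u = w" using L_Int_Q by fastforce
qed (use assms in blast)

lemma projection_matrix_splits:
  fixes v :: "real^'n"
  assumes "(U, f) \<in> F" "z \<in> U" "c \<in> A" "z \<in> fst c"
  defines "w \<equiv> Sc c z (projection_matrix (Gm c z) (Fm c f z) *v Tc c z v)"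
  shows "w \<in> Q z" "v - w \<in> L z"
proof -
  note P = projection_matrix[of "Gm c z", OF Gm_pos[OF assms(3,4)] Fm_surj[OF assms(1-4)]]
  show "v - w \<in> L z"
  proof -
    have "differential A f z w = differential A f z v"
      using P(2) assms(3,4) by (simp add: w_def flip: Fm_differential[OF assms(1-4)])
    then show ?thesis
      by (simp add: leaf_tangent_eq[OF assms(1,2)] linear_diff[OF differential_linear[OF submersion(2)[OF assms(1)] assms(2)]])
  qed
  show "w \<in> Q z"
    unfolding normal_space_def
  proof safe
    fix u assume "u \<in> L z"
    then have "Fm c f z *v Tc c z u = 0" using Fm_differential[OF assms(1-4)] by (simp add: leaf_tangent_eq[OF assms(1,2)])
    from P(3)[OF this, of "Tc c z v"] show "g z w u = 0"
      using assms(3,4) by (simp add: Gm_form w_def g_sym[of z _ u])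
  qed
qed

lemma np_in_Q: "np x v \<in> Q x" and np_diff_L: "v - np x v \<in> L x"
proof -
  obtain U f where Uf: "(U, f) \<in> F" "x \<in> U" by (rule submersion_at)
  note w = projection_matrix_splits[OF Uf chart_at_in chart_at_dom, of v]
  show "np x v \<in> Q x" "v - np x v \<in> L x" using w np_unique[OF w] by simp_all
qed

lemma np_chart:
  assumes "(U, f) \<in> F" "z \<in> U" "c \<in> A" "z \<in> fst c"
  shows "np z v = Sc c z (projection_matrix (Gm c z) (Fm c f z) *v Tc c z v)"
  by (rule np_unique[OF projection_matrix_splits[OF assms]])

lemma np_linear: "linear (np x)"
proof (rule linearI)
  fix v w :: "real^'n" and r :: real
  show "np x (v + w) = np x v + np x w"
    using subspace_add[OF subspace_L np_diff_L[of v x] np_diff_L[of w x]]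
    by (intro np_unique subspace_add[OF subspace_Q] np_in_Q) (simp add: algebra_simps)
  show "np x (r *\<^sub>R v) = r *\<^sub>R np x v"
    using subspace_scale[OF subspace_L np_diff_L[of v x], of r]
    by (intro np_unique subspace_scale[OF subspace_Q] np_in_Q) (simp add: algebra_simps)
qed

lemmas np_simps [simp] = linear_add[OF np_linear] linear_scale[OF np_linear] linear_0[OF np_linear]
  linear_neg[OF np_linear] linear_diff[OF np_linear]

lemma np_Q: "v \<in> Q x \<Longrightarrow> np x v = v"
  by (rule np_unique) (auto simp: subspace_0[OF subspace_L])

lemma np_L: "v \<in> L x \<Longrightarrow> np x v = 0"
  by (rule np_unique) (auto simp: subspace_0[OF subspace_Q])

lemma np_np [simp]: "np x (np x v) = np x v"
  by (rule np_Q[OF np_in_Q])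

lemma L_iff: "v \<in> L x \<longleftrightarrow> np x v = 0"
  using np_L np_diff_L[of v x] by auto

lemma Q_iff: "v \<in> Q x \<longleftrightarrow> np x v = v"
  using np_Q np_in_Q[of x v] by auto

lemma g_np: "g x (np x v) w = g x (np x v) (np x w)" "g x w (np x v) = g x (np x w) (np x v)"
proof -
  have "g x (np x v) (w - np x w) = 0" using np_in_Q np_diff_L by (simp add: normal_space_def)
  then show "g x (np x v) w = g x (np x v) (np x w)" by (simp add: g_simps)
  then show "g x w (np x v) = g x (np x w) (np x v)" by (simp add: g_sym[of x w] g_sym[of x "np x w"])
qed

text \<open>This number is the \<open>q\<close> in \<open>Z (tr B) = (q + 1) \<alpha>(Z)\<close>.\<close>

lemma trace_np: "trace (matrix (np x)) = real CARD('q)"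
proof -
  obtain U f where Uf: "(U, f) \<in> F" "x \<in> U" by (rule submersion_at)
  define c where "c = chart_at A x"
  have c: "c \<in> A" "x \<in> fst c" by (simp_all add: c_def)
  have S: "Sc c x v = v" for v using Sc_Tc[OF c, of v] by (simp add: c_def Tc_chart_at)
  have "np x = (\<lambda>v. projection_matrix (Gm c x) (Fm c f x) *v v)"
    by (rule ext, subst np_chart[OF Uf c], subst S) (simp add: c_def Tc_chart_at)
  then have "matrix (np x) = projection_matrix (Gm c x) (Fm c f x)" by simp
  then show ?thesis using projection_matrix(4)[OF Gm_pos[OF c] Fm_surj[OF Uf c]] by simp
qed

text \<open>The differential of a submersion maps the normal space onto \<open>real^'q\<close>, so two vectors cannot span it.\<close>

lemma exists_normal_outside_plane:
  assumes "CARD('q) \<ge> 3"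
  obtains v where "v \<in> Q x" "v \<notin> span {a, b}"
proof (rule ccontr)
  assume "\<not> thesis"
  then have sub: "Q x \<subseteq> span {a, b}" using that by blast
  obtain U f where Uf: "(U, f) \<in> F" "x \<in> U" by (rule submersion_at)
  note lin = differential_linear[OF submersion(2)[OF Uf(1)] Uf(2)]
  have eq: "differential A f x v = differential A f x (np x v)" for v
    using np_diff_L[of v x] by (simp add: leaf_tangent_eq[OF Uf] linear_diff[OF lin])
  have "range (differential A f x) \<subseteq> differential A f x ` Q x"
  proof (rule image_subsetI)
    show "differential A f x v \<in> differential A f x ` Q x" for v
      using imageI[OF np_in_Q[of x v], of "differential A f x"] eq[of v] by simp
  qed
  then have "UNIV \<subseteq> differential A f x ` Q x" using submersion(3)[OF Uf] by simp
  also have "\<dots> \<subseteq> differential A f x ` span {a, b}" using sub by blast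
  also have "\<dots> = span {differential A f x a, differential A f x b}"
    using linear_span_image[OF lin, of "{a, b}"] by simp
  finally have "span {differential A f x a, differential A f x b} = (UNIV :: (real^'q) set)" by blast
  then have "CARD('q) = dim {differential A f x a, differential A f x b}"
    by (metis dim_span dim_UNIV DIM_cart DIM_real mult.right_neutral)
  also have "\<dots> \<le> card {differential A f x a, differential A f x b}" by (rule dim_le_card') simp
  also have "\<dots> \<le> 2" by (simp add: card_insert_if)
  finally show False using assms by simp
qed

text \<open>In a chart the normal part is given by \<open>projection_matrix\<close>, whose entries are smooth since they are
built from the metric, a submersion and inverse matrices.\<close>

lemma normal_part_vfields [simp]:
  assumes X: "X \<in> vfields A"
  shows "normal_part A g F X \<in> vfields A"
  unfolding vfields_iff
proof (rule vf_on_local)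
  fix x :: 'a
  obtain U f where Uf: "(U, f) \<in> F" "x \<in> U" by (rule submersion_at)
  define c where "c = chart_at A x"
  have c: "c \<in> A" "x \<in> fst c" by (simp_all add: c_def)
  note opU = submersion(1)[OF Uf(1)]
  define N where "N = fst c \<inter> U"
  define S where "S = snd c ` (fst c \<inter> U)"
  have N: "open N" "x \<in> N" "N \<subseteq> fst c" "snd c ` N = S" using opU Uf(2) c chart_open[OF c(1)] by (simp_all add: N_def S_def open_Int)
  have S: "open S" unfolding S_def by (rule chart_image_open_subset[OF c(1) opU])
  have inS: "chart_inv c y \<in> fst c" "chart_inv c y \<in> U" "snd c (chart_inv c y) = y" if "y \<in> S" for y
    using that c(1) by (auto simp: S_def)
  have Gs: "smooth_on S (\<lambda>y. Gm c (chart_inv c y) $ i $ j)" for i j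
  proof -
    have "smf (fst c) (\<lambda>z. Gm c z $ i $ j)"
    proof (rule smooth_fun_on_local)
      fix z assume z: "z \<in> fst c"
      obtain \<rho> M E a where fr: "smf UNIV (\<rho> :: 'a \<Rightarrow> real)" "open M" "z \<in> M" "M \<subseteq> fst c" "\<And>z. z \<in> M \<Longrightarrow> \<rho> z = 1"
        and E: "\<And>i. E i \<in> vfields A" "\<And>i z. z \<in> M \<Longrightarrow> E i z = Sc c z (axis i 1)"
        by (rule local_frame[OF c(1) z]) blast
      have "smf M (\<lambda>z. Gm c z $ i $ j)"
        by (rule smooth_fun_on_cong[OF smooth_fun_on_mono[OF g_smooth[OF E(1)[of i] E(1)[of j]]] fr(2)])
          (auto simp: Gm_def E(2))
      then show "\<exists>M. open M \<and> z \<in> M \<and> smf M (\<lambda>z. Gm c z $ i $ j)" using fr by blast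
    qed
    from smooth_fun_on_chartD[OF this c(1)] show ?thesis
      unfolding o_def by (rule smooth_on_subset) (auto simp: S_def)
  qed
  have Fs: "smooth_on S (\<lambda>y. Fm c f (chart_inv c y) $ i $ j)" for i j
  proof (rule smooth_on_cong[OF _ S])
    show "smooth_on S (\<lambda>y. frechet_derivative (f \<circ> chart_inv c) (at y) (axis j 1) $ i)"
      by (rule smooth_on_nth[OF S smooth_on_frechet])
        (use smooth_fun_on_chartD[OF submersion(2)[OF Uf(1)] c(1)] in \<open>simp add: S_def\<close>)
  qed (use inS in \<open>simp add: Fm_def matrix_def\<close>)
  have Fts: "smooth_on S (\<lambda>y. transpose (Fm c f (chart_inv c y)) $ i $ j)" for i j
    using Fs by (simp add: transpose_def)
  have inv: "invertible (Gm c (chart_inv c y))"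
    "invertible (Fm c f (chart_inv c y) ** (matrix_inv (Gm c (chart_inv c y)) ** transpose (Fm c f (chart_inv c y))))"
    if "y \<in> S" for y
    using invertible_if_positive[OF Gm_pos[OF c(1) inS(1)[OF that]]]
      projection_matrix(1)[OF Gm_pos[OF c(1) inS(1)[OF that]] Fm_surj[OF Uf(1) inS(2)[OF that] c(1) inS(1)[OF that]]] by auto
  note Gis = smooth_on_matrix_inv[OF S Gs inv(1)]
  note His = smooth_on_matrix_inv[OF S smooth_on_matrix_mult[OF S Fs smooth_on_matrix_mult[OF S Gis Fts]] inv(2)]
  have Ps: "smooth_on S (\<lambda>y. projection_matrix (Gm c (chart_inv c y)) (Fm c f (chart_inv c y)) $ i $ j)" for i j
    unfolding projection_matrix_def
    by (rule smooth_on_matrix_mult[OF S smooth_on_matrix_mult[OF S Gis smooth_on_matrix_mult[OF S Fts His]] Fs])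
  have "smooth_on S (components A c X)"
    using X c(1) smooth_on_subset[of "snd c ` fst c" "components A c X" S] by (auto simp: vfields_def S_def)
  note sm = smooth_on_matrix_vector_mult[OF S Ps this]
  have "smooth_on S (components A c (normal_part A g F X))"
    by (rule smooth_on_cong[OF sm S])
      (use np_chart[OF Uf(1) inS(2) c(1) inS(1)] inS c(1) in \<open>simp add: components_def normal_part_np\<close>)
  then have "vf_on N (normal_part A g F X)" using vf_on_chart[OF c(1) N(1,3)] N(4) by simp
  then show "\<exists>N. open N \<and> x \<in> N \<and> vf_on N (normal_part A g F X)" using N by blast
qed

end

section \<open>The transversal connection and its curvature\<close>

context foliated_manifold begin

abbreviation VF where "VF \<equiv> vfields A"
abbreviation GL where "GL \<equiv> sections_L A F"
abbreviation GQ where "GQ \<equiv> sections_Q A g F"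
abbreviation npart where "npart \<equiv> normal_part A g F"
abbreviation lpart where "lpart \<equiv> leaf_part A g F"
abbreviation nab where "nab \<equiv> transversal_connection A g F D"

lemma D_affine: "affine_connection A D"
  and torsion_free: "X \<in> VF \<Longrightarrow> Y \<in> VF \<Longrightarrow> br X Y x = D X Y x - D Y X x"
  and metric_connection: "X \<in> VF \<Longrightarrow> Y \<in> VF \<Longrightarrow> Z \<in> VF \<Longrightarrow>
    dv X (\<lambda>x. g x (Y x) (Z x)) x = g x (D X Y x) (Z x) + g x (Y x) (D X Z x)"
  using lc by (auto simp: levi_civita_def)

lemma D_VF [simp]: "X \<in> VF \<Longrightarrow> Y \<in> VF \<Longrightarrow> D X Y \<in> VF"
  and D_add1: "X \<in> VF \<Longrightarrow> X' \<in> VF \<Longrightarrow> Y \<in> VF \<Longrightarrow> D (\<lambda>x. X x + X' x) Y = (\<lambda>x. D X Y x + D X' Y x)"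
  and D_scale1: "smf UNIV f \<Longrightarrow> X \<in> VF \<Longrightarrow> Y \<in> VF \<Longrightarrow> D (\<lambda>x. f x *\<^sub>R X x) Y = (\<lambda>x. f x *\<^sub>R D X Y x)"
  and D_add2: "X \<in> VF \<Longrightarrow> Y \<in> VF \<Longrightarrow> Y' \<in> VF \<Longrightarrow> D X (\<lambda>x. Y x + Y' x) = (\<lambda>x. D X Y x + D X Y' x)"
  and D_scale2: "smf UNIV f \<Longrightarrow> X \<in> VF \<Longrightarrow> Y \<in> VF \<Longrightarrow>
    D X (\<lambda>x. f x *\<^sub>R Y x) = (\<lambda>x. dv X f x *\<^sub>R Y x + f x *\<^sub>R D X Y x)"
  using D_affine unfolding affine_connection_def by blast+

lemma smf_dv [simp]: "smf UNIV f \<Longrightarrow> X \<in> VF \<Longrightarrow> smf UNIV (dv X f)"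
  using smooth_deriv_along[OF open_UNIV] vfields_vf_on by blast

text \<open>All differentiation rules for the Lie bracket except \<open>dv_bracket\<close> follow from those of
the Levi-Civita connection, because \<open>[X,Y] = D\<^sub>X Y - D\<^sub>Y X\<close>.\<close>

lemma br_fun: "X \<in> VF \<Longrightarrow> Y \<in> VF \<Longrightarrow> br X Y = (\<lambda>x. D X Y x - D Y X x)"
  using torsion_free by blast

lemma br_VF [simp]: "X \<in> VF \<Longrightarrow> Y \<in> VF \<Longrightarrow> br X Y \<in> VF"
  by (simp add: br_fun)

lemma br_skew: "X \<in> VF \<Longrightarrow> Y \<in> VF \<Longrightarrow> br X Y = (\<lambda>x. - br Y X x)"
  by (simp add: br_fun)

lemma br_add2: "X \<in> VF \<Longrightarrow> Y \<in> VF \<Longrightarrow> Y' \<in> VF \<Longrightarrow> br X (\<lambda>x. Y x + Y' x) = (\<lambda>x. br X Y x + br X Y' x)"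
  by (simp add: br_fun D_add1 D_add2 algebra_simps)

lemma br_add1: "X \<in> VF \<Longrightarrow> X' \<in> VF \<Longrightarrow> Y \<in> VF \<Longrightarrow> br (\<lambda>x. X x + X' x) Y = (\<lambda>x. br X Y x + br X' Y x)"
  by (simp add: br_fun D_add1 D_add2 algebra_simps)

lemma br_scale2: "smf UNIV f \<Longrightarrow> X \<in> VF \<Longrightarrow> Y \<in> VF \<Longrightarrow>
    br X (\<lambda>x. f x *\<^sub>R Y x) = (\<lambda>x. dv X f x *\<^sub>R Y x + f x *\<^sub>R br X Y x)"
  by (simp add: br_fun D_scale1 D_scale2 algebra_simps)

lemma br_scale1: "smf UNIV f \<Longrightarrow> X \<in> VF \<Longrightarrow> Y \<in> VF \<Longrightarrow>
    br (\<lambda>x. f x *\<^sub>R X x) Y = (\<lambda>x. f x *\<^sub>R br X Y x - dv Y f x *\<^sub>R X x)"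
  by (simp add: br_fun D_scale1 D_scale2 algebra_simps)

lemma jacobi:
  assumes "X \<in> VF" "Y \<in> VF" "Z \<in> VF"
  shows "br X (br Y Z) x + br Y (br Z X) x + br Z (br X Y) x = 0"
proof -
  have "(\<lambda>x. br X (br Y Z) x + br Y (br Z X) x + br Z (br X Y) x) x = (\<lambda>x. 0) x"
  proof (rule vector_eqI_dv)
    fix f :: "'a \<Rightarrow> real" assume f: "smf UNIV f"
    have d: "dv (br U V) h x = dv U (dv V h) x - dv V (dv U h) x" if "U \<in> VF" "V \<in> VF" "smf UNIV h" for U V h x
      using dv_bracket[OF open_UNIV that(3) UNIV_I that(1,2)] .
    have d2: "dv U (dv (br V W) f) x = dv U (dv V (dv W f)) x - dv U (dv W (dv V f)) x"
      if "U \<in> VF" "V \<in> VF" "W \<in> VF" for U V W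
    proof -
      have "dv (br V W) f = (\<lambda>x. dv V (dv W f) x - dv W (dv V f) x)" by (rule ext) (rule d[OF that(2,3) f])
      then show ?thesis using dv_diff[OF open_UNIV _ _ UNIV_I, of "dv V (dv W f)" "dv W (dv V f)"] that f by simp
    qed
    show "dv (\<lambda>x. br X (br Y Z) x + br Y (br Z X) x + br Z (br X Y) x) f x = dv (\<lambda>x. 0) f x"
      unfolding dv_add_field[OF f UNIV_I] dv_zero_field[OF f UNIV_I refl]
      unfolding d[OF assms(1) br_VF[OF assms(2,3)] f] d[OF assms(2) br_VF[OF assms(3,1)] f] d[OF assms(3) br_VF[OF assms(1,2)] f]
        d2[OF assms(1-3)] d2[OF assms(2,3,1)] d2[OF assms(3,1,2)] d[OF assms(1,2) smf_dv[OF f assms(3)]]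
        d[OF assms(2,3) smf_dv[OF f assms(1)]] d[OF assms(3,1) smf_dv[OF f assms(2)]] by simp
  qed
  then show ?thesis by simp
qed

lemma GQ_VF [simp]: "s \<in> GQ \<Longrightarrow> s \<in> VF" and GL_VF [simp]: "X \<in> GL \<Longrightarrow> X \<in> VF"
  by (auto simp: sections_Q_def sections_L_def)

lemma GQ_iff: "s \<in> GQ \<longleftrightarrow> s \<in> VF \<and> (\<forall>x. np x (s x) = s x)"
  unfolding sections_Q_def Q_iff by blast

lemma GL_iff: "s \<in> GL \<longleftrightarrow> s \<in> VF \<and> (\<forall>x. np x (s x) = 0)"
  unfolding sections_L_def L_iff by blast

lemma np_GQ: "s \<in> GQ \<Longrightarrow> np x (s x) = s x" and np_GL: "X \<in> GL \<Longrightarrow> np x (X x) = 0"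
  unfolding GQ_iff GL_iff by blast+

lemma npart_fun: "npart X = (\<lambda>x. np x (X x))"
  using normal_part_np by blast

lemma lpart_fun: "lpart X = (\<lambda>x. X x - np x (X x))"
  by (simp add: leaf_part_def[abs_def] npart_fun)

lemma npart_GQ [simp]: "X \<in> VF \<Longrightarrow> npart X \<in> GQ"
  unfolding GQ_iff by (simp add: normal_part_np)

lemma lpart_GL [simp]: "X \<in> VF \<Longrightarrow> lpart X \<in> GL"
  unfolding GL_iff lpart_fun using vfields_diff[OF _ normal_part_vfields, of X X] by (simp add: npart_fun)

lemma npart_of_GQ: "s \<in> GQ \<Longrightarrow> npart s = s" and npart_of_GL: "X \<in> GL \<Longrightarrow> npart X = (\<lambda>x. 0)"
  by (auto simp: npart_fun np_GQ np_GL)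

lemma split_field: "X = (\<lambda>x. lpart X x + npart X x)"
  by (simp add: lpart_fun npart_fun)

lemma GQ_closed [simp]: "(\<lambda>x. 0) \<in> GQ" "s \<in> GQ \<Longrightarrow> t \<in> GQ \<Longrightarrow> (\<lambda>x. s x + t x) \<in> GQ"
  "s \<in> GQ \<Longrightarrow> t \<in> GQ \<Longrightarrow> (\<lambda>x. s x - t x) \<in> GQ" "smf UNIV f \<Longrightarrow> s \<in> GQ \<Longrightarrow> (\<lambda>x. f x *\<^sub>R s x) \<in> GQ"
  "s \<in> GQ \<Longrightarrow> (\<lambda>x. - s x) \<in> GQ"
  unfolding GQ_iff by simp_all

lemma nab_eq: "nab X s = (\<lambda>x. np x (br (lpart X) s x) + np x (D (npart X) s x))"
  by (simp add: transversal_connection_def normal_part_np)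

lemma nab_GQ [simp]: "X \<in> VF \<Longrightarrow> s \<in> VF \<Longrightarrow> nab X s \<in> GQ"
proof -
  assume "X \<in> VF" "s \<in> VF"
  moreover have "nab X s = npart (\<lambda>x. br (lpart X) s x + D (npart X) s x)"
    by (rule ext) (simp add: nab_eq normal_part_np)
  ultimately show ?thesis by simp
qed

lemma npart_add: "npart (\<lambda>x. X x + Y x) = (\<lambda>x. npart X x + npart Y x)"
  and npart_scale: "npart (\<lambda>x. f x *\<^sub>R X x) = (\<lambda>x. f x *\<^sub>R npart X x)"
  and lpart_add: "lpart (\<lambda>x. X x + Y x) = (\<lambda>x. lpart X x + lpart Y x)"
  and lpart_scale: "lpart (\<lambda>x. f x *\<^sub>R X x) = (\<lambda>x. f x *\<^sub>R lpart X x)"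
  by (simp_all add: npart_fun lpart_fun algebra_simps)

lemma nab_add1: "X \<in> VF \<Longrightarrow> X' \<in> VF \<Longrightarrow> s \<in> VF \<Longrightarrow> nab (\<lambda>x. X x + X' x) s = (\<lambda>x. nab X s x + nab X' s x)"
  by (simp add: nab_eq npart_add lpart_add br_add1 D_add1 add_ac)

lemma nab_scale1: "smf UNIV f \<Longrightarrow> X \<in> VF \<Longrightarrow> s \<in> VF \<Longrightarrow> nab (\<lambda>x. f x *\<^sub>R X x) s = (\<lambda>x. f x *\<^sub>R nab X s x)"
  by (simp add: nab_eq npart_scale lpart_scale br_scale1 D_scale1 np_GL[OF lpart_GL] algebra_simps)

lemma nab_add2: "X \<in> VF \<Longrightarrow> s \<in> VF \<Longrightarrow> t \<in> VF \<Longrightarrow> nab X (\<lambda>x. s x + t x) = (\<lambda>x. nab X s x + nab X t x)"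
  by (simp add: nab_eq br_add2 D_add2 algebra_simps)

lemma dv_split: "smf UNIV f \<Longrightarrow> dv X f x = dv (lpart X) f x + dv (npart X) f x"
  using dv_add_field[of UNIV f x "lpart X" "npart X"] split_field[of X] by simp

lemma nab_scale2:
  assumes "smf UNIV f" "X \<in> VF" "s \<in> GQ"
  shows "nab X (\<lambda>x. f x *\<^sub>R s x) = (\<lambda>x. dv X f x *\<^sub>R s x + f x *\<^sub>R nab X s x)"
  using assms by (simp add: nab_eq br_scale2 D_scale2 np_GQ dv_split[of f X] algebra_simps)

lemma nab_uminus1: "X \<in> VF \<Longrightarrow> s \<in> VF \<Longrightarrow> nab (\<lambda>x. - X x) s = (\<lambda>x. - nab X s x)"
  using nab_scale1[of "\<lambda>_. -1" X s] by simp

lemma nab_diff1: "X \<in> VF \<Longrightarrow> X' \<in> VF \<Longrightarrow> s \<in> VF \<Longrightarrow> nab (\<lambda>x. X x - X' x) s = (\<lambda>x. nab X s x - nab X' s x)"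
  using nab_add1[of X "\<lambda>x. - X' x" s] by (simp add: nab_uminus1)

lemma nab_uminus2: "X \<in> VF \<Longrightarrow> s \<in> GQ \<Longrightarrow> nab X (\<lambda>x. - s x) = (\<lambda>x. - nab X s x)"
  using nab_scale2[of "\<lambda>_. -1" X s] by simp

lemma nab_diff2: "X \<in> VF \<Longrightarrow> s \<in> GQ \<Longrightarrow> t \<in> GQ \<Longrightarrow> nab X (\<lambda>x. s x - t x) = (\<lambda>x. nab X s x - nab X t x)"
  using nab_add2[of X s "\<lambda>x. - t x"] by (simp add: nab_uminus2)

lemma nab_zero2: "X \<in> VF \<Longrightarrow> nab X (\<lambda>x. 0) = (\<lambda>x. 0)"
  using nab_scale2[of "\<lambda>_. 0" X "\<lambda>_. 0"] by simp

text \<open>The components of a submersion are annihilated by fields tangent to the leaves, hence also by their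
brackets.\<close>

lemma involutive:
  assumes "X \<in> GL" "Y \<in> GL"
  shows "br X Y \<in> GL"
proof -
  have "br X Y x \<in> L x" for x
  proof -
    obtain U f where Uf: "(U, f) \<in> F" "x \<in> U" by (rule submersion_at)
    note sub = submersion[OF Uf(1)]
    have comp: "smf U (\<lambda>z. f z $ k)" for k
      unfolding smooth_fun_on_def
    proof
      fix c assume c: "c \<in> A"
      show "smooth_on (snd c ` (fst c \<inter> U)) ((\<lambda>z. f z $ k) \<circ> chart_inv c)"
        using smooth_on_nth[OF chart_image_open_subset[OF c sub(1)] smooth_fun_on_chartD[OF sub(2) c]]
        by (simp add: o_def)
    qed
    have dk: "dv Z (\<lambda>z. f z $ k) z = differential A f z (Z z) $ k" if "z \<in> U" for Z z k
    proof -
      have "differential A (\<lambda>z. f z $ k) z = (\<lambda>v. differential A f z v $ k)"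
        by (rule differential_eqI)
          (use bounded_linear.has_derivative[OF bounded_linear_vec_nth differential_has_derivative[OF sub(2) that]] in \<open>simp add: o_def\<close>)
      then show ?thesis by (simp add: deriv_along_def)
    qed
    have z: "dv Z (\<lambda>z. f z $ k) z = 0" if "Z \<in> GL" "z \<in> U" for Z z k
    proof -
      have "Z z \<in> L z" using that(1) unfolding sections_L_def by blast
      then show ?thesis using leaf_tangent_eq[OF Uf(1) that(2)] by (simp add: dk[OF that(2)])
    qed
    have zz: "dv W (dv Z (\<lambda>z. f z $ k)) x = 0" if "Z \<in> GL" for W Z k
      using dv_local[OF smooth_fun_on_const[of UNIV 0] UNIV_I sub(1) Uf(2), of "dv Z (\<lambda>z. f z $ k)" W] z[OF that] by simp
    have "differential A f x (br X Y x) $ k = 0" for k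
      using dv_bracket[OF sub(1) comp Uf(2), of X Y k] zz assms by (simp add: dk[OF Uf(2)])
    then show ?thesis by (simp add: leaf_tangent_eq[OF Uf] vec_eq_iff)
  qed
  then show ?thesis using assms unfolding sections_L_def by simp
qed

text \<open>The transversal connection is torsion-free for arbitrary fields on \<open>M\<close>. For two fields tangent to the
leaves this is the involutivity of \<open>L\<close>.\<close>

lemma nab_torsion:
  assumes X: "X \<in> VF" and Y: "Y \<in> VF"
  shows "nab X (npart Y) x - nab Y (npart X) x = np x (br X Y x)"
proof -
  have q: "npart X \<in> VF" "npart Y \<in> VF" "lpart X \<in> VF" "lpart Y \<in> VF" using X Y by simp_all
  have "br X Y x = br (\<lambda>x. lpart X x + npart X x) (\<lambda>x. lpart Y x + npart Y x) x"
    by (simp flip: split_field)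
  also have "\<dots> = br (lpart X) (lpart Y) x + br (lpart X) (npart Y) x + br (npart X) (lpart Y) x + br (npart X) (npart Y) x"
    using q by (simp add: br_add1 br_add2)
  finally have "np x (br X Y x) = np x (br (lpart X) (npart Y) x) + np x (br (npart X) (lpart Y) x) + np x (br (npart X) (npart Y) x)"
    using np_GL[OF involutive[OF lpart_GL[OF X] lpart_GL[OF Y]]] by simp
  also have "br (npart X) (lpart Y) = (\<lambda>x. - br (lpart Y) (npart X) x)" by (rule br_skew) (use q in auto)
  finally show ?thesis using q
    by (simp add: nab_eq npart_of_GQ X Y torsion_free[of "npart X" "npart Y"])
qed

definition R where "R = transversal_curvature A g F D"

lemma R_eq: "R X Z s x = nab X (nab Z s) x - nab Z (nab X s) x - nab (br X Z) s x"
  by (simp add: R_def transversal_curvature_def Let_def)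

lemma R_fun: "R X Z s = (\<lambda>x. nab X (nab Z s) x - nab Z (nab X s) x - nab (br X Z) s x)"
  using R_eq by blast

lemma R_GQ [simp]: "X \<in> VF \<Longrightarrow> Z \<in> VF \<Longrightarrow> s \<in> VF \<Longrightarrow> R X Z s \<in> GQ"
  unfolding R_fun by (intro GQ_closed nab_GQ) auto

lemma R_skew12:
  assumes "X \<in> VF" "Z \<in> VF" "s \<in> VF"
  shows "R X Z s x = - R Z X s x"
  using assms nab_uminus1[of "br Z X" s] br_skew[of X Z] by (simp add: R_eq)

lemma R_add3: "X \<in> VF \<Longrightarrow> Z \<in> VF \<Longrightarrow> s \<in> VF \<Longrightarrow> t \<in> VF \<Longrightarrow>
  R X Z (\<lambda>x. s x + t x) = (\<lambda>x. R X Z s x + R X Z t x)"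
  by (simp add: R_fun nab_add2 algebra_simps)

lemma R_add2: "X \<in> VF \<Longrightarrow> Z \<in> VF \<Longrightarrow> Z' \<in> VF \<Longrightarrow> s \<in> VF \<Longrightarrow>
  R X (\<lambda>x. Z x + Z' x) s x = R X Z s x + R X Z' s x"
  by (simp add: R_fun nab_add2 nab_add1 br_add2 algebra_simps)

lemma R_scale3:
  assumes "smf UNIV f" "X \<in> VF" "Z \<in> VF" "s \<in> GQ"
  shows "R X Z (\<lambda>x. f x *\<^sub>R s x) = (\<lambda>x. f x *\<^sub>R R X Z s x)"
  using assms
  by (simp add: R_fun nab_add2 nab_scale2 dv_bracket[OF open_UNIV assms(1) UNIV_I assms(2,3)] algebra_simps)

text \<open>Torsion-freeness turns the cyclic sum into the normal part of the Jacobi identity. The arguments are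
arbitrary fields on \<open>M\<close>, which is what \<open>R_leaf_zero\<close> exploits.\<close>

lemma bianchi:
  assumes "X \<in> VF" "Y \<in> VF" "Z \<in> VF"
  shows "R X Y (npart Z) x + R Y Z (npart X) x + R Z X (npart Y) x = 0"
proof -
  have a: "nab U (nab V (npart W)) x - nab U (nab W (npart V)) x - nab (br V W) (npart U) x = np x (br U (br V W) x)"
    if "U \<in> VF" "V \<in> VF" "W \<in> VF" for U V W
  proof -
    have "nab U (npart (br V W)) x = nab U (\<lambda>x. nab V (npart W) x - nab W (npart V) x) x"
      using nab_torsion[OF that(2,3)] by (simp add: npart_fun)
    also have "\<dots> = nab U (nab V (npart W)) x - nab U (nab W (npart V)) x"
      using that by (simp add: nab_diff2)
    finally show ?thesis using nab_torsion[of U "br V W" x] that by simp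
  qed
  have "np x (br X (br Y Z) x + br Y (br Z X) x + br Z (br X Y) x) = 0"
    using jacobi[OF assms] by simp
  then show ?thesis
    unfolding R_eq np_simps a[OF assms, symmetric] a[OF assms(2,3,1), symmetric] a[OF assms(3,1,2), symmetric]
    by (simp add: algebra_simps)
qed

end

locale riemannian_foliation = foliated_manifold A g F D
  for A :: "('a::{t2_space,second_countable_topology}, 'n::finite) chart set"
    and g :: "('a, 'n) metric" and F :: "('a, 'q::finite) cocycle" and D :: "('a, 'n) connection" +
  assumes bl: "bundle_like A g F"
begin

text \<open>Along the leaves the connection preserves the metric because \<open>g\<close> is bundle-like, and in normal
directions because the Levi-Civita connection does.\<close>

lemma nab_metric:
  assumes X: "X \<in> VF" and s: "s \<in> GQ" and t: "t \<in> GQ"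
  shows "dv X (\<lambda>x. g x (s x) (t x)) x = g x (nab X s x) (t x) + g x (s x) (nab X t x)"
proof -
  have "dv (lpart X) (\<lambda>x. g x (s x) (t x)) x =
      g x (np x (br (lpart X) s x)) (t x) + g x (s x) (np x (br (lpart X) t x))"
    using bl lpart_GL[OF X] s t unfolding bundle_like_def normal_part_np by blast
  moreover have "dv (npart X) (\<lambda>x. g x (s x) (t x)) x =
      g x (np x (D (npart X) s x)) (t x) + g x (s x) (np x (D (npart X) t x))"
  proof -
    have "g x V (t x) = g x (np x V) (t x)" "g x (s x) V = g x (s x) (np x V)" for V
      using g_np(2)[of x V "t x"] g_np(1)[of x "s x" V] by (simp_all add: np_GQ[OF s] np_GQ[OF t])
    then show ?thesis using metric_connection[of "npart X" s t x] X s t by (metis GQ_VF npart_GQ)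
  qed
  ultimately show ?thesis
    using s t by (simp add: dv_split[of _ X] nab_eq g_simps)
qed

lemma R_skew34:
  assumes X: "X \<in> VF" and Z: "Z \<in> VF" and s: "s \<in> GQ" and t: "t \<in> GQ"
  shows "g x (R X Z s x) (t x) = - g x (s x) (R X Z t x)"
proof -
  have fm: "dv U (\<lambda>x. g x (s x) (t x)) = (\<lambda>x. g x (nab U s x) (t x) + g x (s x) (nab U t x))" if "U \<in> VF" for U
    using nab_metric[OF that s t] by blast
  have two: "dv V (dv U (\<lambda>x. g x (s x) (t x))) x = g x (nab V (nab U s) x) (t x) + g x (nab U s x) (nab V t x)
      + g x (nab V s x) (nab U t x) + g x (s x) (nab V (nab U t) x)" if "U \<in> VF" "V \<in> VF" for U V
  proof -
    have "dv V (dv U (\<lambda>x. g x (s x) (t x))) x = dv V (\<lambda>x. g x (nab U s x) (t x)) x + dv V (\<lambda>x. g x (s x) (nab U t x)) x"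
      unfolding fm[OF that(1)] by (rule dv_add[of UNIV]) (use that s t in auto)
    then show ?thesis using that s t by (simp add: nab_metric)
  qed
  have "dv (br X Z) (\<lambda>x. g x (s x) (t x)) x = dv X (dv Z (\<lambda>x. g x (s x) (t x))) x - dv Z (dv X (\<lambda>x. g x (s x) (t x))) x"
    by (rule dv_bracket[of UNIV]) (use X Z s t in auto)
  then show ?thesis
    using X Z s t by (simp add: two nab_metric R_eq g_simps)
qed

text \<open>For \<open>Z\<close> tangent to the leaves the Bianchi identity makes \<open>g (R(Z,X) W) V\<close> symmetric in \<open>X\<close> and \<open>W\<close>, while
it is skew in \<open>W\<close> and \<open>V\<close>. Such a trilinear form is zero.\<close>

lemma R_leaf_zero:
  assumes Z: "Z \<in> GL" and X: "X \<in> GQ" and s: "s \<in> GQ"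
  shows "R Z X s x = 0"
proof -
  define b where "b X W V = g x (R Z X W x) (V x)" for X W V
  have sym: "b X W V = b W X V" if "X \<in> GQ" "W \<in> GQ" for X W V
  proof -
    have "R X W (\<lambda>x. 0) x = 0" using that by (simp add: R_eq nab_zero2)
    then have "R Z X W x = R Z W X x"
      using bianchi[of Z X W x] Z that R_skew12[of W Z X x] by (simp add: npart_of_GQ npart_of_GL)
    then show ?thesis by (simp add: b_def)
  qed
  have skew: "b X W V = - b X V W" if "X \<in> GQ" "W \<in> GQ" "V \<in> GQ" for X W V
    using R_skew34[of Z X W V x] that Z by (simp add: b_def g_sym)
  define V where "V = R Z X s"
  have V: "V \<in> GQ" using Z X s by (simp add: V_def)
  have "b X s V = 0"
    using sym[OF X s, of V] skew[OF s X V] sym[OF s V, of X] skew[OF V s X] sym[OF V X, of s] skew[OF X V s] by linarith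
  then have "g x (V x) (V x) = 0" by (simp add: b_def V_def)
  then show ?thesis using g_pos[of "V x" x] by (cases "V x = 0") (auto simp: V_def)
qed

text \<open>The classical consequence of skew-symmetry and the Bianchi identity: combine the four Bianchi
identities obtained by cyclic permutation of the arguments.\<close>

lemma R_pair:
  assumes "X \<in> GQ" "Y \<in> GQ" "Z \<in> GQ" "W \<in> GQ"
  shows "g x (R X Y Z x) (W x) = g x (R Z W X x) (Y x)"
proof -
  define r where "r X Y Z W = g x (R X Y Z x) (W x)" for X Y Z W
  have s1: "r X Y Z W = - r Y X Z W" if "X \<in> GQ" "Y \<in> GQ" "Z \<in> GQ" "W \<in> GQ" for X Y Z W
    using R_skew12[of X Y Z x] that by (simp add: r_def g_simps)
  have s2: "r X Y Z W = - r X Y W Z" if "X \<in> GQ" "Y \<in> GQ" "Z \<in> GQ" "W \<in> GQ" for X Y Z W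
    using R_skew34[of X Y Z W x] that by (simp add: r_def g_sym)
  have b: "r X Y Z W + r Y Z X W + r Z X Y W = 0" if "X \<in> GQ" "Y \<in> GQ" "Z \<in> GQ" "W \<in> GQ" for X Y Z W
    using arg_cong[OF bianchi[of X Y Z x], of "\<lambda>v. g x v (W x)"] that by (simp add: r_def g_simps npart_of_GQ)
  have "r X Y Z W = r Z W X Y"
    using b[OF assms(1) assms(2) assms(3) assms(4)] b[OF assms(2) assms(3) assms(4) assms(1)] b[OF assms(3) assms(4) assms(1) assms(2)] b[OF assms(4) assms(1) assms(2) assms(3)]
      s2[OF assms(2) assms(3) assms(1) assms(4)] s2[OF assms(3) assms(4) assms(1) assms(2)] s2[OF assms(1) assms(4) assms(2) assms(3)] s2[OF assms(3) assms(1) assms(2) assms(4)]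
      s2[OF assms(1) assms(2) assms(3) assms(4)] s2[OF assms(2) assms(4) assms(3) assms(1)] s1[OF assms(4) assms(2) assms(3) assms(1)] s1[OF assms(4) assms(1) assms(3) assms(2)]
      s1[OF assms(1) assms(3) assms(4) assms(2)] s1[OF assms(4) assms(1) assms(2) assms(3)]
    by linarith
  then show ?thesis by (simp add: r_def)
qed

end

section \<open>Projective fields of a Kaehler foliation\<close>

lemma trace_matrix: "trace (matrix h) = (\<Sum>i\<in>UNIV. h (axis i 1) $ i)"
  by (simp add: trace_def matrix_def)

text \<open>For \<open>h\<close> skew with respect to \<open>G\<close>, the matrix of \<open>h\<close> is conjugate to the negative of its transpose.\<close>

lemma trace_skew_zero:
  fixes G :: "real^'n^'n" and h :: "real^'n \<Rightarrow> real^'n"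
  assumes "invertible G" "linear h" "\<And>v w. h v \<bullet> (G *v w) = - (v \<bullet> (G *v h w))"
  shows "trace (matrix h) = 0"
proof -
  define M where "M = matrix h"
  note G = matrix_inv_inverse[OF assms(1)]
  have h: "h v = M *v v" for v
    using fun_cong[OF matrix_vector_mul(2)[OF assms(2)], of v] by (simp add: M_def)
  have "transpose M ** G = - (G ** M)"
  proof -
    have "(transpose M ** G) *v w = (- (G ** M)) *v w" for w
    proof -
      have "v \<bullet> ((transpose M ** G) *v w) = v \<bullet> ((- (G ** M)) *v w)" for v
      proof -
        have "v \<bullet> ((transpose M ** G) *v w) = (M *v v) \<bullet> (G *v w)"
          by (simp add: transpose_matrix_vector dot_lmul_matrix inner_commute[of v] inner_commute[of "M *v v"]
              flip: matrix_vector_mul_assoc)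
        also have "\<dots> = - (v \<bullet> (G *v (M *v w)))" using assms(3)[of v w] by (simp add: h)
        also have "\<dots> = v \<bullet> - ((G ** M) *v w)" by (simp add: matrix_vector_mul_assoc)
        also have "- ((G ** M) *v w) = (- (G ** M)) *v w"
          by (simp add: matrix_vector_mult_def vec_eq_iff sum_negf)
        finally show ?thesis .
      qed
      then show ?thesis by (metis vector_eq_ldot)
    qed
    then show ?thesis by (simp add: matrix_eq)
  qed
  then have "matrix_inv G ** (transpose M ** G) = matrix_inv G ** (- (G ** M))" by simp
  also have "\<dots> = - (matrix_inv G ** (G ** M))" by (simp add: matrix_matrix_mult_def vec_eq_iff sum_negf)
  also have "\<dots> = - M" by (simp add: matrix_mul_assoc G)
  finally have "trace (matrix_inv G ** (transpose M ** G)) = - trace M" by (simp add: trace_def sum_negf)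
  moreover have "trace (matrix_inv G ** (transpose M ** G)) = trace (transpose M)"
    by (subst trace_mul_sym) (simp add: G flip: matrix_mul_assoc)
  moreover have "trace (transpose M) = trace M" by (simp add: trace_def transpose_def)
  ultimately show ?thesis by (simp add: M_def)
qed

locale projective_kaehler = riemannian_foliation A g F D
  for A :: "('a::{t2_space,second_countable_topology}, 'n::finite) chart set"
    and g :: "('a, 'n) metric" and F :: "('a, 'q::finite) cocycle" and D :: "('a, 'n) connection" +
  fixes J :: "'a \<Rightarrow> real^'n \<Rightarrow> real^'n" and Y :: "('a, 'n) vfield" and \<alpha> :: "'a \<Rightarrow> real^'n \<Rightarrow> real"
  assumes acs: "almost_complex_structure A g F J"
    and J_isometric: "\<And>s t x. s \<in> sections_Q A g F \<Longrightarrow> t \<in> sections_Q A g F \<Longrightarrow>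
      g x (J x (s x)) (J x (t x)) = g x (s x) (t x)"
    and J_parallel: "\<And>X s x. X \<in> vfields A \<Longrightarrow> s \<in> sections_Q A g F \<Longrightarrow>
      transversal_connection A g F D X (\<lambda>x. J x (s x)) x = J x (transversal_connection A g F D X s x)"
    and Y: "Y \<in> infinitesimal_automorphisms A F"
    and basic: "basic_1form A F \<alpha>"
    and projective: "\<And>X Z x. X \<in> sections_Q A g F \<Longrightarrow> Z \<in> sections_Q A g F \<Longrightarrow>
      lie_connection A g F D Y X Z x = \<alpha> x (X x) *\<^sub>R Z x + \<alpha> x (Z x) *\<^sub>R X x"
begin

text \<open>Composing \<open>J\<close> with the normal projection yields a linear map on the whole tangent space. On sections of
the normal bundle, \<open>Jf\<close> is \<open>J\<close>.\<close>

definition Jp where "Jp x v = J x (np x v)"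
definition Jf where "Jf s = (\<lambda>x. Jp x (s x))"
definition Yb where "Yb = npart Y"

lemma Jp_linear: "linear (Jp x)"
proof (rule linearI)
  show "Jp x (v + w) = Jp x v + Jp x w" for v w
    using acs np_in_Q unfolding almost_complex_structure_def Jp_def by simp
  show "Jp x (r *\<^sub>R v) = r *\<^sub>R Jp x v" for r v
    using acs np_in_Q unfolding almost_complex_structure_def Jp_def by simp
qed

lemmas Jp_simps [simp] = linear_add[OF Jp_linear] linear_scale[OF Jp_linear] linear_0[OF Jp_linear]
  linear_neg[OF Jp_linear] linear_diff[OF Jp_linear]

lemma np_Jp [simp]: "np x (Jp x v) = Jp x v" and Jp_Jp [simp]: "Jp x (Jp x v) = - np x v"
  and Jp_np [simp]: "Jp x (np x v) = Jp x v"
proof -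
  have "J x (np x v) \<in> Q x" "J x (J x (np x v)) = - np x v"
    using acs np_in_Q unfolding almost_complex_structure_def by blast+
  then show "np x (Jp x v) = Jp x v" "Jp x (Jp x v) = - np x v"
    by (simp_all add: Jp_def np_Q)
qed (simp add: Jp_def)

lemma Jf_section: "s \<in> GQ \<Longrightarrow> Jf s = (\<lambda>x. J x (s x))"
  by (simp add: Jf_def Jp_def np_GQ)

lemma Jf_GQ [simp]: "s \<in> GQ \<Longrightarrow> Jf s \<in> GQ"
proof -
  assume s: "s \<in> GQ"
  then have "(\<lambda>x. J x (s x)) \<in> VF" using acs unfolding almost_complex_structure_def by blast
  then have "Jf s \<in> VF" by (simp add: Jf_section[OF s])
  then show ?thesis unfolding GQ_iff by (simp add: Jf_def)
qed

lemma nab_J: "X \<in> VF \<Longrightarrow> s \<in> GQ \<Longrightarrow> nab X (Jf s) = Jf (nab X s)"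
  using J_parallel by (simp add: Jf_section fun_eq_iff)

lemma g_J: "s \<in> GQ \<Longrightarrow> t \<in> GQ \<Longrightarrow> g x (Jf s x) (Jf t x) = g x (s x) (t x)"
  using J_isometric by (simp add: Jf_section)

lemma R_J: "X \<in> VF \<Longrightarrow> Z \<in> VF \<Longrightarrow> s \<in> GQ \<Longrightarrow> R X Z (Jf s) = Jf (R X Z s)"
  by (simp add: R_fun nab_J) (simp add: Jf_def)

text \<open>By the pair symmetry, invariance under \<open>J\<close> in the first two arguments amounts to the fact that \<open>R(U,V)\<close>
commutes with the isometry \<open>J\<close>.\<close>

lemma R_J_invariant:
  assumes X: "X \<in> GQ" and Z: "Z \<in> GQ" and s: "s \<in> GQ"
  shows "R (Jf X) (Jf Z) s = R X Z s"
proof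
  fix x
  have eq: "g x (R (Jf X) (Jf Z) s x) (t x) = g x (R X Z s x) (t x)" if t: "t \<in> GQ" for t
    using R_pair[of "Jf X" "Jf Z" s t x] R_pair[OF X Z s t, of x] g_J[of "R s t X" Z x] X Z s t
    by (simp add: R_J)
  define t where "t = (\<lambda>x. R (Jf X) (Jf Z) s x - R X Z s x)"
  have "t \<in> GQ" using X Z s by (simp add: t_def)
  from eq[OF this] have "g x (t x) (t x) = 0" by (simp add: t_def g_simps)
  then show "R (Jf X) (Jf Z) s x = R X Z s x"
    using g_pos[of "t x" x] by (cases "t x = 0") (auto simp: t_def)
qed

lemma Y_VF [simp]: "Y \<in> VF" and Yb_GQ [simp]: "Yb \<in> GQ"
  using Y by (auto simp: infinitesimal_automorphisms_def Yb_def)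

text \<open>The infinitesimal automorphism condition says that \<open>Yb\<close> is parallel along the leaves.\<close>

lemma nab_leaf_Yb: "Z \<in> GL \<Longrightarrow> nab Z Yb = (\<lambda>x. 0)"
proof
  fix x assume Z: "Z \<in> GL"
  have "br Y Z \<in> GL" using Y Z unfolding infinitesimal_automorphisms_def by blast
  then have "np x (br Z Y x) = 0" using br_skew[of Z Y] Z by (simp add: np_GL)
  then show "nab Z Yb x = 0"
    using nab_torsion[of Z Y x] Z by (simp add: npart_of_GL nab_zero2 Yb_def)
qed

lemma nab_split: "X \<in> VF \<Longrightarrow> s \<in> VF \<Longrightarrow> nab X s x = nab (lpart X) s x + nab (npart X) s x"
  using nab_add1[of "lpart X" "npart X" s] split_field[of X] by simp

lemma nab_normal_Yb: "X \<in> VF \<Longrightarrow> nab (npart X) Yb = nab X Yb"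
  by (rule ext, subst nab_split[of X]) (simp_all add: nab_leaf_Yb)

lemma \<alpha>_linear: "linear (\<alpha> x)" and \<alpha>_smooth [simp]: "X \<in> VF \<Longrightarrow> smf UNIV (\<lambda>x. \<alpha> x (X x))"
  using basic unfolding basic_1form_def by blast+

lemmas \<alpha>_simps = linear_add[OF \<alpha>_linear] linear_scale[OF \<alpha>_linear] linear_0[OF \<alpha>_linear]
  linear_neg[OF \<alpha>_linear] linear_diff[OF \<alpha>_linear]

lemma \<alpha>_GL: "X \<in> GL \<Longrightarrow> \<alpha> x (X x) = 0"
  using basic unfolding basic_1form_def by blast

lemma \<alpha>_np [simp]: "\<alpha> x (np x v) = \<alpha> x v"
  using \<alpha>_GL[OF lpart_GL[of "some_field x v"], of x] by (simp add: lpart_fun \<alpha>_simps)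

text \<open>The projective equation for arbitrary \<open>Z\<close>. For \<open>Z\<close> normal it is the hypothesis. For \<open>Z\<close> tangent to the
leaves both sides vanish: the left side is \<open>R(Z,X) Yb\<close>, as \<open>Yb\<close> is parallel along the leaves.\<close>

lemma lie_equation:
  assumes Z: "Z \<in> VF" and X: "X \<in> GQ"
  shows "nab Z (nab X Yb) x - nab (nab Z X) Yb x =
    \<alpha> x (Z x) *\<^sub>R X x + \<alpha> x (X x) *\<^sub>R np x (Z x) - R Yb Z X x"
proof -
  have leaf: "nab W (nab X Yb) x - nab (nab W X) Yb x = 0" if W: "W \<in> GL" for W
  proof -
    have "npart (br W X) = nab W X"
      using nab_torsion[of W X] W X by (simp add: npart_of_GL npart_of_GQ nab_zero2 normal_part_np fun_eq_iff)
    then have "nab (br W X) Yb = nab (nab W X) Yb" using nab_normal_Yb[of "br W X"] W X by simp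
    then show ?thesis
      using R_leaf_zero[OF W X Yb_GQ, of x] X by (simp add: R_eq nab_leaf_Yb[OF W] nab_zero2)
  qed
  have normal: "nab W (nab X Yb) x - nab (nab W X) Yb x =
      \<alpha> x (W x) *\<^sub>R X x + \<alpha> x (X x) *\<^sub>R W x - R Yb W X x" if W: "W \<in> GQ" for W
    using projective[OF W X, of x] W by (simp add: lie_connection_def Let_def npart_of_GQ R_def algebra_simps flip: Yb_def)
  have RZ: "R Yb Z X x = R Yb (npart Z) X x"
  proof -
    have "R Yb Z X x = R Yb (lpart Z) X x + R Yb (npart Z) X x"
      using R_add2[of Yb "lpart Z" "npart Z" X x] Z X by (simp flip: split_field)
    then show ?thesis using R_leaf_zero[OF lpart_GL[OF Z] Yb_GQ X, of x] R_skew12[of Yb "lpart Z" X x] Z X by simp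
  qed
  have "nab Z X = (\<lambda>x. nab (lpart Z) X x + nab (npart Z) X x)" by (rule ext) (rule nab_split, use Z X in auto)
  then have "nab (nab Z X) Yb x = nab (nab (lpart Z) X) Yb x + nab (nab (npart Z) X) Yb x"
    using Z X by (simp add: nab_add1)
  then have "nab Z (nab X Yb) x - nab (nab Z X) Yb x =
      (nab (lpart Z) (nab X Yb) x - nab (nab (lpart Z) X) Yb x) + (nab (npart Z) (nab X Yb) x - nab (nab (npart Z) X) Yb x)"
    using nab_split[of Z "nab X Yb" x] Z X by simp
  also have "\<dots> = \<alpha> x (Z x) *\<^sub>R X x + \<alpha> x (X x) *\<^sub>R np x (Z x) - R Yb Z X x"
    using leaf[OF lpart_GL[OF Z]] normal[OF npart_GQ[OF Z]] by (simp add: RZ normal_part_np)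
  finally show ?thesis .
qed

text \<open>The derivation over \<open>Z\<close> that acts by \<open>\<nabla>\<^sub>Z\<close> on the normal part and by the leaf part of \<open>D\<^sub>Z\<close> on the
leaf part. It preserves the splitting, so its commutator with \<open>X \<mapsto> \<nabla>\<^sub>X Yb\<close> is the left side
of \<open>lie_equation\<close> at the normal part of \<open>X\<close>.\<close>

definition \<delta> where "\<delta> Z X = (\<lambda>x. nab Z (npart X) x + lpart (D Z (lpart X)) x)"

lemma lpart_lfp: "lpart (lpart X) = lpart X" "lpart (\<lambda>x. f x *\<^sub>R lpart X x) = (\<lambda>x. f x *\<^sub>R lpart X x)"
  by (simp_all add: lpart_fun algebra_simps)

lemma derivation_\<delta>:
  assumes Z: "Z \<in> VF"
  shows "derivation Z (\<delta> Z)"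
proof -
  have 1: "\<delta> Z X \<in> VF" if "X \<in> VF" for X using that Z by (simp add: \<delta>_def)
  have 2: "\<delta> Z (\<lambda>x. X x + X' x) = (\<lambda>x. \<delta> Z X x + \<delta> Z X' x)" if "X \<in> VF" "X' \<in> VF" for X X'
    using that Z by (simp add: \<delta>_def npart_add lpart_add nab_add2 D_add2 add_ac)
  have 3: "\<delta> Z (\<lambda>x. f x *\<^sub>R X x) = (\<lambda>x. dv Z f x *\<^sub>R X x + f x *\<^sub>R \<delta> Z X x)" if "smf UNIV f" "X \<in> VF" for f X
  proof -
    have e: "X x = npart X x + lpart X x" for x by (simp add: npart_fun lpart_fun)
    have "\<delta> Z (\<lambda>x. f x *\<^sub>R X x) = (\<lambda>x. dv Z f x *\<^sub>R (npart X x + lpart X x) + f x *\<^sub>R \<delta> Z X x)"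
      using that Z
      by (simp add: \<delta>_def npart_scale lpart_scale nab_scale2 D_scale2 lpart_add lpart_lfp algebra_simps)
    then show ?thesis by (simp flip: e)
  qed
  show ?thesis unfolding derivation_def using 1 2 3 by blast
qed

lemma tensorial_nab_Yb: "tensorial (\<lambda>X. nab X Yb)"
  by (rule tensorialI) (simp_all add: nab_add1 nab_scale1)

lemma commutator_nab_Yb:
  assumes Z: "Z \<in> VF" and X: "X \<in> VF"
  shows "\<delta> Z (nab X Yb) x - nab (\<delta> Z X) Yb x =
    \<alpha> x (Z x) *\<^sub>R np x (X x) + \<alpha> x (X x) *\<^sub>R np x (Z x) - R Yb Z (npart X) x"
proof -
  have "lpart (nab X Yb) = (\<lambda>x. 0)" using np_GQ[OF nab_GQ[of X Yb]] X by (simp add: lpart_fun)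
  moreover have "D Z (\<lambda>x. 0) = (\<lambda>x. 0)" using D_scale2[of "\<lambda>_. 0" Z "\<lambda>_. 0"] Z by simp
  moreover have "lpart (\<lambda>x. 0) = (\<lambda>x. 0)" by (simp add: lpart_fun)
  ultimately have 1: "\<delta> Z (nab X Yb) = nab Z (nab (npart X) Yb)"
    using X Z by (simp add: \<delta>_def npart_of_GQ nab_normal_Yb)
  have 2: "nab (\<delta> Z X) Yb = nab (nab Z (npart X)) Yb"
    unfolding \<delta>_def using X Z nab_leaf_Yb[OF lpart_GL, of "D Z (lpart X)"] by (simp add: nab_add1)
  show ?thesis
    using lie_equation[OF Z npart_GQ[OF X], of x] by (simp add: 1 2 normal_part_np)
qed

text \<open>Take traces in \<open>commutator_nab_Yb\<close>: the identity of the normal bundle contributes \<open>q \<alpha>(Z)\<close>, the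
term of rank one \<open>\<alpha>(Z)\<close>, and the skew curvature term nothing.\<close>

lemma potential_derivative:
  assumes Z: "Z \<in> VF"
  shows "dv Z (tr (\<lambda>X. nab X Yb)) x = (real CARD('q) + 1) * \<alpha> x (Z x)"
proof -
  define \<Psi> where "\<Psi> X = R Yb Z (npart X)" for X
  have \<Psi>: "tensorial \<Psi>"
    unfolding \<Psi>_def by (rule tensorialI) (use Z in \<open>simp_all add: npart_add npart_scale R_add3 R_scale3\<close>)
  note lin\<Psi> = at_pt_linear[OF \<Psi>, of x]
  have skew: "g x (at_pt \<Psi> x v) w = - g x v (at_pt \<Psi> x w)" for v w
  proof -
    define V W where "V = some_field x v" and "W = some_field x w"
    have VW: "V \<in> VF" "W \<in> VF" "V x = v" "W x = w" by (simp_all add: V_def W_def)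
    have "g x (R Yb Z (npart V) x) (npart W x) = - g x (npart V x) (R Yb Z (npart W) x)"
      by (rule R_skew34) (use Z VW in auto)
    moreover have "g x (R Yb Z (npart V) x) (np x w) = g x (R Yb Z (npart V) x) w"
      using g_np(1)[of x "R Yb Z (npart V) x" w] np_GQ[OF R_GQ[of Yb Z "npart V"]] Z VW by simp
    moreover have "g x (np x v) (R Yb Z (npart W) x) = g x v (R Yb Z (npart W) x)"
      using g_np(2)[of x v "R Yb Z (npart W) x"] np_GQ[OF R_GQ[of Yb Z "npart W"]] Z VW by simp
    ultimately show ?thesis using VW by (simp add: at_pt_def \<Psi>_def normal_part_np flip: V_def W_def)
  qed
  have "trace (matrix (at_pt \<Psi> x)) = 0"
  proof (rule trace_skew_zero[OF invertible_if_positive[OF Gm_pos[OF chart_at_in chart_at_dom]] lin\<Psi>])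
    have S: "Sc (chart_at A x) x v = v" for v
      using Sc_Tc[OF chart_at_in chart_at_dom, of x v] by (simp add: Tc_chart_at)
    show "at_pt \<Psi> x v \<bullet> (Gm (chart_at A x) x *v w) = - (v \<bullet> (Gm (chart_at A x) x *v at_pt \<Psi> x w))" for v w
      using skew by (simp add: Gm_form S)
  qed
  then have tr\<Psi>: "(\<Sum>i\<in>UNIV. at_pt \<Psi> x (axis i 1) $ i) = 0" by (simp add: trace_matrix)
  have trnp: "(\<Sum>i\<in>UNIV. np x (axis i 1) $ i) = real CARD('q)" using trace_np[of x] by (simp add: trace_matrix)
  have rank1: "(\<Sum>i\<in>UNIV. \<alpha> x (axis i 1) * w $ i) = \<alpha> x w" for w
  proof -
    have "\<alpha> x w = \<alpha> x (\<Sum>i\<in>UNIV. (w $ i) *\<^sub>R axis i 1)" using vec_expansion[of w] by simp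
    then show ?thesis by (simp add: linear_sum[OF \<alpha>_linear] linear_scale[OF \<alpha>_linear] mult.commute)
  qed
  define C where "C = (\<lambda>X x. \<delta> Z (nab X Yb) x - nab (\<delta> Z X) Yb x)"
  have "at_pt C x v = \<alpha> x (Z x) *\<^sub>R np x v + \<alpha> x v *\<^sub>R np x (Z x) - at_pt \<Psi> x v" for v
    using commutator_nab_Yb[OF Z, of "some_field x v" x] by (simp add: at_pt_def C_def \<Psi>_def)
  then have "tr C x = \<alpha> x (Z x) * (\<Sum>i\<in>UNIV. np x (axis i 1) $ i) + (\<Sum>i\<in>UNIV. \<alpha> x (axis i 1) * np x (Z x) $ i)
      - (\<Sum>i\<in>UNIV. at_pt \<Psi> x (axis i 1) $ i)"
    by (simp add: tr_def trace_matrix sum.distrib sum_subtractf sum_distrib_left)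
  also have "\<dots> = (real CARD('q) + 1) * \<alpha> x (Z x)" by (simp add: tr\<Psi> trnp rank1 algebra_simps)
  finally show ?thesis
    using trace_smooth_and_derivative(2)[OF derivation_\<delta>[OF Z] tensorial_nab_Yb Z, of x] by (simp add: C_def)
qed

lemma potential:
  obtains f where "smf UNIV (f :: 'a \<Rightarrow> real)" "\<And>Z x. Z \<in> VF \<Longrightarrow> dv Z f x = \<alpha> x (Z x)"
proof
  define h where "h = tr (\<lambda>X. nab X Yb)"
  define c where "c = inverse (real CARD('q) + 1)"
  have h: "smf UNIV h"
    unfolding h_def by (rule trace_smooth_and_derivative(1)[OF derivation_\<delta>[OF vfields_zero] tensorial_nab_Yb vfields_zero])
  show "smf UNIV (\<lambda>x. c * h x)" by (rule smooth_fun_on_mult) (use h in auto)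
  show "dv Z (\<lambda>x. c * h x) x = \<alpha> x (Z x)" if "Z \<in> VF" for Z x
    using dv_cmul[OF h UNIV_I, of Z c x] potential_derivative[OF that, of x] by (simp add: c_def flip: h_def)
qed

text \<open>The covariant derivative of \<open>\<alpha>\<close>, that is, the transversal Hessian of the potential of \<open>\<alpha>\<close>.\<close>

definition Hess where "Hess X W x = dv X (\<lambda>x. \<alpha> x (W x)) x - \<alpha> x (nab X W x)"

text \<open>The Lie derivative of \<open>J\<close> along \<open>Y\<close>, written as the commutator of \<open>J\<close> with \<open>W \<mapsto> \<nabla>\<^sub>W Yb\<close>.\<close>

definition K where "K W = (\<lambda>x. Jf (nab W Yb) x - nab (Jf W) Yb x)"

lemma K_GQ [simp]: "W \<in> GQ \<Longrightarrow> K W \<in> GQ"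
  by (simp add: K_def)

lemma Jf_diff: "Jf (\<lambda>x. s x - t x) = (\<lambda>x. Jf s x - Jf t x)"
  by (simp add: Jf_def)

lemma K_diff: "V \<in> GQ \<Longrightarrow> W \<in> GQ \<Longrightarrow> K (\<lambda>x. V x - W x) = (\<lambda>x. K V x - K W x)"
  by (simp add: K_def nab_diff1 Jf_diff algebra_simps)

text \<open>In the commutator with \<open>J\<close> the terms \<open>\<alpha>(Z) X\<close> and \<open>R(Yb,Z) X\<close> of \<open>lie_equation\<close> drop out, because they are
given by endomorphisms commuting with \<open>J\<close>.\<close>

lemma nab_K:
  assumes Z: "Z \<in> VF" and W: "W \<in> GQ"
  shows "nab Z (K W) = (\<lambda>x. K (nab Z W) x + (\<alpha> x (W x) *\<^sub>R Jf (npart Z) x - \<alpha> x (Jf W x) *\<^sub>R npart Z x))"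
proof
  fix x
  have "nab Z (K W) x = Jp x (nab Z (nab W Yb) x) - nab Z (nab (Jf W) Yb) x"
    unfolding K_def using Z W by (simp add: nab_diff2 nab_J) (simp add: Jf_def)
  also have "nab Z (nab W Yb) x = nab (nab Z W) Yb x + (\<alpha> x (Z x) *\<^sub>R W x + \<alpha> x (W x) *\<^sub>R np x (Z x) - R Yb Z W x)"
    using lie_equation[OF Z W, of x] by (simp add: algebra_simps)
  also have "nab Z (nab (Jf W) Yb) x = nab (Jf (nab Z W)) Yb x + (\<alpha> x (Z x) *\<^sub>R Jf W x + \<alpha> x (Jf W x) *\<^sub>R np x (Z x) - Jp x (R Yb Z W x))"
    using lie_equation[OF Z Jf_GQ[OF W], of x] Z W by (simp add: nab_J R_J algebra_simps) (simp add: Jf_def algebra_simps)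
  finally show "nab Z (K W) x = K (nab Z W) x + (\<alpha> x (W x) *\<^sub>R Jf (npart Z) x - \<alpha> x (Jf W x) *\<^sub>R npart Z x)"
    by (simp add: K_def normal_part_np) (simp add: Jf_def normal_part_np)
qed

text \<open>Ricci's identity for \<open>K\<close>. The terms that contain first derivatives of \<open>X\<close> and \<open>Z\<close> cancel because the
connection is torsion-free.\<close>

lemma integrability:
  assumes X: "X \<in> GQ" and Z: "Z \<in> GQ" and W: "W \<in> GQ"
  shows "R X Z (K W) x - K (R X Z W) x = Hess X W x *\<^sub>R Jf Z x - Hess X (Jf W) x *\<^sub>R Z x
     - Hess Z W x *\<^sub>R Jf X x + Hess Z (Jf W) x *\<^sub>R X x"
proof -
  have two: "nab U (nab V (K W)) x = K (nab U (nab V W)) x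
      + (\<alpha> x (nab V W x) *\<^sub>R Jf U x - \<alpha> x (Jf (nab V W) x) *\<^sub>R U x)
      + (dv U (\<lambda>x. \<alpha> x (W x)) x *\<^sub>R Jf V x + \<alpha> x (W x) *\<^sub>R Jf (nab U V) x)
      - (dv U (\<lambda>x. \<alpha> x (Jf W x)) x *\<^sub>R V x + \<alpha> x (Jf W x) *\<^sub>R nab U V x)"
    if U: "U \<in> GQ" and V: "V \<in> GQ" for U V
  proof -
    have "nab V (K W) = (\<lambda>x. K (nab V W) x + (\<alpha> x (W x) *\<^sub>R Jf V x - \<alpha> x (Jf W x) *\<^sub>R V x))"
      using nab_K[of V W] V W by (simp add: npart_of_GQ)
    then have "nab U (nab V (K W)) x = nab U (K (nab V W)) x
      + (nab U (\<lambda>x. \<alpha> x (W x) *\<^sub>R Jf V x) x - nab U (\<lambda>x. \<alpha> x (Jf W x) *\<^sub>R V x) x)"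
      using U V W by (simp add: nab_add2 nab_diff2)
    also have "nab U (K (nab V W)) x = K (nab U (nab V W)) x
      + (\<alpha> x (nab V W x) *\<^sub>R Jf U x - \<alpha> x (Jf (nab V W) x) *\<^sub>R U x)"
      using nab_K[of U "nab V W"] U V W by (simp add: npart_of_GQ)
    also have "nab U (\<lambda>x. \<alpha> x (W x) *\<^sub>R Jf V x) x = dv U (\<lambda>x. \<alpha> x (W x)) x *\<^sub>R Jf V x + \<alpha> x (W x) *\<^sub>R Jf (nab U V) x"
      using U V W by (simp add: nab_scale2 nab_J)
    also have "nab U (\<lambda>x. \<alpha> x (Jf W x) *\<^sub>R V x) x = dv U (\<lambda>x. \<alpha> x (Jf W x)) x *\<^sub>R V x + \<alpha> x (Jf W x) *\<^sub>R nab U V x"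
      using U V W by (simp add: nab_scale2)
    finally show ?thesis by simp
  qed
  have t: "npart (br X Z) = (\<lambda>x. nab X Z x - nab Z X x)"
    using nab_torsion[of X Z] X Z by (simp add: normal_part_np fun_eq_iff npart_of_GQ)
  have br: "nab (br X Z) (K W) x = K (nab (br X Z) W) x +
      (\<alpha> x (W x) *\<^sub>R (Jf (nab X Z) x - Jf (nab Z X) x) - \<alpha> x (Jf W x) *\<^sub>R (nab X Z x - nab Z X x))"
    using nab_K[of "br X Z" W] X Z W by (simp add: t Jf_diff)
  have "K (R X Z W) x = K (nab X (nab Z W)) x - K (nab Z (nab X W)) x - K (nab (br X Z) W) x"
    unfolding R_fun using X Z W by (simp add: K_diff)
  then show ?thesis
    unfolding R_eq two[OF X Z] two[OF Z X] br Hess_def using X Z W by (simp add: nab_J algebra_simps)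
qed

text \<open>By \<open>R_J_invariant\<close> the right side of \<open>integrability\<close> does not change when \<open>(X,Z)\<close> is replaced by
\<open>(J X,J Z)\<close>. For \<open>Z\<close> outside the complex line spanned by \<open>X\<close> the coefficient of \<open>J Z\<close> in
the difference is the sum in question.\<close>

lemma Hess_anti_invariant:
  assumes q: "CARD('q) \<ge> 3" and X: "X \<in> GQ" and W: "W \<in> GQ"
  shows "Hess X W x + Hess (Jf X) (Jf W) x = 0"
proof (rule ccontr)
  define a where "a = Hess X W x + Hess (Jf X) (Jf W) x"
  assume "\<not> ?thesis"
  then have a: "a \<noteq> 0" by (simp add: a_def)
  obtain v where v: "v \<in> Q x" "v \<notin> span {X x, Jf X x}" by (rule exists_normal_outside_plane[OF q])
  define Z where "Z = npart (some_field x v)"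
  have Z: "Z \<in> GQ" "Z x = v" using v by (simp_all add: Z_def normal_part_np np_Q)
  have JJ: "Jf (Jf s) x = - s x" if "s \<in> GQ" for s using np_GQ[OF that] by (simp add: Jf_def)
  define b where "b = Hess (Jf X) W x - Hess X (Jf W) x"
  define c1 where "c1 = Hess Z W x + Hess (Jf Z) (Jf W) x"
  define c2 where "c2 = Hess (Jf Z) W x - Hess Z (Jf W) x"
  have "R (Jf X) (Jf Z) (K W) x - K (R (Jf X) (Jf Z) W) x = R X Z (K W) x - K (R X Z W) x"
    using X Z(1) W by (simp add: R_J_invariant)
  then have eq: "a *\<^sub>R Jf Z x + b *\<^sub>R Z x = c1 *\<^sub>R Jf X x + c2 *\<^sub>R X x"
    unfolding integrability[OF X Z(1) W] integrability[OF Jf_GQ[OF X] Jf_GQ[OF Z(1)] W] JJ[OF X] JJ[OF Z(1)]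
    by (simp add: a_def b_def c1_def c2_def algebra_simps)
  \<comment> \<open>The left side of eq is the complex number b + a i applied to Z, so multiplication by its conjugate
    b - a i puts a nonzero real multiple of Z into the complex line of X.\<close>
  have "Jp x (a *\<^sub>R Jf Z x + b *\<^sub>R Z x) = Jp x (c1 *\<^sub>R Jf X x + c2 *\<^sub>R X x)" using eq by simp
  then have eq2: "b *\<^sub>R Jf Z x - a *\<^sub>R Z x = c2 *\<^sub>R Jf X x - c1 *\<^sub>R X x"
    using np_GQ[OF Z(1)] np_GQ[OF X] by (simp add: Jf_def)
  have "(a * a + b * b) *\<^sub>R Z x = b *\<^sub>R (a *\<^sub>R Jf Z x + b *\<^sub>R Z x) - a *\<^sub>R (b *\<^sub>R Jf Z x - a *\<^sub>R Z x)"
    by (simp add: algebra_simps)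
  also have "\<dots> = b *\<^sub>R (c1 *\<^sub>R Jf X x + c2 *\<^sub>R X x) - a *\<^sub>R (c2 *\<^sub>R Jf X x - c1 *\<^sub>R X x)"
    by (simp only: eq eq2)
  also have "\<dots> \<in> span {X x, Jf X x}"
    by (intro span_diff span_scale span_add) (auto intro: span_base)
  finally have "(a * a + b * b) *\<^sub>R v \<in> span {X x, Jf X x}" using Z by simp
  moreover have "a * a + b * b \<noteq> 0" using a by (simp add: sum_squares_eq_zero_iff)
  ultimately have "v \<in> span {X x, Jf X x}" using span_scale[of _ _ "inverse (a * a + b * b)"] by fastforce
  then show False using v by simp
qed

text \<open>The diagonal of \<open>Hess_anti_invariant\<close>, rewritten as a second order equation for \<open>f\<close>.\<close>

lemma pluriharmonic:
  assumes q: "CARD('q) \<ge> 3" and f: "smf UNIV f" "\<And>Z x. Z \<in> VF \<Longrightarrow> dv Z f x = \<alpha> x (Z x)" and E: "E \<in> GQ"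
  shows "dv E (dv E f) x + dv (Jf E) (dv (Jf E) f) x - dv (\<lambda>x. nab E E x + nab (Jf E) (Jf E) x) f x = 0"
proof -
  have "dv Z f = (\<lambda>x. \<alpha> x (Z x))" if "Z \<in> VF" for Z using f(2)[OF that] by blast
  then show ?thesis using Hess_anti_invariant[OF q E E, of x] E by (simp add: Hess_def \<alpha>_simps)
qed

end

section \<open>The maximum principle on a compact manifold\<close>

context manifold begin

lemma smooth_imp_continuous:
  assumes "smf UNIV f"
  shows "continuous_on UNIV f"
proof (rule continuous_at_imp_continuous_on, rule ballI)
  fix x
  define c where "c = chart_at A x"
  have c: "c \<in> A" "x \<in> fst c" by (simp_all add: c_def)
  have 1: "continuous_on (snd c ` fst c) (f \<circ> chart_inv c)"
    using smooth_on_continuous[OF smooth_fun_on_chartD[OF assms c(1)]] by simp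
  have 2: "continuous_on (fst c) (snd c)" using chart_homeo[OF c(1)] by (simp add: homeomorphism_def)
  have "continuous_on (fst c) (\<lambda>z. (f \<circ> chart_inv c) (snd c z))"
    by (rule continuous_on_compose2[OF 1 2]) simp
  then have "continuous_on (fst c) f"
    by (rule continuous_on_cong[THEN iffD1, rotated 2]) (use c in auto)
  then show "isCont f x" using chart_open[OF c(1)] c(2) continuous_on_eq_continuous_at by blast
qed

lemma chart_ball_open:
  assumes "c \<in> A"
  shows "open {z \<in> fst c. snd c z \<in> ball y r}"
proof -
  have "open (fst c \<inter> snd c -` ball y r)"
    using chart_homeo[OF assms] chart_open[OF assms] by (intro continuous_open_preimage) (auto simp: homeomorphism_def)
  then show ?thesis by (simp add: Int_def vimage_def)
qed

text \<open>Each point has a neighbourhood that is homeomorphic to a ball and hence connected.\<close>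

lemma connected_component_open: "open (connected_component_set UNIV (x::'a))"
proof (rule topological_space_class.openI)
  fix y assume y: "y \<in> connected_component_set UNIV x"
  define c where "c = chart_at A y"
  have c: "c \<in> A" "y \<in> fst c" by (simp_all add: c_def)
  obtain r where r: "r > 0" "ball (snd c y) r \<subseteq> snd c ` fst c"
    using open_contains_ball[THEN iffD1, OF chart_image_open[OF c(1)]] c(2) by blast
  define B where "B = {z \<in> fst c. snd c z \<in> ball (snd c y) r}"
  have "B = chart_inv c ` ball (snd c y) r" 
  proof (intro set_eqI iffI)
    fix z assume "z \<in> B"
    then show "z \<in> chart_inv c ` ball (snd c y) r"
      using c(1) by (intro image_eqI[of _ _ "snd c z"]) (auto simp: B_def)
  next
    fix z assume "z \<in> chart_inv c ` ball (snd c y) r"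
    then obtain w where w: "z = chart_inv c w" "w \<in> ball (snd c y) r" by blast
    then obtain v where "v \<in> fst c" "w = snd c v" using r(2) by blast
    then show "z \<in> B" using w c(1) by (simp add: B_def)
  qed
  moreover have "connected (chart_inv c ` ball (snd c y) r)"
  proof (rule connected_continuous_image[OF _ connected_ball])
    have "continuous_on (snd c ` fst c) (chart_inv c)" using chart_homeo[OF c(1)] by (simp add: homeomorphism_def)
    then show "continuous_on (ball (snd c y) r) (chart_inv c)" using r(2) by (rule continuous_on_subset)
  qed
  ultimately have "connected B" by simp
  moreover have yB: "y \<in> B" using r(1) c(2) by (simp add: B_def)
  ultimately have "B \<subseteq> connected_component_set UNIV y" by (intro connected_component_maximal) auto
  moreover have "connected_component_set UNIV y = connected_component_set UNIV x"
    using y by (simp add: connected_component_eq)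
  ultimately show "\<exists>T. open T \<and> y \<in> T \<and> T \<subseteq> connected_component_set UNIV x"
    using yB chart_ball_open[OF c(1)] by (intro exI[of _ B]) (auto simp: B_def)
qed

end

context projective_kaehler begin

text \<open>The equations of \<open>pluriharmonic\<close> for the normal parts of a local frame, together with \<open>Z (Z f) = 0\<close> for
the leaf parts \<open>Z\<close>, add up to one equation. Its second order fields span the tangent space, since each
frame field is the sum of its two parts, so it is elliptic in every direction of \<open>M\<close>.\<close>

lemma local_maximum_constant:
  assumes q: "CARD('q) \<ge> 3" and f: "smf UNIV f" "\<And>Z x. Z \<in> VF \<Longrightarrow> dv Z f x = \<alpha> x (Z x)"
    and U: "open U" "p \<in> U" "\<And>z. z \<in> U \<Longrightarrow> f z \<le> f p"
  obtains N where "open N" "p \<in> N" "\<And>z. z \<in> N \<Longrightarrow> f z = f p"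
proof -
  define c where "c = chart_at A p"
  have c: "c \<in> A" "p \<in> fst c" by (simp_all add: c_def)
  obtain \<rho> N E a where fr: "smf UNIV (\<rho> :: 'a \<Rightarrow> real)" "open N" "p \<in> N" "N \<subseteq> fst c" "\<And>z. z \<in> N \<Longrightarrow> \<rho> z = 1"
    and E: "\<And>i. E i \<in> vfields A" "\<And>i z. z \<in> N \<Longrightarrow> E i z = Sc c z (axis i 1)"
    by (rule local_frame[OF c]) blast
  define V :: "'n \<times> nat \<Rightarrow> ('a, 'n) vfield" where
    "V l = (if snd l = 0 then npart (E (fst l)) else if snd l = 1 then Jf (npart (E (fst l))) else lpart (E (fst l)))" for l
  define I where "I = (UNIV :: 'n set) \<times> {0, 1, 2::nat}"
  define T where "T i = (\<lambda>x. nab (npart (E i)) (npart (E i)) x + nab (Jf (npart (E i))) (Jf (npart (E i))) x)" for i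
  define W where "W = (\<lambda>x. \<Sum>i\<in>UNIV. T i x)"
  have V: "V l \<in> VF" for l using E(1) by (auto simp: V_def)
  have T: "T i \<in> VF" for i using E(1) by (auto simp: T_def)
  have W: "W \<in> VF" using T by (simp add: W_def)
  have eqn: "(\<Sum>l\<in>I. dv (V l) (dv (V l) f) x) - dv W f x = 0" for x
  proof -
    have "dv (lpart (E i)) f = (\<lambda>x. 0)" for i
      using f(2)[of "lpart (E i)"] \<alpha>_GL[OF lpart_GL[OF E(1)]] E(1) by auto
    then have "(\<Sum>l\<in>I. dv (V l) (dv (V l) f) x) =
        (\<Sum>i\<in>UNIV. dv (npart (E i)) (dv (npart (E i)) f) x + dv (Jf (npart (E i))) (dv (Jf (npart (E i))) f) x)"
      by (simp add: I_def V_def sum.cartesian_product')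
    also have "\<dots> = (\<Sum>i\<in>UNIV. dv (T i) f x)"
      using pluriharmonic[OF q f npart_GQ[OF E(1)]] by (intro sum.cong) (simp_all add: T_def)
    also have "\<dots> = dv W f x" using f(2) T W by (simp add: W_def linear_sum[OF \<alpha>_linear])
    finally show ?thesis by simp
  qed
  define S where "S = snd c ` (fst c \<inter> (U \<inter> N))"
  have S: "open S" unfolding S_def by (rule chart_image_open_subset[OF c(1)]) (use U fr in auto)
  have Sx: "\<exists>x. x \<in> fst c \<and> x \<in> U \<and> x \<in> N \<and> y = snd c x" if "y \<in> S" for y using that by (auto simp: S_def)
  have "snd c p \<in> S" using c(2) U(2) fr(3) by (auto simp: S_def)
  then obtain r where r: "r > 0" "ball (snd c p) r \<subseteq> S" using S open_contains_ball by blast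
  define u where "u = f \<circ> chart_inv c"
  define Vc where "Vc l = components A c (V l)" for l
  \<comment> \<open>The first order part: the terms from the squares of the fields (dv_twice_chart) and the terms with the
    connection, collected in W.\<close>
  define b where "b y = (\<Sum>l\<in>I. frechet_derivative (Vc l) (at y) (Vc l y)) - components A c W y" for y
  have u: "smooth_on S u" unfolding u_def
    by (rule smooth_on_subset[OF smooth_fun_on_chartD[OF f(1) c(1)]]) (auto simp: S_def)
  have comp: "smooth_on S (components A c X)" if "X \<in> VF" for X
    using that c(1) smooth_on_subset[of "snd c ` fst c" "components A c X" S] by (auto simp: vfields_def S_def)
  have Vs: "smooth_on S (Vc l)" for l unfolding Vc_def by (rule comp[OF V])
  have bs: "smooth_on S b" unfolding b_def
    by (rule smooth_on_diff[OF S smooth_on_sum[OF S smooth_on_frechet_apply[OF S Vs Vs]] comp[OF W]])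
  have const: "u z = u (snd c p)" if z: "z \<in> ball (snd c p) (r / 2)" for z
  proof (rule strong_maximum_principle[where I = I and R = r and V = Vc and b = b
        and u' = "\<lambda>y. frechet_derivative u (at y)"
        and u'' = "\<lambda>y h. frechet_derivative (\<lambda>x. frechet_derivative u (at x) h) (at y)"])
    show "finite I" by (simp add: I_def)
    show "r > 0" by (rule r(1))
    show "z \<in> ball (snd c p) (r / 2)" by (rule z)
    show "continuous_on (ball (snd c p) r) (Vc l)" for l
      by (rule smooth_on_continuous[OF smooth_on_subset[OF Vs r(2)]])
    show "continuous_on (ball (snd c p) r) b"
      by (rule smooth_on_continuous[OF smooth_on_subset[OF bs r(2)]])
    fix y assume "y \<in> ball (snd c p) r"
    then have y: "y \<in> S" using r(2) by blast
    then obtain x where x: "x \<in> fst c" "x \<in> U" "x \<in> N" "y = snd c x" using Sx by blast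
    show "(u has_derivative frechet_derivative u (at y)) (at y)" by (rule smooth_on_has_derivative[OF u y])
    show "((\<lambda>x. frechet_derivative u (at x) h) has_derivative
        frechet_derivative (\<lambda>x. frechet_derivative u (at x) h) (at y)) (at y)" for h
      by (rule smooth_on_has_derivative[OF smooth_on_frechet[OF u] y])
    show "u y \<le> u (snd c p)" using U(3)[OF x(2)] x c by (simp add: u_def)
    note lin = smooth_on_linear_frechet[OF u y]
    have "dv (V l) (dv (V l) f) x = frechet_derivative (\<lambda>x. frechet_derivative u (at x) (Vc l y)) (at y) (Vc l y)
        + frechet_derivative u (at y) (frechet_derivative (Vc l) (at y) (Vc l y))" for l
      using dv_twice_chart[OF open_UNIV f(1) UNIV_I vfields_vf_on[OF V] vfields_vf_on[OF V] c(1) x(1), of l l]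
      by (simp add: u_def Vc_def x(4))
    moreover have "dv W f x = frechet_derivative u (at y) (components A c W y)"
      using dv_chart[OF f(1) UNIV_I c(1) x(1), of W] by (simp add: u_def x(4))
    ultimately show "(\<Sum>l\<in>I. frechet_derivative (\<lambda>x. frechet_derivative u (at x) (Vc l y)) (at y) (Vc l y))
        + frechet_derivative u (at y) (b y) = 0"
      using eqn[of x] by (simp add: b_def linear_diff[OF lin] linear_sum[OF lin] sum.distrib)
    fix \<xi> :: "real^'n" assume \<xi>: "\<xi> \<noteq> 0"
    show "\<exists>l\<in>I. Vc l y \<bullet> \<xi> \<noteq> 0"
    proof (rule ccontr)
      assume "\<not> ?thesis"
      then have z: "Vc (i, k) y \<bullet> \<xi> = 0" if "k \<in> {0, 1, 2}" for i k using that by (auto simp: I_def)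
      have "\<xi> $ i = 0" for i
      proof -
        have "axis i 1 = Tc c x (E i x)" using E(2)[OF x(3), of i] c(1) x(1) by simp
        also have "\<dots> = Tc c x (npart (E i) x + lpart (E i) x)" by (simp add: npart_fun lpart_fun)
        also have "\<dots> = Vc (i, 0) y + Vc (i, 2) y"
          using components_chart[OF c(1) x(1)] by (simp add: Vc_def V_def x(4) linear_add[OF Tc_linear[OF c(1) x(1)]])
        finally have "axis i 1 \<bullet> \<xi> = 0" using z[of 0 i] z[of 2 i] by (simp add: inner_add_left)
        then show ?thesis by (simp add: inner_axis')
      qed
      then show False using \<xi> by (simp add: vec_eq_iff)
    qed
  qed
  show thesis
  proof (rule that)
    show "open {z \<in> fst c. snd c z \<in> ball (snd c p) (r / 2)}" by (rule chart_ball_open[OF c(1)])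
    show "p \<in> {z \<in> fst c. snd c z \<in> ball (snd c p) (r / 2)}" using c(2) r(1) by simp
    show "f z = f p" if "z \<in> {z \<in> fst c. snd c z \<in> ball (snd c p) (r / 2)}" for z
      using const[of "snd c z"] that c by (simp add: u_def)
  qed
qed

text \<open>On the connected component of \<open>x\<close> the maximum of the potential is attained by compactness, and the set
where it is attained is open by \<open>local_maximum_constant\<close>.\<close>

lemma \<alpha>_zero:
  assumes q: "CARD('q) \<ge> 3" and comp: "compact (UNIV :: 'a set)" and X: "X \<in> VF"
  shows "\<alpha> x (X x) = 0"
proof -
  obtain f :: "'a \<Rightarrow> real" where f: "smf UNIV f" "\<And>Z x. Z \<in> VF \<Longrightarrow> dv Z f x = \<alpha> x (Z x)" by (rule potential) blast
  define C where "C = connected_component_set UNIV x"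
  have C: "open C" "closed C" "connected C" "x \<in> C"
    by (auto simp: C_def connected_component_open closed_connected_component)
  have cont: "continuous_on UNIV f" by (rule smooth_imp_continuous[OF f(1)])
  have "compact C" using compact_Int_closed[OF comp C(2)] by simp
  then obtain p where p: "p \<in> C" "\<And>z. z \<in> C \<Longrightarrow> f z \<le> f p"
    using continuous_attains_sup[of C f] continuous_on_subset[OF cont] C(4) by blast
  define P where "P = {z. f z = f p}"
  have "closed P" unfolding P_def using cont by (intro closed_Collect_eq) auto
  have "open (C \<inter> P)"
  proof (rule topological_space_class.openI)
    fix z assume z: "z \<in> C \<inter> P"
    then have "f w \<le> f z" if "w \<in> C" for w using p(2)[OF that] by (simp add: P_def)
    moreover have "z \<in> C" using z by simp
    ultimately obtain N where N: "open N" "z \<in> N" "\<And>w. w \<in> N \<Longrightarrow> f w = f z"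
      using local_maximum_constant[OF q f C(1), of z] by metis
    have "open (N \<inter> C)" "z \<in> N \<inter> C" using N(1,2) C(1) z by auto
    moreover have "N \<inter> C \<subseteq> C \<inter> P" using N(3) z by (auto simp: P_def)
    ultimately show "\<exists>T. open T \<and> z \<in> T \<and> T \<subseteq> C \<inter> P" by blast
  qed
  then have "C \<inter> P \<inter> C = {} \<or> (- P) \<inter> C = {}"
    by (intro connectedD[OF C(3)]) (use \<open>closed P\<close> in auto)
  then have const: "f z = f p" if "z \<in> C" for z using that p(1) by (auto simp: P_def)
  have "dv X f x = 0"
    using dv_local[OF smooth_fun_on_const[of UNIV "f p"] UNIV_I C(1,4), of f X] const by simp
  then show ?thesis using f(2)[OF X] by simp
qed

end

section \<open>Transversal projective fields are affine\<close>

theorem theorem4p5: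
  fixes A :: "('a::{t2_space,second_countable_topology}, 'n::finite) chart set"
    and g :: "('a, 'n) metric"
    and F :: "('a, 'q::finite) cocycle"
    and D :: "('a, 'n) connection"
    and J :: "'a \<Rightarrow> real^'n \<Rightarrow> real^'n"
    and m :: nat
    and s :: "('a, 'n) vfield"
  assumes "smooth_atlas A"
    and "compact (UNIV :: 'a set)"
    and "riemannian_metric A g"
    and "levi_civita A g D"
    and "kaehler_foliation A g F D J"
    and "CARD('q) = 2 * m" and "m \<ge> 2"
    and "transversal_projective_field A g F D s"
  shows "transversal_affine_field A g F D s"
proof -
  obtain Y \<alpha> where Y_props: "Y \<in> infinitesimal_automorphisms A F" "s = normal_part A g F Y" "basic_1form A F \<alpha>"
    and proj: "\<And>X Z x. X \<in> sections_Q A g F \<Longrightarrow> Z \<in> sections_Q A g F \<Longrightarrow>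
      lie_connection A g F D Y X Z x = \<alpha> x (X x) *\<^sub>R Z x + \<alpha> x (Z x) *\<^sub>R X x"
    using assms(8) unfolding transversal_projective_field_def by blast
  interpret projective_kaehler A g F D J Y \<alpha>
  proof
    show "smooth_atlas A" "riemannian_metric A g" "levi_civita A g D"
      "Y \<in> infinitesimal_automorphisms A F" "basic_1form A F \<alpha>"
      by (fact assms(1) assms(3) assms(4) Y_props(1) Y_props(3))+
    show "foliation A F" "bundle_like A g F" "almost_complex_structure A g F J"
      using assms(5) unfolding kaehler_foliation_def by blast+
    show "g x (J x (s x)) (J x (t x)) = g x (s x) (t x)"
      if "s \<in> sections_Q A g F" "t \<in> sections_Q A g F" for s t x
      using assms(5) that unfolding kaehler_foliation_def by blast
    show "transversal_connection A g F D X (\<lambda>x. J x (s x)) x = J x (transversal_connection A g F D X s x)"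
      if "X \<in> vfields A" "s \<in> sections_Q A g F" for X s x
      using assms(5) that unfolding kaehler_foliation_def by blast
    show "lie_connection A g F D Y X Z x = \<alpha> x (X x) *\<^sub>R Z x + \<alpha> x (Z x) *\<^sub>R X x"
      if "X \<in> sections_Q A g F" "Z \<in> sections_Q A g F" for X Z x
      by (rule proj[OF that])
  qed
  have "CARD('q) \<ge> 3" using assms(6,7) by simp
  from \<alpha>_zero[OF this assms(2)]
  have "lie_connection A g F D Y Z X x = 0" if "Z \<in> sections_Q A g F" "X \<in> sections_Q A g F" for Z X x
    using proj[OF that] that by simp
  then show ?thesis using Y_props(1,2) unfolding transversal_affine_field_def by blast
qed

end
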